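(* Let $\Omega\subset\mathbb{R}^d$ be compact with $d\ge2$, let $X_1,X_2,\ldots$ be i.i.d. in $\Omega$ with density $\varphi_P$ and $Y_1,Y_2,\ldots$ i.i.d. in $\Omega$ with density $\varphi_D$, all independent, and let $L^*(n)$ be the length of the optimal stacker crane tour through the pairs $(X_i,Y_i)$, $i=1,\ldots,n$. Let $X,Y$ be independent with densities $\varphi_P,\varphi_D$. If $d\ge3$, $$\limsup_{n\to\infty}\frac{L^*(n)-n\bigl[\mathbb{E}\|Y-X\|+W(\varphi_D,\varphi_P)\bigr]}{n^{1-1/d}}\le\kappa(\varphi_P,\varphi_D)\quad\text{almost surely},$$ where $\kappa(\varphi_P,\varphi_D)=\min_{\phi\in\{\varphi_P,\varphi_D\}}\beta_{M,d}\int_\Omega\phi(x)^{1-1/d}\,dx$. If $d=2$, there is a positive constant $\gamma$ such that, with probability tending to $1$ as $n\to\infty$, $$\frac{L^*(n)-n\bigl[\mathbb{E}\|Y-X\|+W(\varphi_D,\varphi_P)\bigr]}{\sqrt{n\log n}}\le\gamma.$$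
   Context: A stacker crane tour through pairs $(x_i,y_i)$ is a closed tour through all $x_i,y_i$ in which each pickup $x_i$ is immediately followed by its delivery $y_i$; its length is the sum of Euclidean distances along the tour. $W(\varphi_1,\varphi_2)=\inf_{\gamma\in\Gamma(\varphi_1,\varphi_2)}\int_{\Omega\times\Omega}\|y-x\|\,d\gamma(x,y)$ is the Euclidean Wasserstein distance, with $\Gamma(\varphi_1,\varphi_2)$ the set of measures on $\Omega\times\Omega$ with marginal densities $\varphi_1,\varphi_2$. For $d\ge3$, $\beta_{M,d}$ denotes the constant (known to exist from prior work) such that, whenever two independent $n$-point samples are i.i.d. from the same distribution on a compact $\Omega\subset\mathbb{R}^d$ with density $\varphi$, their optimal bipartite matching cost $L$ satisfies $\lim_n L/n^{1-1/d}=\beta_{M,d}\int_\Omega\overline{\varphi}(x)^{1-1/d}dx$ almost surely ($\overline\varphi$ the density of the absolutely continuous part). The densities are densities of absolutely continuous distributions. *)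

theory Defs
  imports "HOL-Probability.Probability"
begin

definition sc_tour_length ::
  "(nat \<Rightarrow> 'a::metric_space) \<Rightarrow> (nat \<Rightarrow> 'a) \<Rightarrow> nat \<Rightarrow> (nat \<Rightarrow> nat) \<Rightarrow> real" where
  "sc_tour_length x y n \<sigma> =
     (\<Sum>k<n. dist (x (\<sigma> k)) (y (\<sigma> k)) + dist (y (\<sigma> k)) (x (\<sigma> (Suc k mod n))))"

definition stacker_crane_opt ::
  "(nat \<Rightarrow> 'a::metric_space) \<Rightarrow> (nat \<Rightarrow> 'a) \<Rightarrow> nat \<Rightarrow> real" where
  "stacker_crane_opt x y n = Min {sc_tour_length x y n \<sigma> | \<sigma>. \<sigma> permutes {..<n}}"

definition matching_cost ::
  "(nat \<Rightarrow> 'a::metric_space) \<Rightarrow> (nat \<Rightarrow> 'a) \<Rightarrow> nat \<Rightarrow> real" where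
  "matching_cost u v n = Min {(\<Sum>i<n. dist (u i) (v (\<sigma> i))) | \<sigma>. \<sigma> permutes {..<n}}"

definition couplings ::
  "'a::euclidean_space set \<Rightarrow> ('a \<Rightarrow> real) \<Rightarrow> ('a \<Rightarrow> real) \<Rightarrow> ('a \<times> 'a) measure set" where
  "couplings \<Omega> \<phi>1 \<phi>2 = {\<gamma>. sets \<gamma> = sets borel \<and>
      emeasure \<gamma> (space \<gamma> - \<Omega> \<times> \<Omega>) = 0 \<and>
      distr \<gamma> borel fst = density lborel (\<lambda>x. ennreal (\<phi>1 x)) \<and>
      distr \<gamma> borel snd = density lborel (\<lambda>x. ennreal (\<phi>2 x))}"

definition wasserstein ::
  "'a::euclidean_space set \<Rightarrow> ('a \<Rightarrow> real) \<Rightarrow> ('a \<Rightarrow> real) \<Rightarrow> real" where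
  "wasserstein \<Omega> \<phi>1 \<phi>2 =
     enn2real (INF \<gamma>\<in>couplings \<Omega> \<phi>1 \<phi>2. \<integral>\<^sup>+ z. ennreal (norm (snd z - fst z)) \<partial>\<gamma>)"

text \<open>The defining property of the constant beta_{M,d} (d = DIM('a)): for every compact
  Omega and every pair of independent i.i.d. samples with common density phi on Omega,
  the optimal matching cost L_n satisfies L_n / n^(1-1/d) -> beta * int_Omega phi^(1-1/d)
  almost surely.  The sample space type is made explicit by the first argument.\<close>
definition beta_M_property :: "'m itself \<Rightarrow> 'a::euclidean_space itself \<Rightarrow> real \<Rightarrow> bool" where
  "beta_M_property _ _ \<beta> \<longleftrightarrow>
    (\<forall>(M::'m measure) (\<Omega>::'a set) (\<phi>::'a \<Rightarrow> real) (U::nat \<Rightarrow> 'm \<Rightarrow> 'a) (V::nat \<Rightarrow> 'm \<Rightarrow> 'a).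
       prob_space M \<and> compact \<Omega> \<and> (\<forall>x. 0 \<le> \<phi> x) \<and>
       (\<forall>i. distributed M lborel (U i) (\<lambda>x. ennreal (\<phi> x))) \<and>
       (\<forall>i. distributed M lborel (V i) (\<lambda>x. ennreal (\<phi> x))) \<and>
       (\<forall>i. AE \<omega> in M. U i \<omega> \<in> \<Omega> \<and> V i \<omega> \<in> \<Omega>) \<and>
       prob_space.indep_vars M (\<lambda>_. borel) (case_sum U V) UNIV
       \<longrightarrow> (AE \<omega> in M.
             (\<lambda>n. matching_cost (\<lambda>i. U i \<omega>) (\<lambda>i. V i \<omega>) n
                    / real n powr (1 - 1 / real DIM('a)))
             \<longlonglongrightarrow> \<beta> * (\<integral>x\<in>\<Omega>. \<phi> x powr (1 - 1 / real DIM('a)) \<partial>lborel)))"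

end

theory Submission
  imports Defs "HOL-Combinatorics.Cycles" "HOL-Probability.Hoeffding" "HOL-Real_Asymp.Real_Asymp"
begin

text \<open>An optimal matching of deliveries to pickups yields a union of closed subtours, one for each
  cycle of the matching permutation. Since the labels of the deliveries are exchangeable, this
  permutation may be taken uniformly random, so merging the subtours costs only \<open>O(log n)\<close> in
  expectation. Drawing the samples from a nearly optimal coupling of the two densities bounds the
  expected matching cost by \<open>n W\<close> plus the expected matching cost of two samples from one and the
  same density, whichever of the two is chosen. The latter is governed by \<open>\<beta>\<^sub>M\<close> if \<open>d \<ge> 3\<close>. If \<open>d = 2\<close>, it is
  \<open>O(sqrt (n log n))\<close> for every law on a compact set: by duality the cost is the supremum of
  the discrepancies of Lipschitz functions; on a grid of mesh \<open>n\<^sup>-\<^sup>1\<^sup>/\<^sup>2\<close> their Dirichlet energy is bounded,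
  and the dual energy of the empirical difference has expectation \<open>O(log n)\<close> after normalisation.
  All costs have bounded differences, so McDiarmid's inequality turns bounds in expectation into
  almost sure bounds (\<open>d \<ge> 3\<close>) and bounds in probability (\<open>d = 2\<close>).\<close>

section \<open>Stacker crane tours and permutations\<close>

text \<open>Two obstacles shape the argument. The constant \<open>\<beta>\<close> is known only
  through an almost sure limit, for two samples of one density, on sample spaces of type
  \<open>'m\<close>; couplings and relabellings, on the other hand, compare laws and say nothing
  about single outcomes. Expectations are therefore the common currency: they depend only on the
  marginal laws of an independent family, so a coupled sample may live on a product space of its own
  and be compared with the original one afterwards. Concentration is used in both directions, to
  extract the expected matching cost from the almost sure limit and to return from the expected tour
  length to almost every outcome. The two samples of one law that the comparison requires are found
  on the original space: the pickups alone, or the deliveries alone, are split by the parity of the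
  index, which is why either density may be chosen. Fluctuations are of order sqrt n, below n^(2/3)
  \<le> n^(1-1/d) for d \<ge> 3 and below sqrt (n log n) for d = 2.\<close>

lemma finite_permutation_costs: "finite {F \<sigma> | \<sigma>. \<sigma> permutes {..<n::nat}}"
proof -
  have "{F \<sigma> | \<sigma>. \<sigma> permutes {..<n}} = F ` {\<sigma>. \<sigma> permutes {..<n}}" by auto
  then show ?thesis by (simp add: finite_permutations)
qed

lemma permutation_costs_nonempty: "{F \<sigma> | \<sigma>. \<sigma> permutes {..<n::nat}} \<noteq> {}"
  using permutes_id by blast

lemma Min_permutation_costs_le:
  fixes F :: "(nat \<Rightarrow> nat) \<Rightarrow> real"
  assumes "\<sigma> permutes {..<n::nat}"
  shows "Min {F \<sigma> | \<sigma>. \<sigma> permutes {..<n}} \<le> F \<sigma>"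
  by (rule Min_le[OF finite_permutation_costs]) (use assms in auto)

lemma Min_permutation_costs_attained:
  fixes F :: "(nat \<Rightarrow> nat) \<Rightarrow> real"
  shows "\<exists>\<sigma>. \<sigma> permutes {..<n::nat} \<and> Min {F \<sigma> | \<sigma>. \<sigma> permutes {..<n}} = F \<sigma>"
  using Min_in[OF finite_permutation_costs permutation_costs_nonempty, of F n] by auto

lemma matching_cost_le:
  "\<sigma> permutes {..<n} \<Longrightarrow> matching_cost u v n \<le> (\<Sum>i<n. dist (u i) (v (\<sigma> i)))"
  unfolding matching_cost_def by (rule Min_permutation_costs_le)

lemma matching_cost_attained:
  "\<exists>\<sigma>. \<sigma> permutes {..<n} \<and> matching_cost u v n = (\<Sum>i<n. dist (u i) (v (\<sigma> i)))"
  unfolding matching_cost_def by (rule Min_permutation_costs_attained)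

lemma stacker_crane_opt_le:
  "\<sigma> permutes {..<n} \<Longrightarrow> stacker_crane_opt x y n \<le> sc_tour_length x y n \<sigma>"
  unfolding stacker_crane_opt_def by (rule Min_permutation_costs_le)

lemma stacker_crane_opt_attained:
  "\<exists>\<sigma>. \<sigma> permutes {..<n} \<and> stacker_crane_opt x y n = sc_tour_length x y n \<sigma>"
  unfolding stacker_crane_opt_def by (rule Min_permutation_costs_attained)

lemma matching_cost_nonneg: "0 \<le> matching_cost u v n"
  using matching_cost_attained[of n u v] by (metis sum_nonneg zero_le_dist)

lemma finite_permutations_differ:
  assumes "\<rho> permutes {..<n::nat}" "\<tau> permutes {..<n}"
  shows "finite {i. \<rho> i \<noteq> \<tau> i}"
proof (rule finite_subset)
  show "{i. \<rho> i \<noteq> \<tau> i} \<subseteq> {..<n}"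
    using permutes_not_in[OF assms(1)] permutes_not_in[OF assms(2)] by (metis (mono_tags, lifting) mem_Collect_eq subsetI)
qed simp

section \<open>Cyclic permutations and the merging of subtours\<close>

definition rotation :: "nat \<Rightarrow> nat \<Rightarrow> nat \<Rightarrow> nat" where
  "rotation n m k = (if k < n then (k + m) mod n else k)"

lemma rotation_permutes: "rotation n m permutes {..<n}"
proof (rule bij_imp_permutes)
  have "((k + m) mod n + (n - m mod n)) mod n = k" if "k < n" for k
  proof -
    have "m mod n < n" using that by simp
    then have "k + m + (n - m mod n) = k + n * (m div n + 1)"
      using mult_div_mod_eq[of n m] unfolding distrib_left by linarith
    then show ?thesis using that by (simp only: mod_add_left_eq mod_mult_self2 mod_less)
  qed
  then have "inj_on (rotation n m) {..<n}"
    unfolding inj_on_def rotation_def by (metis lessThan_iff)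
  moreover have "rotation n m ` {..<n} \<subseteq> {..<n}"
    by (auto simp: rotation_def)
  ultimately show "bij_betw (rotation n m) {..<n} {..<n}"
    by (simp add: bij_betw_def endo_inj_surj)
qed (auto simp: rotation_def)

text \<open>Permutations that form a single cycle on {..<n}. The witness \<open>s\<close> lists the
  cycle in the form in which \<open>sc_tour_length\<close> expects an order of visits, so it can
  serve as a tour directly.\<close>

definition cyclic_perm :: "nat \<Rightarrow> (nat \<Rightarrow> nat) \<Rightarrow> bool" where
  "cyclic_perm n \<rho> \<longleftrightarrow> \<rho> permutes {..<n} \<and>
     (\<exists>s. s permutes {..<n} \<and> (\<forall>k<n. \<rho> (s k) = s (Suc k mod n)))"

lemma cyclic_perm_start:
  assumes "cyclic_perm n \<rho>" "b < n"
  obtains s where "s permutes {..<n}" "s 0 = b" "\<And>k. k < n \<Longrightarrow> \<rho> (s k) = s (Suc k mod n)"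
proof -
  obtain s where s: "s permutes {..<n}" "\<forall>k<n. \<rho> (s k) = s (Suc k mod n)"
    using assms by (auto simp: cyclic_perm_def)
  obtain m where m: "s m = b" "m < n"
    using s(1) assms(2) by (metis lessThan_iff permutes_def permutes_in_image)
  define r where "r = s \<circ> rotation n m"
  have "r permutes {..<n}"
    unfolding r_def by (rule permutes_compose[OF rotation_permutes s(1)])
  moreover have "r 0 = b" using m by (simp add: r_def rotation_def)
  moreover have "\<rho> (r k) = r (Suc k mod n)" if "k < n" for k
  proof -
    have "Suc ((k + m) mod n) mod n = (Suc k mod n + m) mod n"
      by (simp add: mod_simps)
    then show ?thesis using that s(2) by (simp add: r_def rotation_def)
  qed
  ultimately show ?thesis using that by blast
qed

text \<open>The transposition splices \<open>n\<close> into the cycle just before \<open>b\<close>: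
  the predecessor of \<open>b\<close> is sent to \<open>n\<close>, and \<open>n\<close> to
  \<open>b\<close>. An enumeration that starts at \<open>b\<close> lists the longer cycle without
  change, as \<open>s n = n\<close> already puts \<open>n\<close> last.\<close>

lemma cyclic_perm_insert:
  assumes "cyclic_perm n \<rho>" "b < n"
  shows "cyclic_perm (Suc n) (Transposition.transpose n b \<circ> \<rho>)"
proof -
  obtain s where s: "s permutes {..<n}" "s 0 = b" "\<And>k. k < n \<Longrightarrow> \<rho> (s k) = s (Suc k mod n)"
    using cyclic_perm_start[OF assms] by blast
  have \<rho>: "\<rho> permutes {..<n}" using assms by (simp add: cyclic_perm_def)
  have sub: "{..<n} \<subseteq> {..<Suc n}" by auto
  have sn: "s n = n" and \<rho>n: "\<rho> n = n"
    using s(1) \<rho> by (auto simp: permutes_def)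
  have inj: "inj s" using s(1) by (rule permutes_inj)
  have slt: "s k < n" if "k < n" for k using that s(1) by (metis lessThan_iff permutes_in_image)
  have "(Transposition.transpose n b \<circ> \<rho>) (s k) = s (Suc k mod Suc n)" if k: "k < Suc n" for k
  proof -
    consider "k = n" | "k = n - 1" "k < n" | "Suc k < n" using k by linarith
    then show ?thesis
    proof cases
      case 1 then show ?thesis by (simp add: sn \<rho>n s(2))
    next
      case 2
      then have "Suc k = n" by simp
      then show ?thesis using 2 s(2) s(3)[of k] by (simp add: sn)
    next
      case 3
      then have "s (Suc k) \<noteq> b" using s(2) inj by (metis injD nat.distinct(1))
      moreover have "s (Suc k) \<noteq> n" using slt[OF 3] by simp
      ultimately show ?thesis using 3 s(3)[of k] by (simp add: Transposition.transpose_def)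
    qed
  qed
  moreover have "Transposition.transpose n b \<circ> \<rho> permutes {..<Suc n}"
    by (intro permutes_compose permutes_subset[OF \<rho> sub] permutes_swap_id) (use assms in auto)
  ultimately show ?thesis
    unfolding cyclic_perm_def using permutes_subset[OF s(1) sub] by blast
qed

text \<open>A uniformly random permutation of \<open>{..n}\<close> arises by inserting \<open>n\<close> into one of \<open>{..<n}\<close>. The
  element \<open>n\<close> is a fixed point with probability \<open>1 / (n + 1)\<close>, and only then does the insertion
  cost two further changes.\<close>
lemma random_permutation_near_cyclic:
  assumes "n \<ge> 1"
  shows "\<exists>a :: (nat \<Rightarrow> nat) \<Rightarrow> real.
    (\<forall>\<tau>. \<tau> permutes {..<n} \<longrightarrow> (\<exists>\<rho>. cyclic_perm n \<rho> \<and> real (card {i. \<rho> i \<noteq> \<tau> i}) \<le> a \<tau>)) \<and>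
    (\<Sum>\<tau> | \<tau> permutes {..<n}. a \<tau>) \<le> 2 * fact n * harm n"
  using assms
proof (induction n rule: dec_induct)
  case base
  have "cyclic_perm 1 id"
    by (auto simp: cyclic_perm_def permutes_id intro!: exI[of _ id])
  moreover have "\<tau> x = x" if "\<tau> permutes {..<1}" for \<tau> :: "nat \<Rightarrow> nat" and x
  proof -
    show ?thesis
      using that permutes_in_image[OF that, of 0] by (cases "x < 1") (auto simp: permutes_def)
  qed
  then have "card {i. i \<noteq> \<tau> i} = 0" if "\<tau> permutes {..<1}" for \<tau> :: "nat \<Rightarrow> nat"
    using that by (metis (mono_tags, lifting) Collect_empty_eq card.empty)
  ultimately show ?case
    by (intro exI[of _ "\<lambda>_. 0"]) (auto intro!: exI[of _ id] harm_nonneg simp del: card_0_eq)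
next
  case (step n)
  then obtain a :: "(nat \<Rightarrow> nat) \<Rightarrow> real"
    where a: "\<And>\<tau>. \<tau> permutes {..<n} \<Longrightarrow> \<exists>\<rho>. cyclic_perm n \<rho> \<and> real (card {i. \<rho> i \<noteq> \<tau> i}) \<le> a \<tau>"
      and sum_a: "(\<Sum>\<tau> | \<tau> permutes {..<n}. a \<tau>) \<le> 2 * fact n * harm n" by blast
  \<comment> \<open>The same transposition undoes the insertion of \<open>n\<close>. The bound for
    the shorter permutation carries over, plus 2 if \<open>n\<close> was a fixed point.\<close>
  define a' where "a' \<tau> = a (Transposition.transpose n (\<tau> n) \<circ> \<tau>) + (if \<tau> n = n then 2 else 0)" for \<tau>
  have ins: "{..<Suc n} = insert n {..<n}" by auto
  have fixn: "q n = n" if "q permutes {..<n}" for q using that by (auto simp: permutes_def)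
  have "\<exists>\<rho>. cyclic_perm (Suc n) \<rho> \<and> real (card {i. \<rho> i \<noteq> \<tau> i}) \<le> a' \<tau>"
    if \<tau>: "\<tau> permutes {..<Suc n}" for \<tau>
  proof -
    define b where "b = \<tau> n"
    define q where "q = Transposition.transpose n b \<circ> \<tau>"
    have q: "q permutes {..<n}"
      unfolding q_def b_def using \<tau> permutes_insert_lemma[of \<tau> n "{..<n}"] ins by simp
    have \<tau>q: "\<tau> = Transposition.transpose n b \<circ> q" by (simp add: q_def fun_eq_iff)
    obtain \<rho> where \<rho>: "cyclic_perm n \<rho>" "real (card {i. \<rho> i \<noteq> q i}) \<le> a q" using a[OF q] by blast
    show ?thesis
    proof (cases "b = n")
      case False
      then have b: "b < n" using \<tau> unfolding b_def
        by (metis lessThan_iff less_Suc_eq permutes_in_image)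
      have "{i. (Transposition.transpose n b \<circ> \<rho>) i \<noteq> \<tau> i} = {i. \<rho> i \<noteq> q i}"
        by (rule Collect_cong) (metis comp_apply transpose_involutory \<tau>q)
      then show ?thesis
        using cyclic_perm_insert[OF \<rho>(1) b] \<rho>(2) False by (auto simp: a'_def b_def q_def)
    next
      case True
      have \<rho>p: "\<rho> permutes {..<n}" using \<rho>(1) by (simp add: cyclic_perm_def)
      \<comment> \<open>A fixed point \<open>n\<close> has to join the cycle somewhere. Inserting it
        before 0 changes only the images of the two points that \<open>\<rho>\<close> sends to
        \<open>n\<close> and to 0.\<close>
      have sub: "{i. (Transposition.transpose n 0 \<circ> \<rho>) i \<noteq> \<tau> i} \<subseteq> {i. \<rho> i \<noteq> q i} \<union> {inv \<rho> n, inv \<rho> 0}"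
      proof
        fix i assume "i \<in> {i. (Transposition.transpose n 0 \<circ> \<rho>) i \<noteq> \<tau> i}"
        then have "\<rho> i \<noteq> q i \<or> \<rho> i = n \<or> \<rho> i = 0"
          using True by (auto simp: \<tau>q Transposition.transpose_def split: if_splits)
        then show "i \<in> {i. \<rho> i \<noteq> q i} \<union> {inv \<rho> n, inv \<rho> 0}"
          using permutes_inverses(2)[OF \<rho>p, of i] by auto
      qed
      have fin: "finite {i. \<rho> i \<noteq> q i}" by (rule finite_permutations_differ[OF \<rho>p q])
      have "card {i. (Transposition.transpose n 0 \<circ> \<rho>) i \<noteq> \<tau> i} \<le> card ({i. \<rho> i \<noteq> q i} \<union> {inv \<rho> n, inv \<rho> 0})"
        by (rule card_mono[OF _ sub]) (use fin in auto)
      also have "\<dots> \<le> card {i. \<rho> i \<noteq> q i} + card {inv \<rho> n, inv \<rho> 0}" by (rule card_Un_le)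
      also have "\<dots> \<le> card {i. \<rho> i \<noteq> q i} + 2" by (simp add: card_insert_if)
      finally have "real (card {i. (Transposition.transpose n 0 \<circ> \<rho>) i \<noteq> \<tau> i}) \<le> a' \<tau>"
        using \<rho>(2) True by (simp add: a'_def b_def[symmetric] q_def)
      moreover have "cyclic_perm (Suc n) (Transposition.transpose n 0 \<circ> \<rho>)"
        using step by (intro cyclic_perm_insert[OF \<rho>(1)]) simp
      ultimately show ?thesis by blast
    qed
  qed
  moreover have "(\<Sum>\<tau> | \<tau> permutes {..<Suc n}. a' \<tau>) \<le> 2 * fact (Suc n) * harm (Suc n)"
  proof -
    have "(\<Sum>\<tau> | \<tau> permutes {..<Suc n}. a' \<tau>) =
        (\<Sum>b\<in>insert n {..<n}. \<Sum>q | q permutes {..<n}. a' (Transposition.transpose n b \<circ> q))"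
      unfolding ins by (rule sum_over_permutations_insert) auto
    also have "\<dots> = (\<Sum>b\<in>insert n {..<n}. \<Sum>q | q permutes {..<n}. a q + (if b = n then 2 else 0))"
      by (intro sum.cong refl) (auto simp: a'_def fixn o_assoc[symmetric] fun_eq_iff comp_def intro!: arg_cong[of _ _ a])
    \<comment> \<open>Every insertion point contributes the whole sum of \<open>a\<close>; the
      surplus 2 arises for \<open>b = n\<close> only. Relative to (n+1)! it is 2 / (n+1), twice the
      new term of the harmonic sum.\<close>
    also have "\<dots> = (Suc n) * (\<Sum>q | q permutes {..<n}. a q) + 2 * fact n"
      by (simp add: sum.distrib card_permutations algebra_simps)
    also have "\<dots> \<le> (Suc n) * (2 * fact n * harm n) + 2 * fact n"
      using sum_a by (intro add_mono mult_left_mono) auto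
    also have "\<dots> = 2 * fact (Suc n) * harm (Suc n)"
      by (simp add: harm_Suc field_simps)
    finally show ?thesis .
  qed
  ultimately show ?case by blast
qed

lemma sum_compose_permutation:
  assumes "s permutes {..<n::nat}"
  shows "(\<Sum>k<n. g (s k)) = (\<Sum>i<n. g i)"
  using sum.permute[OF assms, of g] by (simp add: comp_def)

lemma stacker_crane_opt_le_cyclic:
  assumes "cyclic_perm n \<rho>"
  shows "stacker_crane_opt x y n \<le> (\<Sum>i<n. dist (x i) (y i)) + (\<Sum>i<n. dist (y i) (x (\<rho> i)))"
proof -
  obtain s where s: "s permutes {..<n}" "\<forall>k<n. \<rho> (s k) = s (Suc k mod n)"
    using assms by (auto simp: cyclic_perm_def)
  have "sc_tour_length x y n s = (\<Sum>k<n. dist (x (s k)) (y (s k))) + (\<Sum>k<n. dist (y (s k)) (x (\<rho> (s k))))"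
    unfolding sc_tour_length_def using s(2) by (simp add: sum.distrib)
  also have "\<dots> = (\<Sum>i<n. dist (x i) (y i)) + (\<Sum>i<n. dist (y i) (x (\<rho> i)))"
    using sum_compose_permutation[OF s(1), of "\<lambda>i. dist (x i) (y i)"]
      sum_compose_permutation[OF s(1), of "\<lambda>i. dist (y i) (x (\<rho> i))"] by simp
  finally show ?thesis using stacker_crane_opt_le[OF s(1), of x y] by simp
qed

text \<open>The permutation \<open>\<rho>\<close> is fixed before \<open>x\<close> and
  \<open>y\<close> are chosen, so it serves to compare two configurations visited in the same order.
  The formula also shows each point on exactly one loaded and one empty leg.\<close>

lemma sc_tour_length_eq_permutation:
  assumes \<sigma>: "\<sigma> permutes {..<n}"
  obtains \<rho> where "\<rho> permutes {..<n}"
    "\<And>x y. sc_tour_length x y n \<sigma> = (\<Sum>i<n. dist (x i) (y i)) + (\<Sum>i<n. dist (y i) (x (\<rho> i)))"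
proof -
  define \<rho> where "\<rho> = \<sigma> \<circ> rotation n 1 \<circ> inv \<sigma>"
  have \<rho>: "\<rho> permutes {..<n}" unfolding \<rho>_def
    by (intro permutes_compose permutes_inv rotation_permutes \<sigma>)
  have "sc_tour_length x y n \<sigma> = (\<Sum>i<n. dist (x i) (y i)) + (\<Sum>i<n. dist (y i) (x (\<rho> i)))" for x y
  proof -
    have "\<rho> (\<sigma> k) = \<sigma> (Suc k mod n)" if "k < n" for k
      using that by (simp add: \<rho>_def permutes_inverses[OF \<sigma>] rotation_def)
    then have "sc_tour_length x y n \<sigma> = (\<Sum>k<n. dist (x (\<sigma> k)) (y (\<sigma> k))) + (\<Sum>k<n. dist (y (\<sigma> k)) (x (\<rho> (\<sigma> k))))"
      unfolding sc_tour_length_def by (simp add: sum.distrib)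
    then show ?thesis
      using sum_compose_permutation[OF \<sigma>, of "\<lambda>i. dist (x i) (y i)"]
        sum_compose_permutation[OF \<sigma>, of "\<lambda>i. dist (y i) (x (\<rho> i))"] by simp
  qed
  then show ?thesis using that \<rho> by blast
qed

lemma sum_dist_permutation_diff_le:
  fixes y x :: "nat \<Rightarrow> 'a::metric_space"
  assumes "\<And>i j. dist (y i) (x j) \<le> D" "finite {i. \<rho> i \<noteq> \<tau> i}"
  shows "(\<Sum>i<n. dist (y i) (x (\<rho> i))) \<le> (\<Sum>i<n. dist (y i) (x (\<tau> i))) + D * real (card {i. \<rho> i \<noteq> \<tau> i})"
proof -
  have D: "0 \<le> D" using assms(1)[of 0 0] zero_le_dist order_trans by blast
  have "(\<Sum>i<n. dist (y i) (x (\<rho> i))) \<le> (\<Sum>i<n. dist (y i) (x (\<tau> i)) + (if \<rho> i \<noteq> \<tau> i then D else 0))"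
    using assms(1) by (intro sum_mono) (auto intro: add_increasing)
  also have "\<dots> = (\<Sum>i<n. dist (y i) (x (\<tau> i))) + D * real (card ({..<n} \<inter> {i. \<rho> i \<noteq> \<tau> i}))"
    by (simp add: sum.distrib sum.If_cases)
  also have "\<dots> \<le> (\<Sum>i<n. dist (y i) (x (\<tau> i))) + D * real (card {i. \<rho> i \<noteq> \<tau> i})"
    using D assms(2) by (intro add_left_mono mult_left_mono) (auto intro: card_mono)
  finally show ?thesis .
qed

text \<open>A deterministic statement about a fixed configuration: as \<open>\<tau>\<close> runs
  through all relabellings of the deliveries, the matching permutation
  \<open>\<sigma> \<circ> \<tau>\<close> runs through all permutations, so it differs from a cyclic
  one in at most \<open>2 * harm n\<close> places on average. Each such place costs at most
  \<open>D\<close>.\<close>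

lemma stacker_crane_opt_average_le:
  fixes x y :: "nat \<Rightarrow> 'a::metric_space"
  assumes D: "\<And>i j. dist (y i) (x j) \<le> D" and n: "n \<ge> 1"
  shows "(\<Sum>\<tau> | \<tau> permutes {..<n}. stacker_crane_opt x (y \<circ> \<tau>) n - (\<Sum>i<n. dist (x i) (y (\<tau> i))))
    \<le> fact n * (matching_cost y x n + 2 * D * harm n)"
proof -
  obtain a :: "(nat \<Rightarrow> nat) \<Rightarrow> real"
    where a: "\<And>\<tau>. \<tau> permutes {..<n} \<Longrightarrow> \<exists>\<rho>. cyclic_perm n \<rho> \<and> real (card {i. \<rho> i \<noteq> \<tau> i}) \<le> a \<tau>"
      and sum_a: "(\<Sum>\<tau> | \<tau> permutes {..<n}. a \<tau>) \<le> 2 * fact n * harm n"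
    using random_permutation_near_cyclic[OF n] by blast
  have D0: "0 \<le> D" using D[of 0 0] zero_le_dist order_trans by blast
  obtain \<sigma> where \<sigma>: "\<sigma> permutes {..<n}" "matching_cost y x n = (\<Sum>i<n. dist (y i) (x (\<sigma> i)))"
    using matching_cost_attained by blast
  have "stacker_crane_opt x (y \<circ> \<tau>) n - (\<Sum>i<n. dist (x i) (y (\<tau> i))) \<le> matching_cost y x n + D * a (\<sigma> \<circ> \<tau>)"
    if \<tau>: "\<tau> permutes {..<n}" for \<tau>
  proof -
    obtain \<rho> where \<rho>: "cyclic_perm n \<rho>" "real (card {i. \<rho> i \<noteq> (\<sigma> \<circ> \<tau>) i}) \<le> a (\<sigma> \<circ> \<tau>)"
      using a[OF permutes_compose[OF \<tau> \<sigma>(1)]] by blast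
    have fin: "finite {i. \<rho> i \<noteq> (\<sigma> \<circ> \<tau>) i}"
      using \<rho>(1) by (intro finite_permutations_differ[of _ n] permutes_compose \<sigma>(1) \<tau>)
        (simp add: cyclic_perm_def)
    have "stacker_crane_opt x (y \<circ> \<tau>) n - (\<Sum>i<n. dist (x i) (y (\<tau> i))) \<le> (\<Sum>i<n. dist (y (\<tau> i)) (x (\<rho> i)))"
      using stacker_crane_opt_le_cyclic[OF \<rho>(1), of x "y \<circ> \<tau>"] by simp
    also have "\<dots> \<le> (\<Sum>i<n. dist (y (\<tau> i)) (x ((\<sigma> \<circ> \<tau>) i))) + D * real (card {i. \<rho> i \<noteq> (\<sigma> \<circ> \<tau>) i})"
      by (rule sum_dist_permutation_diff_le[of "\<lambda>i. y (\<tau> i)"]) (use D fin in auto)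
    also have "(\<Sum>i<n. dist (y (\<tau> i)) (x ((\<sigma> \<circ> \<tau>) i))) = matching_cost y x n"
      using sum_compose_permutation[OF \<tau>, of "\<lambda>i. dist (y i) (x (\<sigma> i))"] by (simp add: \<sigma>(2))
    finally show ?thesis using mult_left_mono[OF \<rho>(2) D0] by linarith
  qed
  then have "(\<Sum>\<tau> | \<tau> permutes {..<n}. stacker_crane_opt x (y \<circ> \<tau>) n - (\<Sum>i<n. dist (x i) (y (\<tau> i))))
     \<le> (\<Sum>\<tau> | \<tau> permutes {..<n}. matching_cost y x n + D * a (\<sigma> \<circ> \<tau>))"
    by (intro sum_mono) auto
  also have "\<dots> = fact n * matching_cost y x n + D * (\<Sum>\<tau> | \<tau> permutes {..<n}. a (\<sigma> \<circ> \<tau>))"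
    by (simp add: sum.distrib card_permutations sum_distrib_left)
  also have "(\<Sum>\<tau> | \<tau> permutes {..<n}. a (\<sigma> \<circ> \<tau>)) = (\<Sum>\<tau> | \<tau> permutes {..<n}. a \<tau>)"
    using setum_permutations_compose_left[OF \<sigma>(1), of a] by simp
  also have "fact n * matching_cost y x n + D * \<dots> \<le> fact n * matching_cost y x n + D * (2 * fact n * harm n)"
    using sum_a D0 by (intro add_left_mono mult_left_mono)
  finally show ?thesis by (simp add: algebra_simps comp_def)
qed

section \<open>Duality and stability of the matching cost\<close>

fun path_weight :: "('i \<Rightarrow> 'i \<Rightarrow> real) \<Rightarrow> 'i list \<Rightarrow> real" where
  "path_weight w (a # b # r) = w a b + path_weight w (b # r)"
| "path_weight w _ = 0"

lemma path_weight_append: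
  "path_weight w (as @ k # bs) = path_weight w (as @ [k]) + path_weight w (k # bs)"
proof (induction as)
  case (Cons a as) then show ?case by (cases as) auto
qed simp

lemma sum_list_map2_path_weight:
  "sum_list (map2 w (k # bs) (bs @ [l])) = path_weight w (k # bs) + w (last (k # bs)) l"
  by (induction bs arbitrary: k) auto

text \<open>Closing the path gives a cycle permutation. Points outside it are fixed and cost nothing
  since \<open>w i i = 0\<close>, so the assumption on full permutations applies.\<close>

lemma closed_path_weight_nonneg:
  fixes w :: "nat \<Rightarrow> nat \<Rightarrow> real"
  assumes cyc: "\<And>\<sigma>. \<sigma> permutes {..<n} \<Longrightarrow> 0 \<le> (\<Sum>i<n. w i (\<sigma> i))"
    and w0: "\<And>i. w i i = 0"
    and cs: "distinct (k # bs)" "set (k # bs) \<subseteq> {..<n}"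
  shows "0 \<le> path_weight w (k # bs) + w (last (k # bs)) k"
proof -
  define \<sigma> where "\<sigma> = cycle_of_list (k # bs)"
  have \<sigma>: "\<sigma> permutes set (k # bs)" unfolding \<sigma>_def by (rule cycle_permutes)
  have rot: "map \<sigma> (k # bs) = bs @ [k]"
    using cyclic_rotation[OF cs(1), of 1] by (simp add: \<sigma>_def)
  have "0 \<le> (\<Sum>i<n. w i (\<sigma> i))" by (rule cyc[OF permutes_subset[OF \<sigma> cs(2)]])
  also have "\<dots> = (\<Sum>i\<in>set (k # bs). w i (\<sigma> i))"
    using cs(2) \<sigma> w0 by (intro sum.mono_neutral_right) (auto simp: permutes_def)
  also have "\<dots> = sum_list (map (\<lambda>i. w i (\<sigma> i)) (k # bs))"
    using cs(1) by (rule sum.distinct_set_conv_list)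
  also have "map (\<lambda>i. w i (\<sigma> i)) (k # bs) = map2 w (k # bs) (map \<sigma> (k # bs))"
    by (simp only: zip_map2 map_map zip_same_conv_map) (simp add: comp_def)
  also have "sum_list \<dots> = path_weight w (k # bs) + w (last (k # bs)) k"
    unfolding rot by (rule sum_list_map2_path_weight)
  finally show ?thesis .
qed

text \<open>The potential at j is the least weight of a simple path ending in j.\<close>
lemma potential_exists:
  fixes w :: "nat \<Rightarrow> nat \<Rightarrow> real"
  assumes cyc: "\<And>\<sigma>. \<sigma> permutes {..<n} \<Longrightarrow> 0 \<le> (\<Sum>i<n. w i (\<sigma> i))"
    and w0: "\<And>i. w i i = 0"
  shows "\<exists>p. \<forall>j<n. \<forall>k<n. p k \<le> p j + w j k"
proof -
  define P where "P j = {ls. distinct ls \<and> set ls \<subseteq> {..<n} \<and> ls \<noteq> [] \<and> last ls = j}" for j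
  define p where "p j = Min (path_weight w ` P j)" for j
  have finP: "finite (P j)" for j
    by (rule finite_subset[OF _ finite_subset_distinct[of "{..<n}"]]) (auto simp: P_def)
  have neP: "P j \<noteq> {}" if "j < n" for j
  proof -
    have "[j] \<in> P j" using that by (simp add: P_def)
    then show ?thesis by blast
  qed
  have le: "p k \<le> path_weight w ls" if "ls \<in> P k" for k ls
    unfolding p_def using that finP by (intro Min_le) auto
  have "p k \<le> p j + w j k" if j: "j < n" and k: "k < n" for j k
  proof -
    have "p j \<in> path_weight w ` P j"
      unfolding p_def using finP neP[OF j] by (intro Min_in) auto
    then obtain ls where ls: "ls \<in> P j" "p j = path_weight w ls" by auto
    have l: "ls = butlast ls @ [j]" using ls(1) by (auto simp: P_def)
    show ?thesis
    proof (cases "k \<in> set ls")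
      case False
      then have "ls @ [k] \<in> P k" using ls(1) k by (auto simp: P_def)
      then have "p k \<le> path_weight w (butlast ls @ j # [k])" using le l
        by (metis append.assoc append_Cons append_Nil)
      then show ?thesis using ls(2) l by (subst (asm) path_weight_append) simp
    next
      \<comment> \<open>Here appending \<open>k\<close> would repeat a vertex. The path is cut at
        its visit to \<open>k\<close>; the dropped tail, closed by the edge from \<open>j\<close>
        back to \<open>k\<close>, is a cycle and so has nonnegative weight.\<close>
      case True
      then obtain as bs where ab: "ls = as @ k # bs" by (auto simp: in_set_conv_decomp)
      then have "as @ [k] \<in> P k" using ls(1) by (auto simp: P_def)
      then have "p k \<le> path_weight w (as @ [k])" by (rule le)
      moreover have "0 \<le> path_weight w (k # bs) + w (last (k # bs)) k"
        by (rule closed_path_weight_nonneg[where w = w and n = n])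
          (use cyc w0 ls(1) ab in \<open>auto simp: P_def\<close>)
      moreover have "last (k # bs) = j" using ls(1) ab by (auto simp: P_def)
      ultimately show ?thesis using ls(2) ab path_weight_append[of w as k bs] by simp
    qed
  qed
  then show ?thesis by blast
qed

text \<open>Kantorovich duality for finite samples. Optimality of the matching means that no cyclic
  rematching gains, which yields dual prices at the matched points; these extend to a 1-Lipschitz
  function on the whole space.\<close>

lemma matching_cost_dual:
  fixes u v :: "nat \<Rightarrow> 'a::metric_space"
  assumes n: "n \<ge> 1"
  shows "\<exists>f. (\<forall>a b. \<bar>f a - f b\<bar> \<le> dist a b) \<and> matching_cost u v n \<le> (\<Sum>i<n. f (u i) - f (v i))"
proof -
  obtain \<sigma> where \<sigma>: "\<sigma> permutes {..<n}" "matching_cost u v n = (\<Sum>i<n. dist (u i) (v (\<sigma> i)))"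
    using matching_cost_attained by blast
  define v' where "v' i = v (\<sigma> i)" for i
  \<comment> \<open>The extra cost of sending \<open>u i\<close> to the partner of
    \<open>u j\<close>. Its sum over any permutation is nonnegative because the matching is
    optimal.\<close>
  define w where "w i j = dist (u i) (v' j) - dist (u i) (v' i)" for i j
  have "0 \<le> (\<Sum>i<n. w i (\<tau> i))" if "\<tau> permutes {..<n}" for \<tau>
    using matching_cost_le[OF permutes_compose[OF that \<sigma>(1)], of u v]
    by (simp add: w_def v'_def \<sigma>(2) sum_subtractf)
  then obtain p where p: "\<forall>j<n. \<forall>k<n. p k \<le> p j + w j k"
    using potential_exists[of n w] by (auto simp: w_def)
  \<comment> \<open>McShane extension: the largest 1-Lipschitz function with value at most
    \<open>- p j\<close> at each \<open>v' j\<close>.\<close>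
  define f where "f a = Min ((\<lambda>j. dist a (v' j) - p j) ` {..<n})" for a
  have fin: "finite ((\<lambda>j. dist a (v' j) - p j) ` {..<n})" "(\<lambda>j. dist a (v' j) - p j) ` {..<n} \<noteq> {}" for a
    using n by (auto simp: lessThan_empty_iff)
  have half: "f a \<le> f b + dist a b" for a b
  proof -
    obtain j where j: "j < n" "f b = dist b (v' j) - p j"
      using Min_in[OF fin[of b]] unfolding f_def by auto
    have "f a \<le> dist a (v' j) - p j" unfolding f_def using j(1) by (intro Min_le fin) auto
    then show ?thesis using j(2) dist_triangle[of a "v' j" b] by linarith
  qed
  have "\<bar>f a - f b\<bar> \<le> dist a b" for a b
    using half[of a b] half[of b a] by (simp add: dist_commute abs_le_iff)
  moreover have "matching_cost u v n \<le> (\<Sum>i<n. f (u i) - f (v i))"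
  proof -
    \<comment> \<open>Taking \<open>j = i\<close> in the minimum bounds \<open>f (v' i)\<close> from
      above, the potential inequality bounds \<open>f (u i)\<close> from below, and the prices
      \<open>p i\<close> cancel.\<close>
    have "dist (u i) (v' i) \<le> f (u i) - f (v' i)" if i: "i < n" for i
    proof -
      have "f (v' i) \<le> - p i" unfolding f_def
        by (rule order_trans[OF Min_le[OF fin(1)]]) (use i in \<open>auto intro!: image_eqI[of _ _ i]\<close>)
      moreover have "dist (u i) (v' i) - p i \<le> dist (u i) (v' x) - p x" if "x < n" for x
        using p[rule_format, OF i that] by (simp add: w_def)
      then have "dist (u i) (v' i) - p i \<le> f (u i)"
        unfolding f_def by (subst Min_ge_iff[OF fin]) auto
      ultimately show ?thesis by linarith
    qed
    then have "matching_cost u v n \<le> (\<Sum>i<n. f (u i) - f (v' i))"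
      unfolding \<sigma>(2) v'_def by (intro sum_mono) auto
    also have "\<dots> = (\<Sum>i<n. f (u i) - f (v i))"
      using sum_compose_permutation[OF \<sigma>(1), of "\<lambda>i. f (v i)"] by (simp add: sum_subtractf v'_def)
    finally show ?thesis .
  qed
  ultimately show ?thesis by blast
qed

lemma matching_cost_triangle:
  "matching_cost u w n \<le> matching_cost u v n + matching_cost v w n"
proof -
  obtain \<sigma> where \<sigma>: "\<sigma> permutes {..<n}" "matching_cost u v n = (\<Sum>i<n. dist (u i) (v (\<sigma> i)))"
    using matching_cost_attained by blast
  obtain \<tau> where \<tau>: "\<tau> permutes {..<n}" "matching_cost v w n = (\<Sum>i<n. dist (v i) (w (\<tau> i)))"
    using matching_cost_attained by blast
  have "matching_cost u w n \<le> (\<Sum>i<n. dist (u i) (w ((\<tau> \<circ> \<sigma>) i)))"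
    by (rule matching_cost_le[OF permutes_compose[OF \<sigma>(1) \<tau>(1)]])
  also have "\<dots> \<le> (\<Sum>i<n. dist (u i) (v (\<sigma> i)) + dist (v (\<sigma> i)) (w (\<tau> (\<sigma> i))))"
    by (intro sum_mono) (simp add: dist_triangle)
  also have "\<dots> = matching_cost u v n + matching_cost v w n"
    using sum_compose_permutation[OF \<sigma>(1), of "\<lambda>i. dist (v i) (w (\<tau> i))"]
    by (simp add: sum.distrib \<sigma>(2) \<tau>(2))
  finally show ?thesis .
qed

lemma matching_cost_le_sum: "matching_cost u v n \<le> (\<Sum>i<n. dist (u i) (v i))"
  using matching_cost_le[OF permutes_id, of u v n] by simp

section \<open>Stability under a change of one point, and measurability\<close>

lemma Min_permutation_costs_diff_le:
  fixes F G :: "(nat \<Rightarrow> nat) \<Rightarrow> real"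
  assumes "\<And>\<sigma>. \<sigma> permutes {..<n::nat} \<Longrightarrow> F \<sigma> \<le> G \<sigma> + c"
  shows "Min {F \<sigma> | \<sigma>. \<sigma> permutes {..<n}} \<le> Min {G \<sigma> | \<sigma>. \<sigma> permutes {..<n}} + c"
proof -
  obtain \<sigma> where \<sigma>: "\<sigma> permutes {..<n}" "Min {G \<sigma> | \<sigma>. \<sigma> permutes {..<n}} = G \<sigma>"
    using Min_permutation_costs_attained by blast
  show ?thesis using Min_permutation_costs_le[OF \<sigma>(1), of F] assms[OF \<sigma>(1)] \<sigma>(2) by linarith
qed

lemma sum_dist_permutation_update_le:
  fixes y x y' x' :: "nat \<Rightarrow> 'a::metric_space"
  assumes \<rho>: "\<rho> permutes {..<n}"
    and D: "\<And>i j. dist (y i) (x j) \<le> D"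
    and upd: "(\<forall>j. j \<noteq> i \<longrightarrow> y j = y' j) \<and> x = x' \<or> (\<forall>j. j \<noteq> i \<longrightarrow> x j = x' j) \<and> y = y'"
  shows "(\<Sum>k<n. dist (y k) (x (\<rho> k))) \<le> (\<Sum>k<n. dist (y' k) (x' (\<rho> k))) + D"
proof -
  have D0: "0 \<le> D" using D[of 0 0] zero_le_dist order_trans by blast
  \<comment> \<open>The affected summand is \<open>i\<close> for a change in the first family, and
    the index that \<open>\<rho>\<close> sends to \<open>i\<close> for a change in the
    second.\<close>
  obtain l where l: "\<And>k. k \<noteq> l \<Longrightarrow> dist (y k) (x (\<rho> k)) = dist (y' k) (x' (\<rho> k))"
    using upd
  proof
    assume "(\<forall>j. j \<noteq> i \<longrightarrow> x j = x' j) \<and> y = y'"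
    then show ?thesis using that[of "inv \<rho> i"] permutes_inverses[OF \<rho>] by metis
  qed (use that[of i] in auto)
  have "(\<Sum>k<n. dist (y k) (x (\<rho> k))) \<le> (\<Sum>k<n. dist (y' k) (x' (\<rho> k)) + (if k = l then D else 0))"
  proof (rule sum_mono)
    fix k
    show "dist (y k) (x (\<rho> k)) \<le> dist (y' k) (x' (\<rho> k)) + (if k = l then D else 0)"
      using l[of k] D by (cases "k = l") (auto intro: add_increasing)
  qed
  also have "\<dots> \<le> (\<Sum>k<n. dist (y' k) (x' (\<rho> k))) + D"
    using D0 by (simp add: sum.distrib)
  finally show ?thesis .
qed

lemma matching_cost_update_le:
  fixes y x y' x' :: "nat \<Rightarrow> 'a::metric_space"
  assumes "\<And>i j. dist (y i) (x j) \<le> D"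
    and "(\<forall>j. j \<noteq> i \<longrightarrow> y j = y' j) \<and> x = x' \<or> (\<forall>j. j \<noteq> i \<longrightarrow> x j = x' j) \<and> y = y'"
  shows "matching_cost y x n \<le> matching_cost y' x' n + D"
  unfolding matching_cost_def
  using assms by (intro Min_permutation_costs_diff_le sum_dist_permutation_update_le)

text \<open>Each point lies on one loaded and one empty leg, and each of the two sums changes by at
  most \<open>D\<close>; hence the factor 2.\<close>

lemma stacker_crane_opt_update_le:
  fixes y x y' x' :: "nat \<Rightarrow> 'a::metric_space"
  assumes D: "\<And>i j. dist (y i) (x j) \<le> D"
    and upd: "(\<forall>j. j \<noteq> i \<longrightarrow> y j = y' j) \<and> x = x' \<or> (\<forall>j. j \<noteq> i \<longrightarrow> x j = x' j) \<and> y = y'"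
  shows "stacker_crane_opt x y n \<le> stacker_crane_opt x' y' n + 2 * D"
  unfolding stacker_crane_opt_def
proof (rule Min_permutation_costs_diff_le)
  fix \<sigma> assume "\<sigma> permutes {..<n}"
  then obtain \<rho> where \<rho>: "\<rho> permutes {..<n}"
    "\<And>x y. sc_tour_length x y n \<sigma> =
       (\<Sum>i<n. dist (x i) (y i)) + (\<Sum>i<n. dist (y i) (x (\<rho> i) :: 'a))"
    using sc_tour_length_eq_permutation by metis
  have "(\<Sum>k<n. dist (y k) (x k)) \<le> (\<Sum>k<n. dist (y' k) (x' k)) + D"
    using sum_dist_permutation_update_le[OF permutes_id D upd, of n] by simp
  moreover have "(\<Sum>k<n. dist (y k) (x (\<rho> k))) \<le> (\<Sum>k<n. dist (y' k) (x' (\<rho> k))) + D"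
    using sum_dist_permutation_update_le[OF \<rho>(1) D upd] by simp
  ultimately show "sc_tour_length x y n \<sigma> \<le> sc_tour_length x' y' n \<sigma> + 2 * D"
    by (simp add: \<rho>(2) dist_commute)
qed

text \<open>The cost is formally a function of infinite sequences. This locality reduces it to
  finitely many coordinates, as the bounded difference inequality requires.\<close>

lemma matching_cost_cong:
  assumes "\<And>i. i < n \<Longrightarrow> u i = u' i" "\<And>i. i < n \<Longrightarrow> v i = v' i"
  shows "matching_cost u v n = matching_cost u' v' n"
proof -
  have "(\<Sum>i<n. dist (u i) (v (\<sigma> i))) = (\<Sum>i<n. dist (u' i) (v' (\<sigma> i)))" if "\<sigma> permutes {..<n}" for \<sigma>
    using assms permutes_in_image[OF that] by (intro sum.cong) auto
  then show ?thesis unfolding matching_cost_def by (metis (no_types, lifting))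
qed

lemma stacker_crane_opt_cong:
  assumes "\<And>i. i < n \<Longrightarrow> x i = x' i" "\<And>i. i < n \<Longrightarrow> y i = y' i"
  shows "stacker_crane_opt x y n = stacker_crane_opt x' y' n"
proof -
  have "sc_tour_length x y n \<sigma> = sc_tour_length x' y' n \<sigma>" if "\<sigma> permutes {..<n}" for \<sigma>
    unfolding sc_tour_length_def using assms permutes_in_image[OF that]
    by (intro sum.cong) (auto)
  then show ?thesis unfolding stacker_crane_opt_def by (metis (no_types, lifting))
qed

lemma measurable_Min_permutation_costs:
  fixes F :: "'m \<Rightarrow> (nat \<Rightarrow> nat) \<Rightarrow> real"
  assumes "\<And>\<sigma>. \<sigma> permutes {..<n::nat} \<Longrightarrow> (\<lambda>\<omega>. F \<omega> \<sigma>) \<in> borel_measurable M"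
  shows "(\<lambda>\<omega>. Min {F \<omega> \<sigma> | \<sigma>. \<sigma> permutes {..<n}}) \<in> borel_measurable M"
proof -
  have "{F \<omega> \<sigma> | \<sigma>. \<sigma> permutes {..<n}} = (\<lambda>\<sigma>. F \<omega> \<sigma>) ` {\<sigma>. \<sigma> permutes {..<n}}" for \<omega> by auto
  then show ?thesis
    using assms by (simp add: borel_measurable_Min finite_permutations)
qed

lemma measurable_matching_cost [measurable (raw)]:
  fixes u v :: "'m \<Rightarrow> nat \<Rightarrow> 'a::{metric_space, second_countable_topology}"
  assumes "\<And>i. i < n \<Longrightarrow> (\<lambda>\<omega>. u \<omega> i) \<in> borel_measurable M" "\<And>i. i < n \<Longrightarrow> (\<lambda>\<omega>. v \<omega> i) \<in> borel_measurable M"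
  shows "(\<lambda>\<omega>. matching_cost (u \<omega>) (v \<omega>) n) \<in> borel_measurable M"
  unfolding matching_cost_def
proof (rule measurable_Min_permutation_costs)
  fix \<sigma> assume "\<sigma> permutes {..<n}"
  then have "\<sigma> i < n" if "i < n" for i using that permutes_in_image by fastforce
  then show "(\<lambda>\<omega>. \<Sum>i<n. dist (u \<omega> i) (v \<omega> (\<sigma> i))) \<in> borel_measurable M"
    using assms by (intro borel_measurable_sum borel_measurable_dist) auto
qed

lemma measurable_stacker_crane_opt [measurable (raw)]:
  fixes x y :: "'m \<Rightarrow> nat \<Rightarrow> 'a::{metric_space, second_countable_topology}"
  assumes "\<And>i. i < n \<Longrightarrow> (\<lambda>\<omega>. x \<omega> i) \<in> borel_measurable M" "\<And>i. i < n \<Longrightarrow> (\<lambda>\<omega>. y \<omega> i) \<in> borel_measurable M"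
  shows "(\<lambda>\<omega>. stacker_crane_opt (x \<omega>) (y \<omega>) n) \<in> borel_measurable M"
  unfolding stacker_crane_opt_def
proof (rule measurable_Min_permutation_costs)
  fix \<sigma> assume "\<sigma> permutes {..<n}"
  then have "\<sigma> i < n" if "i < n" for i using that permutes_in_image by fastforce
  then show "(\<lambda>\<omega>. sc_tour_length (x \<omega>) (y \<omega>) n \<sigma>) \<in> borel_measurable M"
    unfolding sc_tour_length_def
    using assms by (intro borel_measurable_sum borel_measurable_add borel_measurable_dist) auto
qed

section \<open>Concentration for functions of independent variables\<close>

lemma (in prob_space) integrable_bounded:
  fixes f :: "'a \<Rightarrow> real"
  assumes "f \<in> borel_measurable M" "\<And>x. x \<in> space M \<Longrightarrow> \<bar>f x\<bar> \<le> B"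
  shows "integrable M f"
  using assms by (intro integrable_const_bound[of f B]) auto

lemma (in prob_space) expectation_abs_le:
  fixes f :: "'a \<Rightarrow> real"
  assumes "f \<in> borel_measurable M" "\<And>x. x \<in> space M \<Longrightarrow> \<bar>f x\<bar> \<le> B"
  shows "\<bar>expectation f\<bar> \<le> B"
proof -
  have "\<bar>expectation f\<bar> \<le> expectation (\<lambda>x. \<bar>f x\<bar>)" by (rule integral_abs_bound)
  also have "\<dots> \<le> expectation (\<lambda>_. B)"
    using assms by (intro integral_mono integrable_bounded[of _ "\<bar>B\<bar>"]) (auto intro: order_trans[OF _ abs_ge_self])
  finally show ?thesis by (simp add: prob_space)
qed

text \<open>Any value \<open>f y\<close> is the centre of an interval of length \<open>2 * c\<close>
  that contains the range of \<open>f\<close>. This avoids infimum and supremum, at the price of the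
  constant 1/2 in place of 1/8.\<close>

lemma (in prob_space) Hoeffding_lemma_oscillation:
  fixes f :: "'a \<Rightarrow> real"
  assumes f: "f \<in> borel_measurable M" and l: "l > 0"
    and c: "\<And>x y. x \<in> space M \<Longrightarrow> y \<in> space M \<Longrightarrow> \<bar>f x - f y\<bar> \<le> c"
  shows "expectation (\<lambda>x. exp (l * (f x - expectation f))) \<le> exp (l\<^sup>2 * c\<^sup>2 / 2)"
proof -
  obtain y where y: "y \<in> space M" using not_empty by blast
  interpret interval_bounded_random_variable M f "f y - c" "f y + c"
  proof
    show "random_variable borel f" by fact
    have "f x \<in> {f y - c..f y + c}" if "x \<in> space M" for x using c[OF that y] by (simp add: abs_le_iff)
    then show "AE x in M. f x \<in> {f y - c..f y + c}" by (rule AE_I2)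
  qed
  have eq: "l\<^sup>2 * (f y + c - (f y - c))\<^sup>2 / 8 = l\<^sup>2 * c\<^sup>2 / 2"
    by (simp add: power2_eq_square)
  have "(\<integral>\<^sup>+x. ennreal (exp (l * (f x - expectation f))) \<partial>M) \<le> ennreal (exp (l\<^sup>2 * c\<^sup>2 / 2))"
    using Hoeffdings_lemma_nn_integral[OF l] unfolding eq .
  then show ?thesis by (intro integral_real_bounded) auto
qed

text \<open>McDiarmid's inequality for moment generating functions, by integrating out one
  coordinate at a time. With the others fixed, \<open>f\<close> oscillates by at most
  \<open>c\<close> and Hoeffding's lemma gives one factor; the conditional mean \<open>g\<close>
  inherits bounded differences in the remaining coordinates.\<close>

lemma mcdiarmid_mgf:
  fixes f :: "('i \<Rightarrow> 'a) \<Rightarrow> real"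
  assumes K: "\<And>j. prob_space (K j)" and "finite J"
    and f: "f \<in> borel_measurable (PiM J K)"
    and B: "\<And>z. z \<in> space (PiM J K) \<Longrightarrow> \<bar>f z\<bar> \<le> B"
    and c: "\<And>z j a. z \<in> space (PiM J K) \<Longrightarrow> j \<in> J \<Longrightarrow> a \<in> space (K j) \<Longrightarrow> \<bar>f (z(j := a)) - f z\<bar> \<le> c"
    and l: "l > 0"
  shows "(\<integral>z. exp (l * (f z - integral\<^sup>L (PiM J K) f)) \<partial>PiM J K) \<le> exp (l\<^sup>2 * c\<^sup>2 / 2 * real (card J))"
  using \<open>finite J\<close> f B c
proof (induction J arbitrary: f rule: finite_induct)
  case empty
  interpret product_sigma_finite K
    by (intro product_sigma_finite.intro prob_space_imp_sigma_finite K)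
  show ?case by (simp add: PiM_empty lebesgue_integral_count_space_finite)
next
  case (insert i J)
  interpret product_sigma_finite K
    by (intro product_sigma_finite.intro prob_space_imp_sigma_finite K)
  interpret Ki: prob_space "K i" by (rule K)
  interpret PJ: prob_space "PiM J K" by (rule prob_space_PiM[OF K])
  interpret PI: prob_space "PiM (insert i J) K" by (rule prob_space_PiM[OF K])
  note [measurable] = insert.prems(1)
  define g where "g x = (\<integral>y. f (x(i := y)) \<partial>K i)" for x
  have upd: "x(i := y) \<in> space (PiM (insert i J) K)" if "x \<in> space (PiM J K)" "y \<in> space (K i)" for x y
    using that by (auto simp: space_PiM PiE_def extensional_def)
  have fm: "(\<lambda>y. f (x(i := y))) \<in> borel_measurable (K i)" if "x \<in> space (PiM J K)" for x
    using measurable_comp[OF measurable_component_update[OF that insert.hyps(2)] insert.prems(1)]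
    by (simp add: comp_def)
  have fm2: "(\<lambda>(x, y). f (x(i := y))) \<in> borel_measurable (PiM J K \<Otimes>\<^sub>M K i)"
    using measurable_comp[OF measurable_add_dim insert.prems(1)] by (simp add: comp_def case_prod_beta)
  have gm: "g \<in> borel_measurable (PiM J K)"
    unfolding g_def using fm2 by measurable
  have gB: "\<bar>g x\<bar> \<le> B" if "x \<in> space (PiM J K)" for x
    unfolding g_def by (rule Ki.expectation_abs_le[OF fm[OF that]]) (rule insert.prems(2)[OF upd[OF that]])
  have fint: "integrable (K i) (\<lambda>y. f (x(i := y)))" if "x \<in> space (PiM J K)" for x
    by (rule Ki.integrable_bounded[OF fm[OF that], of B]) (rule insert.prems(2)[OF upd[OF that]])
  have Ef: "integral\<^sup>L (PiM (insert i J) K) f = integral\<^sup>L (PiM J K) g"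
    unfolding g_def
    by (rule product_integral_insert[OF insert.hyps PI.integrable_bounded[OF insert.prems(1,2)]])
  define m where "m = integral\<^sup>L (PiM J K) g"
  have mB: "\<bar>m\<bar> \<le> B" unfolding m_def by (rule PJ.expectation_abs_le[OF gm gB])
  have expB: "\<bar>exp (l * (a - b))\<bar> \<le> exp (l * (2 * B))" if "\<bar>a\<bar> \<le> B" "\<bar>b\<bar> \<le> B" for a b
    using that l by (simp add: abs_le_iff)
  have inner: "(\<integral>y. exp (l * (f (x(i := y)) - m)) \<partial>K i) \<le> exp (l\<^sup>2 * c\<^sup>2 / 2) * exp (l * (g x - m))"
    if x: "x \<in> space (PiM J K)" for x
  proof -
    \<comment> \<open>Split \<open>f - m\<close> into the conditional fluctuation
      \<open>f - g\<close> and the part \<open>g - m\<close>, which is constant in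
      \<open>y\<close>.\<close>
    have "(\<integral>y. exp (l * (f (x(i := y)) - m)) \<partial>K i) =
        (\<integral>y. exp (l * (g x - m)) * exp (l * (f (x(i := y)) - g x)) \<partial>K i)"
      by (simp add: algebra_simps flip: exp_add)
    also have "\<dots> = exp (l * (g x - m)) * (\<integral>y. exp (l * (f (x(i := y)) - g x)) \<partial>K i)"
      by simp
    also have "\<dots> \<le> exp (l * (g x - m)) * exp (l\<^sup>2 * c\<^sup>2 / 2)"
    proof (intro mult_left_mono)
      show "(\<integral>y. exp (l * (f (x(i := y)) - g x)) \<partial>K i) \<le> exp (l\<^sup>2 * c\<^sup>2 / 2)"
        unfolding g_def
      proof (rule Ki.Hoeffding_lemma_oscillation[OF fm[OF x] l])
        fix a b assume ab: "a \<in> space (K i)" "b \<in> space (K i)"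
        show "\<bar>f (x(i := a)) - f (x(i := b))\<bar> \<le> c"
          using insert.prems(3)[of "x(i := b)" i a] upd[OF x ab(2)] ab(1) by (simp only: fun_upd_upd insertI1)
      qed
    qed simp
    finally show ?thesis by (simp add: mult.commute)
  qed
  have "(\<integral>z. exp (l * (f z - m)) \<partial>PiM (insert i J) K) = (\<integral>x. (\<integral>y. exp (l * (f (x(i := y)) - m)) \<partial>K i) \<partial>PiM J K)"
  proof (rule product_integral_insert[OF insert.hyps PI.integrable_bounded[of _ "exp (l * (2 * B))"]])
    show "(\<lambda>z. exp (l * (f z - m))) \<in> borel_measurable (PiM (insert i J) K)" by measurable
  qed (rule expB[OF insert.prems(2) mB])
  also have "\<dots> \<le> (\<integral>x. exp (l\<^sup>2 * c\<^sup>2 / 2) * exp (l * (g x - m)) \<partial>PiM J K)"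
  proof (rule integral_mono)
    show "integrable (PiM J K) (\<lambda>x. \<integral>y. exp (l * (f (x(i := y)) - m)) \<partial>K i)"
    proof (rule PJ.integrable_bounded[of _ "exp (l * (2 * B))"])
      have "(\<lambda>(x, y). exp (l * (f (x(i := y)) - m))) \<in> borel_measurable (PiM J K \<Otimes>\<^sub>M K i)"
        using fm2 by (simp add: case_prod_beta)
      then show "(\<lambda>x. \<integral>y. exp (l * (f (x(i := y)) - m)) \<partial>K i) \<in> borel_measurable (PiM J K)"
        by measurable
      fix x assume x: "x \<in> space (PiM J K)"
      have "(\<lambda>y. exp (l * (f (x(i := y)) - m))) \<in> borel_measurable (K i)"
        using fm[OF x] by simp
      then show "\<bar>\<integral>y. exp (l * (f (x(i := y)) - m)) \<partial>K i\<bar> \<le> exp (l * (2 * B))"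
        by (rule Ki.expectation_abs_le) (rule expB[OF insert.prems(2)[OF upd[OF x]] mB])
    qed
    have "integrable (PiM J K) (\<lambda>x. exp (l * (g x - m)))"
      by (rule PJ.integrable_bounded[of _ "exp (l * (2 * B))"]) (use gm in simp, rule expB[OF gB mB])
    then show "integrable (PiM J K) (\<lambda>x. exp (l\<^sup>2 * c\<^sup>2 / 2) * exp (l * (g x - m)))" by simp
  qed (rule inner)
  also have "\<dots> = exp (l\<^sup>2 * c\<^sup>2 / 2) * (\<integral>x. exp (l * (g x - m)) \<partial>PiM J K)" by simp
  also have "\<dots> \<le> exp (l\<^sup>2 * c\<^sup>2 / 2) * exp (l\<^sup>2 * c\<^sup>2 / 2 * real (card J))"
    unfolding m_def
  proof (intro mult_left_mono insert.IH[OF gm gB])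
    fix z j a assume z: "z \<in> space (PiM J K)" and j: "j \<in> J" and a: "a \<in> space (K j)"
    have ij: "i \<noteq> j" using j insert.hyps(2) by auto
    have z': "z(j := a) \<in> space (PiM J K)"
      using z j a by (auto simp: space_PiM PiE_def extensional_def)
    \<comment> \<open>Updates of different coordinates commute, so the difference of two averages is
      an average of differences bounded by \<open>c\<close>.\<close>
    have "g (z(j := a)) - g z = (\<integral>y. f (z(j := a, i := y)) - f (z(i := y)) \<partial>K i)"
      unfolding g_def by (rule Bochner_Integration.integral_diff[OF fint[OF z'] fint[OF z], symmetric])
    also have "\<bar>\<dots>\<bar> \<le> c"
    proof (rule Ki.expectation_abs_le)
      show "(\<lambda>y. f (z(j := a, i := y)) - f (z(i := y))) \<in> borel_measurable (K i)"
        using fm[OF z] fm[OF z'] by simp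
      fix y assume "y \<in> space (K i)"
      then show "\<bar>f (z(j := a, i := y)) - f (z(i := y))\<bar> \<le> c"
        using insert.prems(3)[of "z(i := y)" j a] upd[OF z] a j
        unfolding fun_upd_twist[OF ij] by blast
    qed
    finally show "\<bar>g (z(j := a)) - g z\<bar> \<le> c" .
  qed auto
  also have "\<dots> = exp (l\<^sup>2 * c\<^sup>2 / 2 * real (card (insert i J)))"
    using insert.hyps by (simp add: algebra_simps flip: exp_add)
  finally show ?case by (simp add: Ef m_def)
qed

text \<open>The bounds on \<open>f\<close> hold only for points of \<open>\<Omega>\<close>.
  Composition with a retraction onto \<open>\<Omega>\<close> makes them global without changing
  \<open>f\<close> along \<open>Z\<close>; then the product estimate applies to the joint law,
  combined with the exponential Markov inequality.\<close>

lemma mcdiarmid_tail: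
  fixes f :: "('i \<Rightarrow> 'a::topological_space) \<Rightarrow> real" and Z :: "'i \<Rightarrow> 'm \<Rightarrow> 'a"
  assumes "prob_space M" and indep: "prob_space.indep_vars M (\<lambda>_. borel) Z J"
    and J: "finite J" "J \<noteq> {}"
    and \<Omega>: "\<Omega> \<in> sets borel" and Z: "\<And>j \<omega>. j \<in> J \<Longrightarrow> \<omega> \<in> space M \<Longrightarrow> Z j \<omega> \<in> \<Omega>"
    and f: "f \<in> borel_measurable (PiM J (\<lambda>_. borel))"
    and dep: "\<And>z z'. (\<And>j. j \<in> J \<Longrightarrow> z j = z' j) \<Longrightarrow> f z = f z'"
    and B: "\<And>z. (\<And>j. z j \<in> \<Omega>) \<Longrightarrow> \<bar>f z\<bar> \<le> B"
    and c: "\<And>z j a. (\<And>j. z j \<in> \<Omega>) \<Longrightarrow> j \<in> J \<Longrightarrow> a \<in> \<Omega> \<Longrightarrow> \<bar>f (z(j := a)) - f z\<bar> \<le> c"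
    and c0: "c > 0" and t: "t > 0"
  shows "measure M {\<omega> \<in> space M. f (\<lambda>j. Z j \<omega>) - (\<integral>\<omega>. f (\<lambda>j. Z j \<omega>) \<partial>M) \<ge> t}
    \<le> exp (- t\<^sup>2 / (2 * c\<^sup>2 * real (card J)))"
proof -
  interpret prob_space M by fact
  obtain \<omega>0 where \<omega>0: "\<omega>0 \<in> space M" using not_empty by blast
  obtain j0 where j0: "j0 \<in> J" using J by blast
  define x0 where "x0 = Z j0 \<omega>0"
  have x0: "x0 \<in> \<Omega>" unfolding x0_def using Z \<omega>0 j0 by blast
  define p where "p x = (if x \<in> \<Omega> then x else x0)" for x
  have p\<Omega>: "p x \<in> \<Omega>" for x using x0 by (simp add: p_def)
  have pm: "p \<in> borel_measurable borel" unfolding p_def using \<Omega> by measurable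
  have rv: "random_variable borel (Z j)" if "j \<in> J" for j
    using indep that by (auto simp: indep_vars_def)
  \<comment> \<open>Indices outside \<open>J\<close> receive some law of the family, because
    \<open>mcdiarmid_mgf\<close> asks for probability measures at all indices.\<close>
  define K where "K j = (if j \<in> J then distr M borel (Z j) else distr M borel (Z j0))" for j
  have K: "prob_space (K j)" for j
    unfolding K_def using rv j0 by (auto intro!: prob_space_distr)
  have Kb: "sets (K j) = sets borel" for j by (simp add: K_def)
  have PK: "sets (PiM J K) = sets (PiM J (\<lambda>_. borel))" by (rule sets_PiM_cong) (auto simp: Kb)
  have law: "distr M (PiM J (\<lambda>_. borel)) (\<lambda>\<omega>. \<lambda>j\<in>J. Z j \<omega>) = PiM J K"
  proof -
    have "distr M (PiM J (\<lambda>_. borel)) (\<lambda>\<omega>. \<lambda>j\<in>J. Z j \<omega>) = PiM J (\<lambda>j. distr M borel (Z j))"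
      using indep_vars_iff_distr_eq_PiM'[of J Z "\<lambda>_. borel"] J rv indep by auto
    also have "\<dots> = PiM J K" by (rule PiM_cong) (auto simp: K_def)
    finally show ?thesis .
  qed
  define g where "g z = f (\<lambda>j. p (z j))" for z
  have gm': "g \<in> borel_measurable (PiM J (\<lambda>_. borel))"
  proof -
    have "g = (\<lambda>z. f (\<lambda>j\<in>J. p (z j)))" unfolding g_def by (intro ext dep) auto
    moreover have "(\<lambda>z. \<lambda>j\<in>J. p (z j)) \<in> measurable (PiM J (\<lambda>_. borel)) (PiM J (\<lambda>_. borel))"
      using pm by (intro measurable_restrict) auto
    ultimately show ?thesis using measurable_compose[OF _ f] by simp
  qed
  then have gm: "g \<in> borel_measurable (PiM J K)" by (simp add: measurable_cong_sets[OF PK refl])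
  have Xm: "(\<lambda>\<omega>. \<lambda>j\<in>J. Z j \<omega>) \<in> measurable M (PiM J (\<lambda>_. borel))"
    using rv by (intro measurable_restrict)
  have gZ: "g (\<lambda>j\<in>J. Z j \<omega>) = f (\<lambda>j. Z j \<omega>)" if "\<omega> \<in> space M" for \<omega>
    unfolding g_def using that Z by (intro dep) (auto simp: p_def)
  have transfer: "(\<integral>z. h (g z) \<partial>PiM J K) = (\<integral>\<omega>. h (f (\<lambda>j. Z j \<omega>)) \<partial>M)"
    if "h \<in> borel_measurable borel" for h :: "real \<Rightarrow> real"
  proof -
    have "(\<integral>z. h (g z) \<partial>PiM J K) = (\<integral>\<omega>. h (g (\<lambda>j\<in>J. Z j \<omega>)) \<partial>M)"
      unfolding law[symmetric] by (intro integral_distr[OF Xm] measurable_compose[OF gm' that])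
    also have "\<dots> = (\<integral>\<omega>. h (f (\<lambda>j. Z j \<omega>)) \<partial>M)" by (intro Bochner_Integration.integral_cong) (simp_all add: gZ)
    finally show ?thesis .
  qed
  define m where "m = (\<integral>\<omega>. f (\<lambda>j. Z j \<omega>) \<partial>M)"
  have m: "m = integral\<^sup>L (PiM J K) g" unfolding m_def using transfer[of "\<lambda>x. x"] by simp
  have N: "real (card J) > 0" using J by (simp add: card_gt_0_iff)
  \<comment> \<open>The minimiser of the exponent
    \<open>l\<^sup>2 * c\<^sup>2 / 2 * card J - l * t\<close>.\<close>
  define l where "l = t / (c\<^sup>2 * real (card J))"
  have l: "l > 0" unfolding l_def using t c0 N by simp
  have fZm: "(\<lambda>\<omega>. f (\<lambda>j. Z j \<omega>)) \<in> borel_measurable M"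
    using measurable_compose[OF Xm gm'] by (rule measurable_cong[THEN iffD1, rotated]) (rule gZ)
  have fB: "\<bar>f (\<lambda>j. Z j \<omega>)\<bar> \<le> B" if "\<omega> \<in> space M" for \<omega>
  proof -
    have "f (\<lambda>j. Z j \<omega>) = f (\<lambda>j. p (Z j \<omega>))" by (rule dep) (use Z that in \<open>simp add: p_def\<close>)
    then show ?thesis using B[of "\<lambda>j. p (Z j \<omega>)"] p\<Omega> by simp
  qed
  have mB: "\<bar>m\<bar> \<le> B" unfolding m_def by (rule expectation_abs_le[OF fZm fB])
  have "measure M {\<omega> \<in> space M. f (\<lambda>j. Z j \<omega>) - m \<ge> t}
      = measure M {\<omega> \<in> space M. exp (l * (f (\<lambda>j. Z j \<omega>) - m)) \<ge> exp (l * t)}"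
    using l by simp
  also have "\<dots> \<le> (\<integral>\<omega>. exp (l * (f (\<lambda>j. Z j \<omega>) - m)) \<partial>M) / exp (l * t)"
  proof (rule integral_Markov_inequality_measure[where A = "{}"])
    have "\<bar>exp (l * (f (\<lambda>j. Z j \<omega>) - m))\<bar> \<le> exp (l * (2 * B))" if "\<omega> \<in> space M" for \<omega>
      using fB[OF that] mB l by (simp add: abs_le_iff)
    then show "integrable M (\<lambda>\<omega>. exp (l * (f (\<lambda>j. Z j \<omega>) - m)))"
      by (rule integrable_bounded[rotated]) (use fZm in measurable)
  qed auto
  also have "(\<integral>\<omega>. exp (l * (f (\<lambda>j. Z j \<omega>) - m)) \<partial>M) = (\<integral>z. exp (l * (g z - m)) \<partial>PiM J K)"
    using transfer[of "\<lambda>x. exp (l * (x - m))"] by simp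
  also have "\<dots> \<le> exp (l\<^sup>2 * c\<^sup>2 / 2 * real (card J))"
    unfolding m
  proof (rule mcdiarmid_mgf[OF K J(1) gm _ _ l])
    show "\<bar>g z\<bar> \<le> B" for z unfolding g_def by (rule B[OF p\<Omega>])
    fix z j a assume "j \<in> J"
    have "(\<lambda>k. p ((z(j := a)) k)) = (\<lambda>k. p (z k))(j := p a)" by auto
    then show "\<bar>g (z(j := a)) - g z\<bar> \<le> c"
      unfolding g_def using c[of "\<lambda>k. p (z k)" j "p a"] p\<Omega> \<open>j \<in> J\<close> by simp
  qed
  also have "exp (l\<^sup>2 * c\<^sup>2 / 2 * real (card J)) / exp (l * t) = exp (l\<^sup>2 * c\<^sup>2 / 2 * real (card J) - l * t)"
    by (simp add: exp_diff)
  also have "l\<^sup>2 * c\<^sup>2 / 2 * real (card J) - l * t = - t\<^sup>2 / (2 * c\<^sup>2 * real (card J))"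
    unfolding l_def using N c0 by (simp add: field_simps power2_eq_square)
  finally show ?thesis unfolding m_def by (simp add: divide_right_mono)
qed

section \<open>Relabelling and transfer of independent families; second moments\<close>

lemma (in prob_space) indep_vars_reindex:
  assumes indep: "indep_vars N X I" and h: "inj_on h J" "h ` J \<subseteq> I"
  shows "indep_vars (\<lambda>j. N (h j)) (\<lambda>j. X (h j)) J"
proof -
  have "indep_sets (\<lambda>j. F (h j)) J" if F: "indep_sets F I" for F :: "'b \<Rightarrow> 'a set set"
    unfolding indep_sets_def
  proof (intro conjI ballI allI impI)
    fix j assume "j \<in> J" then show "F (h j) \<subseteq> events" using F h by (auto simp: indep_sets_def)
  next
    fix K A assume K: "K \<subseteq> J" "K \<noteq> {}" "finite K" and A: "A \<in> (\<Pi> j\<in>K. F (h j))"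
    define A' where "A' i = A (inv_into K h i)" for i
    have inj: "inj_on h K" using h K inj_on_subset by blast
    have A'h: "A' (h k) = A k" if "k \<in> K" for k unfolding A'_def using inj that by simp
    have "prob (\<Inter>i\<in>h ` K. A' i) = (\<Prod>i\<in>h ` K. prob (A' i))"
    proof (rule indep_setsD[OF F])
      show "h ` K \<subseteq> I" using K(1) h(2) by blast
      show "\<forall>i\<in>h ` K. A' i \<in> F i" using A A'h by (auto simp: Pi_iff)
    qed (use K in auto)
    then show "prob (\<Inter>j\<in>K. A j) = (\<Prod>j\<in>K. prob (A j))"
      using inj A'h by (simp add: prod.reindex)
  qed
  from this[of "\<lambda>i. {X i -` A \<inter> space M |A. A \<in> sets (N i)}"] show ?thesis
    using indep h unfolding indep_vars_def2 by auto
qed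

text \<open>Independence turns the joint law into the product of the marginals, so families with
  equal marginals are interchangeable in expectation, even on sample spaces of different types. This
  carries coupled samples back to the original space.\<close>

lemma indep_vars_expectation_eq:
  fixes f :: "('i \<Rightarrow> 'a::topological_space) \<Rightarrow> real"
  assumes "prob_space M" "prob_space M'"
    and "prob_space.indep_vars M (\<lambda>_. borel) Z UNIV" "prob_space.indep_vars M' (\<lambda>_. borel) Z' UNIV"
    and law: "\<And>j. distr M borel (Z j) = distr M' borel (Z' j)"
    and f: "f \<in> borel_measurable (PiM UNIV (\<lambda>_. borel))"
  shows "(\<integral>\<omega>. f (\<lambda>j. Z j \<omega>) \<partial>M) = (\<integral>\<omega>. f (\<lambda>j. Z' j \<omega>) \<partial>M')"
proof -
  have *: "(\<integral>\<omega>. f (\<lambda>j. Z j \<omega>) \<partial>M) = (\<integral>z. f z \<partial>PiM UNIV (\<lambda>j. distr M borel (Z j)))"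
    if "prob_space M" "prob_space.indep_vars M (\<lambda>_. borel) Z UNIV"
    for M :: "'x measure" and Z :: "'i \<Rightarrow> 'x \<Rightarrow> 'a"
  proof -
    interpret prob_space M by fact
    have rv: "random_variable borel (Z j)" for j using that(2) by (auto simp: indep_vars_def)
    have "distr M (PiM UNIV (\<lambda>_. borel)) (\<lambda>\<omega>. \<lambda>j\<in>UNIV. Z j \<omega>) = PiM UNIV (\<lambda>j. distr M borel (Z j))"
      using indep_vars_iff_distr_eq_PiM[of UNIV Z "\<lambda>_. borel"] rv that(2) by auto
    then have "(\<integral>z. f z \<partial>PiM UNIV (\<lambda>j. distr M borel (Z j)))
       = (\<integral>z. f z \<partial>distr M (PiM UNIV (\<lambda>_. borel)) (\<lambda>\<omega>. \<lambda>j\<in>UNIV. Z j \<omega>))" by simp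
    also have "\<dots> = (\<integral>\<omega>. f (\<lambda>j\<in>UNIV. Z j \<omega>) \<partial>M)"
      using rv f by (intro integral_distr measurable_restrict) auto
    finally show ?thesis by (simp add: restrict_UNIV)
  qed
  show ?thesis using *[OF assms(1,3)] *[OF assms(2,4)] law by simp
qed

lemma (in prob_space) expectation_sum_square_le:
  fixes X :: "'i \<Rightarrow> 'a \<Rightarrow> real"
  assumes indep: "indep_vars (\<lambda>_. borel) X J" and J: "finite J"
    and bnd: "\<And>j \<omega>. j \<in> J \<Longrightarrow> \<omega> \<in> space M \<Longrightarrow> \<bar>X j \<omega>\<bar> \<le> b"
    and E0: "\<And>j. j \<in> J \<Longrightarrow> expectation (X j) = 0"
  shows "expectation (\<lambda>\<omega>. (\<Sum>j\<in>J. X j \<omega>)\<^sup>2) \<le> real (card J) * b\<^sup>2"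
proof -
  have rv: "random_variable borel (X j)" if "j \<in> J" for j
    using indep that by (auto simp: indep_vars_def)
  have prod_bnd: "\<bar>X i \<omega> * X j \<omega>\<bar> \<le> b\<^sup>2" if "i \<in> J" "j \<in> J" "\<omega> \<in> space M" for i j \<omega>
    unfolding power2_eq_square abs_mult
    using bnd[OF that(1,3)] bnd[OF that(2,3)] by (intro mult_mono) auto
  have int: "integrable M (\<lambda>\<omega>. X i \<omega> * X j \<omega>)" if "i \<in> J" "j \<in> J" for i j
    using rv that prod_bnd by (intro integrable_bounded[of _ "b\<^sup>2"]) auto
  have off: "expectation (\<lambda>\<omega>. X i \<omega> * X j \<omega>) = 0" if ij: "i \<in> J" "j \<in> J" "i \<noteq> j" for i j
  proof -
    have "indep_vars (\<lambda>_. borel) X {i, j}" by (rule indep_vars_subset[OF indep]) (use ij in auto)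
    then have "expectation (\<lambda>\<omega>. \<Prod>k\<in>{i, j}. X k \<omega>) = (\<Prod>k\<in>{i, j}. expectation (X k))"
      using ij rv bnd by (intro indep_vars_lebesgue_integral) (auto intro!: integrable_bounded)
    then show ?thesis using ij E0 by simp
  qed
  have "expectation (\<lambda>\<omega>. (\<Sum>j\<in>J. X j \<omega>)\<^sup>2) = expectation (\<lambda>\<omega>. \<Sum>i\<in>J. \<Sum>j\<in>J. X i \<omega> * X j \<omega>)"
    by (simp add: power2_eq_square sum_product)
  also have "\<dots> = (\<Sum>i\<in>J. \<Sum>j\<in>J. expectation (\<lambda>\<omega>. X i \<omega> * X j \<omega>))"
    using int by simp
  also have "\<dots> = (\<Sum>i\<in>J. \<Sum>j\<in>J. if i = j then expectation (\<lambda>\<omega>. X i \<omega> * X i \<omega>) else 0)"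
    using off by (intro sum.cong refl) auto
  also have "\<dots> = (\<Sum>i\<in>J. expectation (\<lambda>\<omega>. X i \<omega> * X i \<omega>))"
    using J by simp
  also have "\<dots> \<le> (\<Sum>i\<in>J. b\<^sup>2)"
  proof (rule sum_mono)
    fix i assume i: "i \<in> J"
    have "\<bar>expectation (\<lambda>\<omega>. X i \<omega> * X i \<omega>)\<bar> \<le> b\<^sup>2"
      using rv[OF i] prod_bnd[OF i i] by (intro expectation_abs_le) auto
    then show "expectation (\<lambda>\<omega>. X i \<omega> * X i \<omega>) \<le> b\<^sup>2" by linarith
  qed
  finally show ?thesis by simp
qed

section \<open>Fourier analysis on the discrete torus\<close>

text \<open>Orthogonality is taken over the characters \<open>r\<close>, for two fixed points: this
  form gives Fourier inversion at once, and inversion gives Parseval. On the torus \<open>K\<close>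
  is the number of characters.\<close>

locale character_table =
  fixes R :: "'r set" and S :: "'x set" and E :: "'r \<Rightarrow> 'x \<Rightarrow> complex" and K :: real
  assumes finite_R: "finite R" and finite_S: "finite S" and K_pos: "K > 0"
    and orthogonal: "\<And>x y. x \<in> S \<Longrightarrow> y \<in> S \<Longrightarrow>
      (\<Sum>r\<in>R. E r x * cnj (E r y)) = (if x = y then complex_of_real K else 0)"
begin

definition ft :: "('x \<Rightarrow> real) \<Rightarrow> 'r \<Rightarrow> complex" where
  "ft g r = (\<Sum>x\<in>S. complex_of_real (g x) * cnj (E r x))"

lemma ft_inversion:
  assumes y: "y \<in> S"
  shows "(\<Sum>r\<in>R. ft g r * E r y) = complex_of_real (K * g y)"
proof -
  have "(\<Sum>r\<in>R. ft g r * E r y) = (\<Sum>r\<in>R. \<Sum>x\<in>S. complex_of_real (g x) * (E r y * cnj (E r x)))"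
    by (simp add: ft_def sum_distrib_right sum_distrib_left mult_ac)
  also have "\<dots> = (\<Sum>x\<in>S. complex_of_real (g x) * (\<Sum>r\<in>R. E r y * cnj (E r x)))"
    by (subst sum.swap) (simp add: sum_distrib_left)
  also have "\<dots> = (\<Sum>x\<in>S. if y = x then complex_of_real (g y) * complex_of_real K else 0)"
    using y by (intro sum.cong refl) (auto simp: orthogonal)
  also have "\<dots> = complex_of_real (K * g y)" using y finite_S by (simp add: mult.commute)
  finally show ?thesis .
qed

lemma ft_parseval: "(\<Sum>r\<in>R. (cmod (ft g r))\<^sup>2) = K * (\<Sum>x\<in>S. (g x)\<^sup>2)"
proof -
  have "complex_of_real (\<Sum>r\<in>R. (cmod (ft g r))\<^sup>2) = (\<Sum>r\<in>R. ft g r * cnj (ft g r))"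
    by (simp only: of_real_sum complex_norm_square)
  also have "\<dots> = (\<Sum>r\<in>R. \<Sum>x\<in>S. complex_of_real (g x) * (ft g r * E r x))"
  proof (intro sum.cong refl)
    fix r
    have "cnj (ft g r) = (\<Sum>x\<in>S. complex_of_real (g x) * E r x)" by (simp add: ft_def)
    then show "ft g r * cnj (ft g r) = (\<Sum>x\<in>S. complex_of_real (g x) * (ft g r * E r x))"
      by (simp add: sum_distrib_left mult_ac)
  qed
  also have "\<dots> = (\<Sum>x\<in>S. complex_of_real (g x) * (\<Sum>r\<in>R. ft g r * E r x))"
    by (subst sum.swap) (simp add: sum_distrib_left)
  also have "\<dots> = (\<Sum>x\<in>S. complex_of_real (g x) * complex_of_real (K * g x))"
    by (intro sum.cong refl) (simp add: ft_inversion)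
  also have "\<dots> = complex_of_real (K * (\<Sum>x\<in>S. (g x)\<^sup>2))"
    by (simp add: sum_distrib_left power2_eq_square mult_ac)
  finally show ?thesis using of_real_eq_iff by blast
qed

text \<open>Characters are eigenfunctions of the shift \<open>s\<close>. Since
  \<open>cmod ch = 1\<close>, conjugation inverts the eigenvalue, and reindexing by \<open>s\<close>
  moves the shift from \<open>g\<close> to the character.\<close>

lemma ft_shift_difference:
  assumes s: "bij_betw s S S" and ch: "\<And>x. x \<in> S \<Longrightarrow> E r (s x) = ch * E r x" "cmod ch = 1"
  shows "ft (\<lambda>x. g (s x) - g x) r = (ch - 1) * ft g r"
proof -
  have "ch * cnj (E r (s x)) = cnj (E r x)" if "x \<in> S" for x
    using ch(1)[OF that] ch(2) complex_norm_square[of ch] by (simp add: mult_ac)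
  then have "(\<Sum>x\<in>S. complex_of_real (g (s x)) * cnj (E r x)) =
      (\<Sum>x\<in>S. ch * (complex_of_real (g (s x)) * cnj (E r (s x))))"
    by (intro sum.cong refl) (metis mult.left_commute)
  also have "\<dots> = ch * ft g r"
    unfolding ft_def sum_distrib_left[symmetric]
    using sum.reindex_bij_betw[OF s, of "\<lambda>x. complex_of_real (g x) * cnj (E r x)"] by simp
  finally have "(\<Sum>x\<in>S. complex_of_real (g (s x)) * cnj (E r x)) = ch * ft g r" .
  then show ?thesis by (simp add: ft_def algebra_simps sum_subtractf)
qed

lemma ft_shift_energy_le:
  assumes s: "bij_betw s S S"
    and ch: "\<And>r x. r \<in> R \<Longrightarrow> x \<in> S \<Longrightarrow> E r (s x) = ch r * E r x" "\<And>r. r \<in> R \<Longrightarrow> cmod (ch r) = 1"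
    and h: "\<And>x. x \<in> S \<Longrightarrow> \<bar>g (s x) - g x\<bar> \<le> h"
  shows "(\<Sum>r\<in>R. (cmod (ch r - 1))\<^sup>2 * (cmod (ft g r))\<^sup>2) \<le> K * (real (card S) * h\<^sup>2)"
proof -
  have "(\<Sum>r\<in>R. (cmod (ch r - 1))\<^sup>2 * (cmod (ft g r))\<^sup>2) = (\<Sum>r\<in>R. (cmod (ft (\<lambda>x. g (s x) - g x) r))\<^sup>2)"
  proof (intro sum.cong refl)
    fix r assume r: "r \<in> R"
    show "(cmod (ch r - 1))\<^sup>2 * (cmod (ft g r))\<^sup>2 = (cmod (ft (\<lambda>x. g (s x) - g x) r))\<^sup>2"
      using ft_shift_difference[OF s ch(1)[OF r] ch(2)[OF r], of g]
      by (simp add: norm_mult power_mult_distrib)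
  qed
  also have "\<dots> = K * (\<Sum>x\<in>S. (g (s x) - g x)\<^sup>2)" by (rule ft_parseval)
  also have "\<dots> \<le> K * (\<Sum>x\<in>S. h\<^sup>2)"
  proof (intro mult_left_mono sum_mono)
    fix x assume "x \<in> S"
    then show "(g (s x) - g x)\<^sup>2 \<le> h\<^sup>2" using power_mono[OF h abs_ge_zero, of x 2] by simp
  qed (use K_pos in simp)
  finally show ?thesis by simp
qed

text \<open>The Dirichlet energy of g controls its Fourier coefficients weighted by lam; by
  Cauchy-Schwarz the discrepancy is then bounded by the dual norm of the empirical difference.\<close>
lemma discrepancy_bound:
  assumes s1: "bij_betw s1 S S" and s2: "bij_betw s2 S S"
    and cha: "\<And>r x. r \<in> R \<Longrightarrow> x \<in> S \<Longrightarrow> E r (s1 x) = cha r * E r x" "\<And>r. r \<in> R \<Longrightarrow> cmod (cha r) = 1"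
    and chb: "\<And>r x. r \<in> R \<Longrightarrow> x \<in> S \<Longrightarrow> E r (s2 x) = chb r * E r x" "\<And>r. r \<in> R \<Longrightarrow> cmod (chb r) = 1"
    and h1: "\<And>x. x \<in> S \<Longrightarrow> \<bar>g (s1 x) - g x\<bar> \<le> h"
    and h2: "\<And>x. x \<in> S \<Longrightarrow> \<bar>g (s2 x) - g x\<bar> \<le> h"
    and lam: "\<And>r. r \<in> R \<Longrightarrow> lam r = (cmod (cha r - 1))\<^sup>2 + (cmod (chb r - 1))\<^sup>2"
      "\<And>r. r \<in> R \<Longrightarrow> r \<noteq> r0 \<Longrightarrow> lam r > 0"
    and r0: "\<And>x. x \<in> S \<Longrightarrow> E r0 x = 1"
    and zw: "\<And>i. i < n \<Longrightarrow> z i \<in> S" "\<And>i. i < n \<Longrightarrow> w i \<in> S"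
  shows "(\<Sum>i<n. g (z i) - g (w i))\<^sup>2 \<le> 2 * h\<^sup>2 * (real (card S) / K) *
    (\<Sum>r\<in>R - {r0}. (cmod (\<Sum>i<n. E r (z i) - E r (w i)))\<^sup>2 / lam r)"
proof -
  define T where "T r = (\<Sum>i<n. E r (z i) - E r (w i))" for r
  define Q where "Q = (\<Sum>r\<in>R - {r0}. (cmod (T r))\<^sup>2 / lam r)"
  define G where "G = (\<Sum>i<n. g (z i) - g (w i))"
  \<comment> \<open>Both samples have \<open>n\<close> points, so the constant character cancels. It
    is the one frequency at which \<open>lam\<close> may vanish and must be removed before
    dividing.\<close>
  have T0: "T r0 = 0" unfolding T_def using zw r0 by simp
  have "complex_of_real (K * G) = (\<Sum>i<n. complex_of_real (K * g (z i)) - complex_of_real (K * g (w i)))"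
    by (simp add: G_def sum_distrib_left right_diff_distrib)
  also have "\<dots> = (\<Sum>i<n. (\<Sum>r\<in>R. ft g r * E r (z i)) - (\<Sum>r\<in>R. ft g r * E r (w i)))"
    using zw by (intro sum.cong refl) (simp add: ft_inversion del: of_real_mult)
  also have "\<dots> = (\<Sum>i<n. \<Sum>r\<in>R. ft g r * (E r (z i) - E r (w i)))"
    by (simp add: sum_subtractf right_diff_distrib)
  also have "\<dots> = (\<Sum>r\<in>R. ft g r * T r)"
    unfolding T_def sum_distrib_left by (rule sum.swap)
  also have "\<dots> = (\<Sum>r\<in>R - {r0}. ft g r * T r)"
    using finite_R T0 by (intro sum.mono_neutral_right) auto
  finally have "cmod (complex_of_real (K * G)) \<le> (\<Sum>r\<in>R - {r0}. cmod (ft g r * T r))"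
    by (simp only: norm_sum)
  also have "\<dots> = (\<Sum>r\<in>R - {r0}. (sqrt (lam r) * cmod (ft g r)) * (cmod (T r) / sqrt (lam r)))"
    using lam(2) by (intro sum.cong refl) (force simp: norm_mult)
  finally have "\<bar>K * G\<bar> \<le> (\<Sum>r\<in>R - {r0}. (sqrt (lam r) * cmod (ft g r)) * (cmod (T r) / sqrt (lam r)))"
    by (simp only: norm_of_real)
  then have "(K * G)\<^sup>2 \<le> (\<Sum>r\<in>R - {r0}. (sqrt (lam r) * cmod (ft g r)) * (cmod (T r) / sqrt (lam r)))\<^sup>2"
    by (rule abs_le_square_iff[THEN iffD1, OF order_trans[OF _ abs_ge_self]])
  also have "\<dots> \<le> (\<Sum>r\<in>R - {r0}. (sqrt (lam r) * cmod (ft g r))\<^sup>2) * (\<Sum>r\<in>R - {r0}. (cmod (T r) / sqrt (lam r))\<^sup>2)"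
    by (rule Cauchy_Schwarz_ineq_sum)
  also have "(\<Sum>r\<in>R - {r0}. (cmod (T r) / sqrt (lam r))\<^sup>2) = Q"
    unfolding Q_def using lam(2) by (intro sum.cong refl) (simp add: power_divide less_imp_le)
  finally have KG: "(K * G)\<^sup>2 \<le> (\<Sum>r\<in>R - {r0}. (sqrt (lam r) * cmod (ft g r))\<^sup>2) * Q" .
  have Q: "0 \<le> Q" unfolding Q_def using lam(2) by (intro sum_nonneg divide_nonneg_pos) auto
  have "(\<Sum>r\<in>R - {r0}. (sqrt (lam r) * cmod (ft g r))\<^sup>2) = (\<Sum>r\<in>R - {r0}. lam r * (cmod (ft g r))\<^sup>2)"
    using lam(2) by (intro sum.cong refl) (simp add: power_mult_distrib less_imp_le)
  also have "\<dots> \<le> (\<Sum>r\<in>R. lam r * (cmod (ft g r))\<^sup>2)"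
    using finite_R lam(1) by (intro sum_mono2) auto
  also have "\<dots> = (\<Sum>r\<in>R. (cmod (cha r - 1))\<^sup>2 * (cmod (ft g r))\<^sup>2) + (\<Sum>r\<in>R. (cmod (chb r - 1))\<^sup>2 * (cmod (ft g r))\<^sup>2)"
    by (simp add: lam(1) distrib_right sum.distrib)
  also have "\<dots> \<le> K * (real (card S) * h\<^sup>2) + K * (real (card S) * h\<^sup>2)"
    by (intro add_mono ft_shift_energy_le[where s = s1 and ch = cha]
        ft_shift_energy_le[where s = s2 and ch = chb] s1 s2 cha chb h1 h2)
  finally have "(K * G)\<^sup>2 \<le> (K * (real (card S) * h\<^sup>2) + K * (real (card S) * h\<^sup>2)) * Q"
    by (rule order_trans[OF KG mult_right_mono[OF _ Q]])
  then have "K\<^sup>2 * G\<^sup>2 \<le> K\<^sup>2 * (2 * h\<^sup>2 * (real (card S) / K) * Q)"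
    using K_pos by (simp add: power_mult_distrib power2_eq_square field_simps)
  then show ?thesis
    using K_pos unfolding G_def Q_def T_def by (simp only: mult_le_cancel_left_pos zero_less_power)
qed

end

section \<open>Characters and Laplacian eigenvalues of the discrete torus\<close>

text \<open>Distance from \<open>p\<close> to 0 on the cycle of length \<open>N\<close>. It has two
  roles: as the absolute value of a frequency, and as the reflection that folds the cycle onto half
  of it.\<close>

definition fold_index :: "nat \<Rightarrow> nat \<Rightarrow> nat" where
  "fold_index N p = min p (N - p)"

definition torus :: "nat \<Rightarrow> (nat \<times> nat) set" where
  "torus N = {..<N} \<times> {..<N}"

definition unity :: "nat \<Rightarrow> nat \<Rightarrow> complex" where
  "unity N a = cis (2 * pi * real a / real N)"

definition torus_char :: "nat \<Rightarrow> nat \<times> nat \<Rightarrow> nat \<times> nat \<Rightarrow> complex" where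
  "torus_char N r x = unity N (fst x) ^ fst r * unity N (snd x) ^ snd r"

text \<open>Eigenvalue of the negative discrete Laplacian at frequency \<open>r = (p, q)\<close>,
  that is 4 sin^2 (pi p / N) + 4 sin^2 (pi q / N).\<close>

definition torus_eigen :: "nat \<Rightarrow> nat \<times> nat \<Rightarrow> real" where
  "torus_eigen N r = (cmod (unity N 1 ^ fst r - 1))\<^sup>2 + (cmod (unity N 1 ^ snd r - 1))\<^sup>2"

lemma norm_unity: "cmod (unity N a) = 1"
  by (simp add: unity_def)

lemma unity_power_N: "N > 0 \<Longrightarrow> unity N a ^ N = 1"
  unfolding unity_def Complex.DeMoivre using cis_multiple_2pi[of "real a"] by simp

lemma unity_orthogonal:
  assumes "a < N" "b < N"
  shows "(\<Sum>p<N. unity N a ^ p * cnj (unity N b ^ p)) = (if a = b then of_nat N else 0)"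
proof -
  have N: "N > 0" using assms by simp
  define \<omega> where "\<omega> = unity N a * cnj (unity N b)"
  have eq: "(\<Sum>p<N. unity N a ^ p * cnj (unity N b ^ p)) = (\<Sum>p<N. \<omega> ^ p)"
    by (simp add: \<omega>_def power_mult_distrib)
  have bb: "unity N b * cnj (unity N b) = 1"
    using complex_norm_square[of "unity N b"] by (simp add: norm_unity)
  show ?thesis
  proof (cases "a = b")
    case True
    then show ?thesis unfolding eq using bb by (simp add: \<omega>_def)
  next
    case False
    have "unity N a \<noteq> unity N b"
      using Complex.bij_betw_roots_unity[OF N] assms False unfolding unity_def bij_betw_def inj_on_def by auto
    then have "\<omega> \<noteq> 1" using bb unfolding \<omega>_def
      by (metis mult.commute mult_cancel_right mult_zero_left zero_neq_one)
    moreover have "\<omega> ^ N = 1"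
      unfolding \<omega>_def power_mult_distrib complex_cnj_power[symmetric] by (simp add: unity_power_N N)
    ultimately show ?thesis unfolding eq using False by (simp add: geometric_sum)
  qed
qed

lemma character_table_torus:
  assumes "N > 0"
  shows "character_table (torus N) (torus N) (torus_char N) ((real N)\<^sup>2)"
proof
  show "finite (torus N)" by (simp add: torus_def)
  show "0 < (real N)\<^sup>2" using assms by simp
next
  fix x y assume "x \<in> torus N" "y \<in> torus N"
  then obtain a b a' b' where xy: "x = (a, b)" "y = (a', b')" "a < N" "b < N" "a' < N" "b' < N"
    by (auto simp: torus_def)
  have "(\<Sum>r\<in>torus N. torus_char N r x * cnj (torus_char N r y)) =
      (\<Sum>p<N. \<Sum>q<N. (unity N a ^ p * cnj (unity N a' ^ p)) * (unity N b ^ q * cnj (unity N b' ^ q)))"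
    unfolding torus_def sum.cartesian_product
    by (intro sum.cong refl) (auto simp: torus_char_def xy mult_ac)
  also have "\<dots> = (\<Sum>p<N. unity N a ^ p * cnj (unity N a' ^ p)) * (\<Sum>q<N. unity N b ^ q * cnj (unity N b' ^ q))"
    by (rule sum_product[symmetric])
  also have "\<dots> = (if x = y then complex_of_real ((real N)\<^sup>2) else 0)"
    using xy by (simp only: unity_orthogonal) (auto simp: power2_eq_square)
  finally show "(\<Sum>r\<in>torus N. torus_char N r x * cnj (torus_char N r y)) =
    (if x = y then complex_of_real ((real N)\<^sup>2) else 0)" .
qed

text \<open>A weak form of Jordan's inequality: the Taylor remainder \<open>x ^ 3 / 6\<close> is at
  most \<open>x / 2\<close> as long as \<open>x * x \<le> 3\<close>, and
  \<open>pi / 2 \<le> 8 / 5\<close>.\<close>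

lemma sin_ge_half:
  assumes "0 \<le> x" "x \<le> pi / 2"
  shows "x / 2 \<le> sin x"
proof -
  have x: "x \<le> 8 / 5" using assms pi_approx by simp
  have "\<bar>sin x - (\<Sum>m<3. sin_coeff m * x ^ m)\<bar> \<le> inverse (fact 3) * \<bar>x\<bar> ^ 3"
    by (rule Maclaurin_sin_bound)
  then have "\<bar>sin x - x\<bar> \<le> x ^ 3 / 6"
    using assms by (simp add: sin_coeff_def numeral_eq_Suc field_simps)
  moreover have "x ^ 3 \<le> 3 * x"
  proof -
    have "x * x \<le> (8/5) * (8/5)" using x assms by (intro mult_mono) auto
    then have "x * (x * x) \<le> x * 3" using assms by (intro mult_left_mono) auto
    then show ?thesis by (simp add: power3_eq_cube mult_ac)
  qed
  ultimately show ?thesis by linarith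
qed

lemma norm_cis_double_minus_1: "(cmod (cis (2 * t) - 1))\<^sup>2 = 4 * (sin t)\<^sup>2"
proof -
  have "(cmod (cis (2 * t) - 1))\<^sup>2 = (2 * (sin t)\<^sup>2)\<^sup>2 + (2 * sin t * cos t)\<^sup>2"
    by (simp add: cmod_power2 cos_double_sin sin_double)
  also have "\<dots> = 4 * (sin t)\<^sup>2 * ((sin t)\<^sup>2 + (cos t)\<^sup>2)" by algebra
  finally show ?thesis by simp
qed

text \<open>The chord from 1 to \<open>cis (2 * t)\<close> has length 2 |sin t|. By sin (pi - t) =
  sin t the frequency may be folded to \<open>k\<close>, and then sin x \<ge> x / 2 \<ge> k / N
  because pi \<ge> 2.\<close>

lemma norm_unity_power_minus_1_ge:
  assumes "p < N"
  shows "(cmod (unity N 1 ^ p - 1))\<^sup>2 \<ge> 4 * (real (fold_index N p) / real N)\<^sup>2"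
proof -
  define k where "k = fold_index N p"
  define x where "x = pi * real k / real N"
  have N: "N > 0" using assms by simp
  have "unity N 1 ^ p = cis (2 * (pi * real p / real N))"
    unfolding unity_def Complex.DeMoivre by (simp add: mult_ac)
  then have "(cmod (unity N 1 ^ p - 1))\<^sup>2 = 4 * (sin (pi * real p / real N))\<^sup>2"
    by (simp only: norm_cis_double_minus_1)
  also have "(sin (pi * real p / real N))\<^sup>2 = (sin x)\<^sup>2"
  proof (cases "p \<le> N - p")
    case False
    then have "x = pi - pi * real p / real N"
      using assms N by (simp add: x_def k_def fold_index_def min_def of_nat_diff field_simps)
    then show ?thesis by simp
  qed (simp add: x_def k_def fold_index_def min_def)
  finally have eq: "(cmod (unity N 1 ^ p - 1))\<^sup>2 = 4 * (sin x)\<^sup>2" .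
  have "(x / 2)\<^sup>2 \<le> (sin x)\<^sup>2"
  proof -
    have "2 * k \<le> N" by (auto simp: k_def fold_index_def min_def)
    then have "2 * real k \<le> real N" by linarith
    then have "x \<le> pi / 2" unfolding x_def using N by (simp add: field_simps)
    then show ?thesis by (intro power_mono sin_ge_half) (simp_all add: x_def)
  qed
  moreover have "(real k / real N)\<^sup>2 \<le> (x / 2)\<^sup>2"
  proof (rule power_mono)
    have "2 * (real k / real N) \<le> pi * (real k / real N)" using pi_ge_two by (intro mult_right_mono) auto
    then show "real k / real N \<le> x / 2" by (simp add: x_def)
  qed simp
  ultimately show ?thesis unfolding eq k_def by linarith
qed

lemma torus_eigen_ge:
  assumes "r \<in> torus N"
  shows "torus_eigen N r \<ge> 4 * (real (max (fold_index N (fst r)) (fold_index N (snd r))) / real N)\<^sup>2"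
proof -
  define a where "a = real (fold_index N (fst r)) / real N"
  define b where "b = real (fold_index N (snd r)) / real N"
  have "4 * a\<^sup>2 + 4 * b\<^sup>2 \<le> torus_eigen N r"
    unfolding torus_eigen_def a_def b_def
    using assms by (intro add_mono norm_unity_power_minus_1_ge) (auto simp: torus_def)
  moreover have "(real (max (fold_index N (fst r)) (fold_index N (snd r))) / real N)\<^sup>2 \<le> a\<^sup>2 + b\<^sup>2"
    by (simp add: max_def a_def b_def)
  ultimately show ?thesis by linarith
qed

lemma fold_index_pos: "0 < p \<Longrightarrow> p < N \<Longrightarrow> 0 < fold_index N p"
  by (simp add: fold_index_def)

lemma max_fold_index_pos:
  assumes "r \<in> torus N - {(0, 0)}"
  shows "0 < max (fold_index N (fst r)) (fold_index N (snd r))"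
  using assms fold_index_pos[of "fst r" N] fold_index_pos[of "snd r" N]
  by (cases r) (auto simp: torus_def less_max_iff_disj)

lemma torus_eigen_pos:
  assumes "r \<in> torus N - {(0, 0)}"
  shows "0 < torus_eigen N r"
proof -
  have "N > 0" using assms by (auto simp: torus_def)
  then have "0 < 4 * (real (max (fold_index N (fst r)) (fold_index N (snd r))) / real N)\<^sup>2"
    using max_fold_index_pos[OF assms] by (simp add: less_max_iff_disj)
  also have "\<dots> \<le> torus_eigen N r" using assms by (intro torus_eigen_ge) simp
  finally show ?thesis .
qed

text \<open>One coordinate is \<open>k\<close> or \<open>N - k\<close>; the other has at most 2k + 1
  \<le> 3k values, which is where \<open>k \<ge> 1\<close> enters. The two orders of the coordinates
  double the product 2 * 3k.\<close>

lemma card_fold_index_level: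
  assumes "k \<ge> 1"
  shows "card {r \<in> torus N. max (fold_index N (fst r)) (fold_index N (snd r)) = k} \<le> 12 * k"
proof -
  define A where "A = {k, N - k}"
  define B where "B = {0..k} \<union> {N - k..<N}"
  have A: "p \<in> A" if "fold_index N p = k" "p < N" for p
    using that by (auto simp: A_def fold_index_def min_def split: if_splits)
  have B: "p \<in> B" if "fold_index N p \<le> k" "p < N" for p
    using that by (auto simp: B_def fold_index_def min_def split: if_splits)
  have fin: "finite A" "finite B" by (auto simp: A_def B_def)
  have cA: "card A \<le> 2" by (simp add: A_def card_insert_if)
  have "card B \<le> card {0..k} + card {N - k..<N}" unfolding B_def by (rule card_Un_le)
  also have "\<dots> \<le> 3 * k" using assms by simp
  finally have cB: "card B \<le> 3 * k" .
  have "{r \<in> torus N. max (fold_index N (fst r)) (fold_index N (snd r)) = k} \<subseteq> A \<times> B \<union> B \<times> A"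
  proof
    fix r assume "r \<in> {r \<in> torus N. max (fold_index N (fst r)) (fold_index N (snd r)) = k}"
    then have r: "fst r < N" "snd r < N" "max (fold_index N (fst r)) (fold_index N (snd r)) = k"
      by (auto simp: torus_def)
    then have "fold_index N (fst r) = k \<and> fold_index N (snd r) \<le> k \<or>
        fold_index N (snd r) = k \<and> fold_index N (fst r) \<le> k" by (auto simp: max_def split: if_splits)
    then show "r \<in> A \<times> B \<union> B \<times> A" using A B r(1,2) by (cases r) auto
  qed
  then have "card {r \<in> torus N. max (fold_index N (fst r)) (fold_index N (snd r)) = k} \<le> card (A \<times> B \<union> B \<times> A)"
    using fin by (intro card_mono) auto
  also have "\<dots> \<le> card (A \<times> B) + card (B \<times> A)" by (rule card_Un_le)
  also have "\<dots> \<le> 2 * (3 * k) + (3 * k) * 2"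
    unfolding card_cartesian_product using cA cB by (intro add_mono mult_mono) auto
  finally show ?thesis by simp
qed

text \<open>The source of the logarithm. Level \<open>k\<close> has at most 12k frequencies, each
  with eigenvalue at least 4 (k / N)^2, and so contributes at most 3 N^2 / k. Dimension two is the
  borderline case in which the levels add up to a harmonic number.\<close>

lemma sum_inverse_torus_eigen_le:
  "(\<Sum>r\<in>torus N - {(0, 0)}. 1 / torus_eigen N r) \<le> 3 * (real N)\<^sup>2 * harm N"
proof -
  define k where "k r = max (fold_index N (fst r)) (fold_index N (snd r))" for r :: "nat \<times> nat"
  define T where "T = torus N - {(0, 0)}"
  have fin: "finite T" by (simp add: T_def torus_def)
  have kpos: "0 < k r" if "r \<in> T" for r using that max_fold_index_pos by (simp add: T_def k_def)
  have kle: "k r \<le> N" if "r \<in> T" for r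
    using that by (auto simp: T_def torus_def k_def fold_index_def)
  have "(\<Sum>r\<in>T. 1 / torus_eigen N r) \<le> (\<Sum>r\<in>T. (real N)\<^sup>2 / (4 * (real (k r))\<^sup>2))"
  proof (rule sum_mono)
    fix r assume r: "r \<in> T"
    then have N: "N > 0" by (auto simp: T_def torus_def)
    have "1 / torus_eigen N r \<le> 1 / (4 * (real (k r) / real N)\<^sup>2)"
      using torus_eigen_ge[of r N] r kpos[OF r] N unfolding k_def T_def
      by (intro divide_left_mono mult_pos_pos) (auto intro!: torus_eigen_pos)
    then show "1 / torus_eigen N r \<le> (real N)\<^sup>2 / (4 * (real (k r))\<^sup>2)"
      by (simp add: power_divide)
  qed
  also have "\<dots> = (\<Sum>l\<in>{1..N}. \<Sum>r\<in>{r \<in> T. k r = l}. (real N)\<^sup>2 / (4 * (real (k r))\<^sup>2))"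
    using kpos kle by (intro sum.group[symmetric] fin) (auto simp: Suc_le_eq)
  also have "\<dots> = (\<Sum>l\<in>{1..N}. real (card {r \<in> T. k r = l}) * ((real N)\<^sup>2 / (4 * (real l)\<^sup>2)))"
    by (intro sum.cong refl) simp
  also have "\<dots> \<le> (\<Sum>l\<in>{1..N}. real (12 * l) * ((real N)\<^sup>2 / (4 * (real l)\<^sup>2)))"
  proof (intro sum_mono mult_right_mono)
    fix l assume "l \<in> {1..N}"
    then have "card {r \<in> torus N. k r = l} \<le> 12 * l"
      unfolding k_def by (intro card_fold_index_level) simp
    moreover have "card {r \<in> T. k r = l} \<le> card {r \<in> torus N. k r = l}"
      by (rule card_mono) (auto simp: T_def torus_def)
    ultimately show "real (card {r \<in> T. k r = l}) \<le> real (12 * l)" by linarith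
  qed simp
  also have "\<dots> = (\<Sum>l\<in>{1..N}. 3 * (real N)\<^sup>2 * inverse (real l))"
    by (intro sum.cong refl) (simp add: power2_eq_square field_simps)
  also have "\<dots> = 3 * (real N)\<^sup>2 * harm N"
    by (simp add: harm_def sum_distrib_left)
  finally show ?thesis by (simp add: T_def)
qed

section \<open>Rounding to a folded grid in the plane\<close>

definition grid_point :: "real \<Rightarrow> real \<Rightarrow> 'a \<Rightarrow> 'a \<Rightarrow> nat \<Rightarrow> nat \<times> nat \<Rightarrow> 'a::euclidean_space" where
  "grid_point R h e1 e2 N x = (h * real (fold_index N (fst x)) - R) *\<^sub>R e1 + (h * real (fold_index N (snd x)) - R) *\<^sub>R e2"

text \<open>For points of norm at most \<open>R\<close> and \<open>h = 2 * R / m\<close>, rounding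
  down lands in {0..m}, the half of a cycle of length \<open>2 * m\<close> on which
  \<open>fold_index\<close> is the identity; there \<open>grid_point\<close> undoes it up to
  \<open>h\<close> per coordinate.\<close>

definition grid_cell :: "real \<Rightarrow> real \<Rightarrow> 'a \<Rightarrow> 'a \<Rightarrow> 'a::euclidean_space \<Rightarrow> nat \<times> nat" where
  "grid_cell R h e1 e2 u = (nat \<lfloor>(u \<bullet> e1 + R) / h\<rfloor>, nat \<lfloor>(u \<bullet> e2 + R) / h\<rfloor>)"

lemma floor_cell:
  fixes t :: real
  assumes "\<bar>t\<bar> \<le> R" "h = 2 * R / real m" "R > 0" "m \<ge> 1"
  shows "nat \<lfloor>(t + R) / h\<rfloor> \<le> m" "\<bar>h * real (nat \<lfloor>(t + R) / h\<rfloor>) - R - t\<bar> \<le> h"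
proof -
  have h: "h > 0" using assms by simp
  define q where "q = (t + R) / h"
  have q0: "0 \<le> q" unfolding q_def using assms h by simp
  have "h * real m = 2 * R" using assms by simp
  then have "q \<le> real m" unfolding q_def using assms(1) h by (simp add: pos_divide_le_eq mult.commute)
  then show "nat \<lfloor>(t + R) / h\<rfloor> \<le> m" unfolding q_def by linarith
  have n: "real (nat \<lfloor>q\<rfloor>) = of_int \<lfloor>q\<rfloor>" using q0 by simp
  have "\<bar>real (nat \<lfloor>q\<rfloor>) - q\<bar> \<le> 1" unfolding n by linarith
  then have "h * \<bar>real (nat \<lfloor>q\<rfloor>) - q\<bar> \<le> h * 1" using h by (intro mult_left_mono) auto
  moreover have "h * \<bar>real (nat \<lfloor>q\<rfloor>) - q\<bar> = \<bar>h * real (nat \<lfloor>q\<rfloor>) - h * q\<bar>"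
    using h by (simp add: abs_mult flip: right_diff_distrib)
  moreover have "h * q = t + R" unfolding q_def using h by simp
  ultimately show "\<bar>h * real (nat \<lfloor>(t + R) / h\<rfloor>) - R - t\<bar> \<le> h" unfolding q_def[symmetric] by (simp add: algebra_simps)
qed

lemma fold_index_succ_diff:
  assumes "a < N"
  shows "\<bar>real (fold_index N (Suc a mod N)) - real (fold_index N a)\<bar> \<le> 1"
proof (cases "Suc a = N")
  case True then show ?thesis by (auto simp: fold_index_def min_def)
next
  case False
  then have "Suc a mod N = Suc a" using assms by simp
  then show ?thesis using assms by (auto simp: fold_index_def min_def)
qed

lemma unity_succ_mod:
  assumes "a < N"
  shows "unity N (Suc a mod N) = unity N 1 * unity N a"
proof -
  have "unity N 1 * unity N a = unity N (Suc a)"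
    unfolding unity_def cis_mult using assms by (simp add: field_simps)
  moreover have "unity N (Suc a mod N) = unity N (Suc a)"
  proof (cases "Suc a = N")
    case True
    then show ?thesis using assms by (simp add: unity_def)
  qed (use assms in simp)
  ultimately show ?thesis by simp
qed

lemma bij_betw_succ_mod: "bij_betw (\<lambda>a. Suc a mod N) {..<N} {..<N}"
proof -
  have "bij_betw (rotation N 1) {..<N} {..<N}" by (rule permutes_imp_bij[OF rotation_permutes])
  then show ?thesis by (rule bij_betw_cong[THEN iffD1, rotated]) (simp add: rotation_def)
qed

text \<open>The grid is reflected at the boundary (see \<^const>\<open>fold_index\<close>), so that the restriction of any
  Lipschitz function to it is automatically a periodic Lipschitz function.\<close>
lemma matching_cost_grid_bound:
  fixes u v :: "nat \<Rightarrow> 'a::euclidean_space"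
  assumes basis: "Basis = {e1, e2 :: 'a}" "e1 \<noteq> e2" and R: "R > 0" and m: "m \<ge> 1" and n: "n \<ge> 1"
    and h: "h = 2 * R / real m" and N: "N = 2 * m"
    and uv: "\<And>i. i < n \<Longrightarrow> norm (u i) \<le> R" "\<And>i. i < n \<Longrightarrow> norm (v i) \<le> R"
  shows "matching_cost u v n \<le> 4 * real n * h + sqrt (2 * h\<^sup>2 * (\<Sum>r\<in>torus N - {(0, 0)}.
      (cmod (\<Sum>i<n. torus_char N r (grid_cell R h e1 e2 (u i)) - torus_char N r (grid_cell R h e1 e2 (v i))))\<^sup>2
        / torus_eigen N r))"
proof -
  have Npos: "N > 0" using m N by simp
  have h0: "h > 0" using h R m by simp
  have eB: "e1 \<in> Basis" "e2 \<in> Basis" using basis by auto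
  then have e: "e1 \<in> Basis" "e2 \<in> Basis" "e1 \<bullet> e1 = 1" "e2 \<bullet> e2 = 1" "e1 \<bullet> e2 = 0" "e2 \<bullet> e1 = 0"
    "norm e1 = 1" "norm e2 = 1"
    using basis(2) by (simp_all only: inner_Basis norm_Basis) auto
  let ?P = "grid_point R h e1 e2 N" and ?c = "grid_cell R h e1 e2"
  have comp: "\<bar>x \<bullet> e1\<bar> \<le> R" "\<bar>x \<bullet> e2\<bar> \<le> R" if "norm x \<le> R" for x :: 'a
    using that Basis_le_norm[OF e(1), of x] Basis_le_norm[OF e(2), of x] by auto
  have cell: "?c x \<in> torus N" if "norm x \<le> R" for x
    using floor_cell(1)[OF comp(1)[OF that] h R m] floor_cell(1)[OF comp(2)[OF that] h R m] m N
    by (auto simp: grid_cell_def torus_def)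
  \<comment> \<open>Each of the two coordinates moves by at most \<open>h\<close>. Rounding both
    ends of \<open>n\<close> pairs then accounts for the term \<open>4 * n * h\<close>.\<close>
  have snap: "dist x (?P (?c x)) \<le> 2 * h" if "norm x \<le> R" for x
  proof -
    have fold: "fold_index N a = a" if "a \<le> m" for a using that N by (simp add: fold_index_def)
    have "norm (?P (?c x) - x) \<le> (\<Sum>b\<in>Basis. \<bar>(?P (?c x) - x) \<bullet> b\<bar>)" by (rule norm_le_l1)
    also have "\<dots> = \<bar>(?P (?c x) - x) \<bullet> e1\<bar> + \<bar>(?P (?c x) - x) \<bullet> e2\<bar>"
      unfolding basis(1) using basis(2) by simp
    also have "\<dots> \<le> h + h"
      using floor_cell[OF comp(1)[OF that] h R m] floor_cell[OF comp(2)[OF that] h R m]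
      by (intro add_mono) (simp_all add: grid_point_def grid_cell_def fold inner_diff_left inner_add_left e)
    finally show ?thesis by (simp add: dist_norm norm_minus_commute)
  qed
  obtain f where f: "\<And>a b. \<bar>f a - f b\<bar> \<le> dist a b" "matching_cost u v n \<le> (\<Sum>i<n. f (u i) - f (v i))"
    using matching_cost_dual[OF n, of u v] by blast
  define g where "g = f \<circ> ?P"
  interpret character_table "torus N" "torus N" "torus_char N" "(real N)\<^sup>2"
    by (rule character_table_torus[OF Npos])
  define s1 s2 where "s1 = map_prod (\<lambda>a. Suc a mod N) (\<lambda>b::nat. b)" and "s2 = map_prod (\<lambda>a::nat. a) (\<lambda>b. Suc b mod N)"
  have bij: "bij_betw s1 (torus N) (torus N)" "bij_betw s2 (torus N) (torus N)"
    unfolding s1_def s2_def torus_def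
    by (intro bij_betw_map_prod bij_betw_succ_mod, simp add: bij_betw_def)+
  have bound: "(\<Sum>i<n. g (?c (u i)) - g (?c (v i)))\<^sup>2 \<le> 2 * h\<^sup>2 * (real (card (torus N)) / (real N)\<^sup>2) *
    (\<Sum>r\<in>torus N - {(0, 0)}. (cmod (\<Sum>i<n. torus_char N r (?c (u i)) - torus_char N r (?c (v i))))\<^sup>2 / torus_eigen N r)"
  proof (rule discrepancy_bound[where cha = "\<lambda>r. unity N 1 ^ fst r" and chb = "\<lambda>r. unity N 1 ^ snd r", OF bij])
    fix r x assume "x \<in> torus N"
    then show "torus_char N r (s1 x) = unity N 1 ^ fst r * torus_char N r x"
      "torus_char N r (s2 x) = unity N 1 ^ snd r * torus_char N r x"
      by (auto simp: torus_char_def s1_def s2_def torus_def unity_succ_mod power_mult_distrib)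
  next
    fix x assume x: "x \<in> torus N"
    \<comment> \<open>One step on the torus moves the folded grid point by at most \<open>h\<close>
      along a single axis, also at the fold and across the wrap-around.\<close>
    have "\<bar>g (s1 x) - g x\<bar> \<le> norm (?P (s1 x) - ?P x)"
      using f(1)[of "?P (s1 x)" "?P x"] by (simp add: g_def dist_norm)
    also have "?P (s1 x) - ?P x = (h * (real (fold_index N (Suc (fst x) mod N)) - real (fold_index N (fst x)))) *\<^sub>R e1"
      by (cases x) (simp add: grid_point_def s1_def algebra_simps)
    also have "norm \<dots> \<le> h * 1"
      unfolding norm_scaleR e abs_mult using h0 fold_index_succ_diff[of "fst x" N] x
      by (auto simp: torus_def intro!: mult_left_mono)
    finally show "\<bar>g (s1 x) - g x\<bar> \<le> h" by simp
    have "\<bar>g (s2 x) - g x\<bar> \<le> norm (?P (s2 x) - ?P x)"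
      using f(1)[of "?P (s2 x)" "?P x"] by (simp add: g_def dist_norm)
    also have "?P (s2 x) - ?P x = (h * (real (fold_index N (Suc (snd x) mod N)) - real (fold_index N (snd x)))) *\<^sub>R e2"
      by (cases x) (simp add: grid_point_def s2_def algebra_simps)
    also have "norm \<dots> \<le> h * 1"
      unfolding norm_scaleR e abs_mult using h0 fold_index_succ_diff[of "snd x" N] x
      by (auto simp: torus_def intro!: mult_left_mono)
    finally show "\<bar>g (s2 x) - g x\<bar> \<le> h" by simp
  next
    fix r assume "r \<in> torus N" "r \<noteq> (0, 0)"
    then show "0 < torus_eigen N r" by (intro torus_eigen_pos) auto
  qed (auto simp: norm_power norm_unity torus_eigen_def torus_char_def uv cell)
  have one: "real (card (torus N)) / (real N)\<^sup>2 = 1"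
    using Npos by (simp add: torus_def power2_eq_square)
  have "(\<Sum>i<n. g (?c (u i)) - g (?c (v i))) \<le> sqrt (2 * h\<^sup>2 * (\<Sum>r\<in>torus N - {(0, 0)}.
      (cmod (\<Sum>i<n. torus_char N r (?c (u i)) - torus_char N r (?c (v i))))\<^sup>2 / torus_eigen N r))"
    by (rule real_le_rsqrt[OF bound[unfolded one mult_1_right]])
  moreover have "(\<Sum>i<n. f (u i) - f (v i)) \<le> (\<Sum>i<n. (g (?c (u i)) - g (?c (v i))) + 4 * h)"
  proof (rule sum_mono)
    fix i assume "i \<in> {..<n}"
    then have i: "i < n" by simp
    show "f (u i) - f (v i) \<le> (g (?c (u i)) - g (?c (v i))) + 4 * h"
      using f(1)[of "u i" "?P (?c (u i))"] f(1)[of "v i" "?P (?c (v i))"]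
        snap[OF uv(1)[OF i]] snap[OF uv(2)[OF i]] unfolding g_def comp_def by linarith
  qed
  moreover have "(\<Sum>i<n. (g (?c (u i)) - g (?c (v i))) + 4 * h) = (\<Sum>i<n. g (?c (u i)) - g (?c (v i))) + 4 * real n * h"
    by (simp add: sum.distrib)
  ultimately show ?thesis using f(2) by linarith
qed

section \<open>Random matchings in the plane\<close>

lemma sum_Plus_nat:
  fixes g :: "nat + nat \<Rightarrow> 'b::comm_monoid_add"
  shows "(\<Sum>j\<in>{..<n} <+> {..<n}. g j) = (\<Sum>i<n. g (Inl i)) + (\<Sum>i<n. g (Inr i))"
  by (subst sum.Plus) (auto simp: comp_def)

lemma (in prob_space) expectation_iid_difference_square_le:
  fixes Z :: "nat + nat \<Rightarrow> 'a \<Rightarrow> 'b::topological_space" and \<phi> :: "'b \<Rightarrow> real"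
  assumes indep: "indep_vars (\<lambda>_. borel) Z UNIV" and law: "\<And>j. distr M borel (Z j) = \<mu>"
    and \<phi>: "\<phi> \<in> borel_measurable borel" and \<phi>1: "\<And>x. \<bar>\<phi> x\<bar> \<le> 1"
  shows "expectation (\<lambda>\<omega>. (\<Sum>i<n. \<phi> (Z (Inr i) \<omega>) - \<phi> (Z (Inl i) \<omega>))\<^sup>2) \<le> 8 * real n"
proof -
  have rv: "random_variable borel (Z j)" for j using indep by (auto simp: indep_vars_def)
  define a where "a = (\<integral>x. \<phi> x \<partial>\<mu>)"
  have E: "expectation (\<lambda>\<omega>. \<phi> (Z j \<omega>)) = a" for j
    unfolding a_def law[of j, symmetric] using rv \<phi> by (simp add: integral_distr)
  have m: "(\<lambda>\<omega>. \<phi> (Z j \<omega>)) \<in> borel_measurable M" for j by (rule measurable_compose[OF rv \<phi>])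
  have a1: "\<bar>a\<bar> \<le> 1" using expectation_abs_le[OF m[of "Inl 0"], of 1] \<phi>1 by (simp add: E)
  have int: "integrable M (\<lambda>\<omega>. \<phi> (Z j \<omega>))" for j using m \<phi>1 by (intro integrable_bounded[of _ 1])
  \<comment> \<open>Signs merge the two samples into one sum of \<open>2 * n\<close> independent
    terms, and the means cancel because the laws agree. Centred terms are at most 2 in absolute
    value, whence 8n = 2n * 2^2.\<close>
  define sg :: "nat + nat \<Rightarrow> real" where "sg = case_sum (\<lambda>_. -1) (\<lambda>_. 1)"
  define B where "B j \<omega> = sg j * (\<phi> (Z j \<omega>) - a)" for j \<omega>
  let ?J = "{..<n} <+> {..<n}"
  have sg: "\<bar>sg j\<bar> = 1" for j by (cases j) (auto simp: sg_def)
  have "indep_vars (\<lambda>_. borel) (\<lambda>j \<omega>. sg j * (\<phi> (Z j \<omega>) - a)) UNIV"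
    using \<phi> by (intro indep_vars_compose2[OF indep, where Y = "\<lambda>j x. sg j * (\<phi> x - a)"]) simp
  then have iB: "indep_vars (\<lambda>_. borel) B ?J"
    unfolding B_def by (rule indep_vars_subset) simp
  have "expectation (\<lambda>\<omega>. (\<Sum>j\<in>?J. B j \<omega>)\<^sup>2) \<le> real (card ?J) * 2\<^sup>2"
  proof (rule expectation_sum_square_le[OF iB])
    fix j \<omega>
    show "\<bar>B j \<omega>\<bar> \<le> 2"
      unfolding B_def abs_mult sg using \<phi>1[of "Z j \<omega>"] a1 by (simp add: abs_le_iff)
    show "expectation (B j) = 0"
      unfolding B_def using int[of j] by (simp add: E prob_space)
  qed simp
  moreover have "(\<Sum>j\<in>?J. B j \<omega>) = (\<Sum>i<n. \<phi> (Z (Inr i) \<omega>) - \<phi> (Z (Inl i) \<omega>))" for \<omega>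
    unfolding sum_Plus_nat sum.distrib[symmetric] by (intro sum.cong refl) (simp add: B_def sg_def)
  ultimately show ?thesis by (simp add: card_Plus)
qed

lemma measurable_torus_char_grid_cell [measurable]:
  "(\<lambda>u::'a::euclidean_space. torus_char N r (grid_cell R h e1 e2 u)) \<in> borel_measurable borel"
proof -
  have cell: "(\<lambda>u::'a. nat \<lfloor>(u \<bullet> e + R) / h\<rfloor>) \<in> measurable borel (count_space UNIV)" for e
    by measurable
  have "(\<lambda>u::'a. unity N (nat \<lfloor>(u \<bullet> e + R) / h\<rfloor>)) \<in> borel_measurable borel" for e
    by (rule measurable_compose[OF cell]) simp
  then show ?thesis unfolding torus_char_def grid_cell_def by simp
qed

lemma norm_torus_char: "cmod (torus_char N r x) = 1"
  by (simp add: torus_char_def norm_mult norm_power norm_unity)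

lemma harm_le_1_plus_ln:
  assumes "n \<ge> 1"
  shows "harm n \<le> 1 + ln (real n)"
  using assms
proof (induction n rule: dec_induct)
  case (step n)
  have "ln (real n / real (Suc n)) \<le> real n / real (Suc n) - 1"
    using step by (intro ln_le_minus_one) simp
  then have "ln (real n) - ln (real (Suc n)) \<le> - inverse (real (Suc n))"
    using step by (simp add: ln_div field_simps)
  then show ?case using step by (simp add: harm_Suc)
qed (simp add: harm_def)

text \<open>With about sqrt n grid lines per axis, rounding costs only order sqrt n, while the torus
  has order n points, so that the inverse eigenvalues contribute no more than a factor of order log
  n.\<close>

lemma (in prob_space) expectation_matching_cost_plane_le:
  fixes Z :: "nat + nat \<Rightarrow> 'a \<Rightarrow> 'b::euclidean_space"
  assumes dim: "DIM('b) = 2"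
    and indep: "indep_vars (\<lambda>_. borel) Z UNIV" and law: "\<And>j. distr M borel (Z j) = \<mu>"
    and Z: "\<And>j \<omega>. \<omega> \<in> space M \<Longrightarrow> norm (Z j \<omega>) \<le> R" and R: "R > 0" and n: "n \<ge> 2"
  shows "expectation (\<lambda>\<omega>. matching_cost (\<lambda>i. Z (Inr i) \<omega>) (\<lambda>i. Z (Inl i) \<omega>) n)
    \<le> 96 * R * sqrt (real n * ln (real n))"
proof -
  have rv [measurable]: "random_variable borel (Z j)" for j using indep by (auto simp: indep_vars_def)
  obtain e1 e2 :: 'b where basis: "Basis = {e1, e2}" "e1 \<noteq> e2"
    using dim by (auto simp: card_2_iff)
  define m where "m = nat \<lceil>sqrt (real n)\<rceil>"
  have sqn: "1 \<le> sqrt (real n)" using n by simp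
  have m_ge: "sqrt (real n) \<le> real m" unfolding m_def by (rule real_nat_ceiling_ge)
  then have m1: "m \<ge> 1" using sqn by linarith
  have "sqrt (real n) \<le> real n" using sqn mult_left_mono[OF sqn, of "sqrt (real n)"] by simp
  then have m_le: "m \<le> n" unfolding m_def by (simp add: ceiling_le_iff nat_le_iff)
  define h where "h = 2 * R / real m"
  define N where "N = 2 * m"
  define T where "T r \<omega> = (\<Sum>i<n. torus_char N r (grid_cell R h e1 e2 (Z (Inr i) \<omega>))
      - torus_char N r (grid_cell R h e1 e2 (Z (Inl i) \<omega>)))" for r \<omega>
  define Q where "Q \<omega> = (\<Sum>r\<in>torus N - {(0, 0)}. (cmod (T r \<omega>))\<^sup>2 / torus_eigen N r)" for \<omega>
  have Tm [measurable]: "T r \<in> borel_measurable M" for r unfolding T_def by measurable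
  have intT: "integrable M (\<lambda>\<omega>. (cmod (T r \<omega>))\<^sup>2)" for r
  proof (rule integrable_bounded)
    fix \<omega>
    have "cmod (T r \<omega>) \<le> (\<Sum>i<n. 2)" unfolding T_def
    proof (rule sum_norm_le)
      fix i show "cmod (torus_char N r (grid_cell R h e1 e2 (Z (Inr i) \<omega>)) -
          torus_char N r (grid_cell R h e1 e2 (Z (Inl i) \<omega>))) \<le> 2"
        by (rule order_trans[OF norm_triangle_ineq4]) (simp add: norm_torus_char)
    qed
    then have "(cmod (T r \<omega>))\<^sup>2 \<le> (2 * real n)\<^sup>2" by (intro power_mono) auto
    then show "\<bar>(cmod (T r \<omega>))\<^sup>2\<bar> \<le> (2 * real n)\<^sup>2" by simp
  qed simp
  have ET: "expectation (\<lambda>\<omega>. (cmod (T r \<omega>))\<^sup>2) \<le> 16 * real n" for r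
  proof -
    let ?c = "\<lambda>x. torus_char N r (grid_cell R h e1 e2 x)"
    have bnd: "\<bar>Re (?c x)\<bar> \<le> 1" "\<bar>Im (?c x)\<bar> \<le> 1" for x
      using abs_Re_le_cmod[of "?c x"] abs_Im_le_cmod[of "?c x"] by (simp_all add: norm_torus_char)
    have "(cmod (T r \<omega>))\<^sup>2 = (\<Sum>i<n. Re (?c (Z (Inr i) \<omega>)) - Re (?c (Z (Inl i) \<omega>)))\<^sup>2
        + (\<Sum>i<n. Im (?c (Z (Inr i) \<omega>)) - Im (?c (Z (Inl i) \<omega>)))\<^sup>2" for \<omega>
      by (simp add: cmod_power2 T_def)
    moreover have "integrable M (\<lambda>\<omega>. (\<Sum>i<n. \<psi> (?c (Z (Inr i) \<omega>)) - \<psi> (?c (Z (Inl i) \<omega>)))\<^sup>2)"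
      if \<psi>: "\<psi> = Re \<or> \<psi> = Im" for \<psi>
    proof (rule Bochner_Integration.integrable_bound[OF intT[of r]])
      show "(\<lambda>\<omega>. (\<Sum>i<n. \<psi> (?c (Z (Inr i) \<omega>)) - \<psi> (?c (Z (Inl i) \<omega>)))\<^sup>2) \<in> borel_measurable M"
        using \<psi> by auto
      show "AE \<omega> in M. norm ((\<Sum>i<n. \<psi> (?c (Z (Inr i) \<omega>)) - \<psi> (?c (Z (Inl i) \<omega>)))\<^sup>2) \<le> norm ((cmod (T r \<omega>))\<^sup>2)"
        using \<psi> by (auto simp: T_def cmod_power2)
    qed
    ultimately have "expectation (\<lambda>\<omega>. (cmod (T r \<omega>))\<^sup>2) =
        expectation (\<lambda>\<omega>. (\<Sum>i<n. Re (?c (Z (Inr i) \<omega>)) - Re (?c (Z (Inl i) \<omega>)))\<^sup>2)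
        + expectation (\<lambda>\<omega>. (\<Sum>i<n. Im (?c (Z (Inr i) \<omega>)) - Im (?c (Z (Inl i) \<omega>)))\<^sup>2)"
      by simp
    also have "\<dots> \<le> 8 * real n + 8 * real n"
      by (intro add_mono expectation_iid_difference_square_le[OF indep law]) (auto intro: bnd)
    finally show ?thesis by simp
  qed
  have intQ: "integrable M Q" unfolding Q_def using intT by simp
  have EQ: "expectation Q \<le> 48 * real n * (real N)\<^sup>2 * harm N"
  proof -
    have "expectation Q = (\<Sum>r\<in>torus N - {(0, 0)}. expectation (\<lambda>\<omega>. (cmod (T r \<omega>))\<^sup>2) / torus_eigen N r)"
      unfolding Q_def using intT by simp
    also have "\<dots> \<le> (\<Sum>r\<in>torus N - {(0, 0)}. 16 * real n / torus_eigen N r)"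
      using ET torus_eigen_pos by (intro sum_mono divide_right_mono) (auto intro: less_imp_le)
    also have "\<dots> = 16 * real n * (\<Sum>r\<in>torus N - {(0, 0)}. 1 / torus_eigen N r)"
      by (simp add: sum_distrib_left)
    also have "\<dots> \<le> 16 * real n * (3 * (real N)\<^sup>2 * harm N)"
      by (intro mult_left_mono sum_inverse_torus_eigen_le) simp
    finally show ?thesis by simp
  qed
  have ln2: "1 / 2 \<le> ln (real n)"
  proof -
    have "ln (1 / 2 :: real) \<le> 1 / 2 - 1" by (rule ln_le_minus_one) simp
    then have "1 / 2 \<le> ln (2::real)" by (simp add: ln_div)
    also have "\<dots> \<le> ln (real n)" using n by simp
    finally show ?thesis .
  qed
  have "harm N \<le> 1 + ln (real N)" using m1 by (intro harm_le_1_plus_ln) (simp add: N_def)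
  also have "ln (real N) \<le> ln (real n * real n)"
  proof -
    have "2 * m \<le> n * n" using n m_le by (intro mult_mono) auto
    then have "real N \<le> real n * real n" unfolding N_def by (metis of_nat_le_iff of_nat_mult)
    then show ?thesis using m1 by (subst ln_le_cancel_iff) (auto simp: N_def)
  qed
  also have "ln (real n * real n) = 2 * ln (real n)" using n by (simp add: ln_mult)
  finally have harmN: "harm N \<le> 4 * ln (real n)" using ln2 by linarith
  \<comment> \<open>The mesh enters the main term only through \<open>h * N = 4 * R\<close> and
    through \<open>harm N\<close>. The constant 6144 below is 96 * 16 * 4.\<close>
  have hN: "h\<^sup>2 * (real N)\<^sup>2 = 16 * R\<^sup>2"
    using m1 by (simp add: h_def N_def power2_eq_square)
  define s where "s = R * sqrt (6144 * (real n * ln (real n)))"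
  have nln: "0 < real n * ln (real n)" using n ln2 by (intro mult_pos_pos) auto
  have s: "s > 0" unfolding s_def using nln R by simp
  have s2: "s\<^sup>2 = R\<^sup>2 * (6144 * (real n * ln (real n)))" unfolding s_def power_mult_distrib using nln by simp
  have E2: "expectation (\<lambda>\<omega>. 2 * h\<^sup>2 * Q \<omega>) \<le> s\<^sup>2"
  proof -
    have "expectation (\<lambda>\<omega>. 2 * h\<^sup>2 * Q \<omega>) = 2 * h\<^sup>2 * expectation Q" by simp
    also have "\<dots> \<le> 2 * h\<^sup>2 * (48 * real n * (real N)\<^sup>2 * harm N)" by (intro mult_left_mono EQ) simp
    also have "\<dots> = 96 * real n * (h\<^sup>2 * (real N)\<^sup>2) * harm N" by simp
    also have "\<dots> \<le> 96 * real n * (h\<^sup>2 * (real N)\<^sup>2) * (4 * ln (real n))" by (intro mult_left_mono harmN) simp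
    also have "\<dots> = s\<^sup>2" unfolding hN s2 by simp
    finally show ?thesis .
  qed
  \<comment> \<open>This replaces Jensen's inequality for the square root: sqrt a \<le> (a / s + s)
    / 2 for every s > 0. As the expectation of a is at most s^2, that of the right-hand side is at
    most s.\<close>
  have pw: "matching_cost (\<lambda>i. Z (Inr i) \<omega>) (\<lambda>i. Z (Inl i) \<omega>) n \<le> 4 * real n * h + (2 * h\<^sup>2 * Q \<omega> / s + s) / 2"
    if \<omega>: "\<omega> \<in> space M" for \<omega>
  proof -
    have Q0: "0 \<le> 2 * h\<^sup>2 * Q \<omega>" unfolding Q_def
      using torus_eigen_pos by (intro mult_nonneg_nonneg sum_nonneg divide_nonneg_pos) auto
    have "matching_cost (\<lambda>i. Z (Inr i) \<omega>) (\<lambda>i. Z (Inl i) \<omega>) n \<le> 4 * real n * h + sqrt (2 * h\<^sup>2 * Q \<omega>)"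
      unfolding Q_def T_def
      by (rule matching_cost_grid_bound[OF basis R m1 _ h_def N_def]) (use n Z[OF \<omega>] in auto)
    moreover have "sqrt (2 * h\<^sup>2 * Q \<omega>) \<le> (2 * h\<^sup>2 * Q \<omega> / s + s) / 2"
    proof -
      have "sqrt ((2 * h\<^sup>2 * Q \<omega> / s) * s) \<le> (2 * h\<^sup>2 * Q \<omega> / s + s) / 2"
        using Q0 s by (intro arith_geo_mean_sqrt) auto
      then show ?thesis using s by simp
    qed
    ultimately show ?thesis by linarith
  qed
  have "expectation (\<lambda>\<omega>. matching_cost (\<lambda>i. Z (Inr i) \<omega>) (\<lambda>i. Z (Inl i) \<omega>) n)
      \<le> expectation (\<lambda>\<omega>. 4 * real n * h + (2 * h\<^sup>2 * Q \<omega> / s + s) / 2)"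
  proof (rule integral_mono)
    show int: "integrable M (\<lambda>\<omega>. 4 * real n * h + (2 * h\<^sup>2 * Q \<omega> / s + s) / 2)" using intQ by simp
    show "integrable M (\<lambda>\<omega>. matching_cost (\<lambda>i. Z (Inr i) \<omega>) (\<lambda>i. Z (Inl i) \<omega>) n)"
    proof (rule Bochner_Integration.integrable_bound[OF int])
      show "AE \<omega> in M. norm (matching_cost (\<lambda>i. Z (Inr i) \<omega>) (\<lambda>i. Z (Inl i) \<omega>) n)
          \<le> norm (4 * real n * h + (2 * h\<^sup>2 * Q \<omega> / s + s) / 2)"
      proof (rule AE_I2)
        fix \<omega> assume "\<omega> \<in> space M"
        from pw[OF this] show "norm (matching_cost (\<lambda>i. Z (Inr i) \<omega>) (\<lambda>i. Z (Inl i) \<omega>) n)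
          \<le> norm (4 * real n * h + (2 * h\<^sup>2 * Q \<omega> / s + s) / 2)"
          using matching_cost_nonneg[of "\<lambda>i. Z (Inr i) \<omega>" "\<lambda>i. Z (Inl i) \<omega>" n] by simp
      qed
    qed simp
  qed (rule pw)
  also have "\<dots> = 4 * real n * h + (expectation (\<lambda>\<omega>. 2 * h\<^sup>2 * Q \<omega>) / s + s) / 2"
    using intQ by (simp add: prob_space add_divide_distrib)
  also have "\<dots> \<le> 4 * real n * h + s"
  proof -
    have "expectation (\<lambda>\<omega>. 2 * h\<^sup>2 * Q \<omega>) / s \<le> s\<^sup>2 / s" using E2 s by (intro divide_right_mono) auto
    also have "\<dots> = s" using s by (simp add: power2_eq_square)
    finally show ?thesis by simp
  qed
  also have "4 * real n * h \<le> 16 * R * sqrt (real n * ln (real n))"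
  proof -
    have "real n / real m \<le> real n / sqrt (real n)"
      using m_ge sqn m1 by (intro divide_left_mono mult_pos_pos) auto
    also have "\<dots> = sqrt (real n)" by (simp add: real_div_sqrt)
    also have "\<dots> \<le> sqrt (4 * (real n * ln (real n)))"
      using ln2 n by (intro real_sqrt_le_mono) (simp add: field_simps)
    also have "\<dots> = 2 * sqrt (real n * ln (real n))" by (simp add: real_sqrt_mult)
    finally have "8 * R * (real n / real m) \<le> 8 * R * (2 * sqrt (real n * ln (real n)))"
      using R by (intro mult_left_mono) auto
    then show ?thesis by (simp add: h_def mult_ac)
  qed
  \<comment> \<open>80 exceeds sqrt 6144; with the 16 from rounding it makes the constant
    96.\<close>
  also have "s \<le> R * (80 * sqrt (real n * ln (real n)))"
  proof -
    have "sqrt (6144 * (real n * ln (real n))) \<le> sqrt (80\<^sup>2 * (real n * ln (real n)))"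
      using nln by (intro real_sqrt_le_mono) simp
    also have "\<dots> = 80 * sqrt (real n * ln (real n))"
      using nln by (simp add: real_sqrt_mult)
    finally show ?thesis unfolding s_def using R by (intro mult_left_mono) auto
  qed
  finally show ?thesis
    by (simp add: algebra_simps)
qed

section \<open>Expected tour length and concentration\<close>

lemma stacker_crane_opt_nonneg: "0 \<le> stacker_crane_opt x y n"
  using stacker_crane_opt_attained[of n x y] unfolding sc_tour_length_def
  by (metis (no_types, lifting) add_nonneg_nonneg sum_nonneg zero_le_dist)

lemma stacker_crane_opt_le_diameter:
  assumes "\<And>i j. dist (x i) (y j) \<le> D"
  shows "stacker_crane_opt x y n \<le> 2 * D * real n"
proof -
  have D': "dist (y j) (x i) \<le> D" for i j using assms[of i j] by (simp add: dist_commute)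
  have "stacker_crane_opt x y n \<le> sc_tour_length x y n id"
    by (rule stacker_crane_opt_le[OF permutes_id])
  also have "\<dots> \<le> (\<Sum>k<n. D + D)"
    unfolding sc_tour_length_def using assms D' by (intro sum_mono add_mono)
  finally show ?thesis by (simp add: mult.commute)
qed

lemma matching_cost_le_diameter:
  assumes "\<And>i j. dist (u i) (v j) \<le> D"
  shows "matching_cost u v n \<le> D * real n"
proof -
  have "matching_cost u v n \<le> (\<Sum>i<n. dist (u i) (v i))" by (rule matching_cost_le_sum)
  also have "\<dots> \<le> (\<Sum>i<n. D)" using assms by (intro sum_mono)
  finally show ?thesis by (simp add: mult.commute)
qed

text \<open>Deliveries come first: a matching edge is an empty leg, which runs from a delivery to a
  pickup.\<close>

abbreviation match_samples :: "nat \<Rightarrow> (nat + nat \<Rightarrow> 'a::metric_space) \<Rightarrow> real" where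
  "match_samples n z \<equiv> matching_cost (\<lambda>i. z (Inr i)) (\<lambda>i. z (Inl i)) n"

abbreviation crane_samples :: "nat \<Rightarrow> (nat + nat \<Rightarrow> 'a::metric_space) \<Rightarrow> real" where
  "crane_samples n z \<equiv> stacker_crane_opt (\<lambda>i. z (Inl i)) (\<lambda>i. z (Inr i)) n"

lemma measurable_match_samples:
  fixes n :: nat
  assumes "{..<n} <+> {..<n} \<subseteq> J"
  shows "(match_samples n :: (_ \<Rightarrow> 'a::euclidean_space) \<Rightarrow> _) \<in> borel_measurable (PiM J (\<lambda>_. borel))"
  using assms by (intro measurable_matching_cost measurable_component_singleton) auto

lemma measurable_crane_samples:
  fixes n :: nat
  assumes "{..<n} <+> {..<n} \<subseteq> J"
  shows "(crane_samples n :: (_ \<Rightarrow> 'a::euclidean_space) \<Rightarrow> _) \<in> borel_measurable (PiM J (\<lambda>_. borel))"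
  using assms by (intro measurable_stacker_crane_opt measurable_component_singleton) auto

lemma (in prob_space) AE_happens:
  assumes "AE x in M. P x"
  shows "\<exists>x\<in>space M. P x"
proof (rule ccontr)
  assume "\<not> ?thesis"
  then have "AE x in M. P x \<longrightarrow> False" by (intro AE_I2) auto
  with assms have "AE x in M. False" by (rule AE_mp)
  then show False by simp
qed

text \<open>Pickups are the components \<open>Inl i\<close>, deliveries the components \<open>Inr i\<close>.\<close>
locale crane_sample = prob_space M for M :: "'m measure" +
  fixes Z :: "nat + nat \<Rightarrow> 'm \<Rightarrow> 'a::euclidean_space" and \<Omega> :: "'a set" and \<mu> \<nu> :: "'a measure"
    and D :: real
  assumes indep: "indep_vars (\<lambda>_. borel) Z UNIV"
    and law_Inl: "\<And>i. distr M borel (Z (Inl i)) = \<mu>" and law_Inr: "\<And>i. distr M borel (Z (Inr i)) = \<nu>"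
    and Z_in: "\<And>j \<omega>. \<omega> \<in> space M \<Longrightarrow> Z j \<omega> \<in> \<Omega>"
    and compact: "compact \<Omega>"
    and D: "\<And>a b. a \<in> \<Omega> \<Longrightarrow> b \<in> \<Omega> \<Longrightarrow> dist a b \<le> D" and D_pos: "D > 0"
begin

lemma rv [measurable]: "random_variable borel (Z j)"
  using indep by (auto simp: indep_vars_def)

lemma \<Omega>_borel: "\<Omega> \<in> sets borel"
  using compact by (simp add: borel_compact)

lemma D_Z: "\<omega> \<in> space M \<Longrightarrow> dist (Z j \<omega>) (Z k \<omega>) \<le> D"
  by (intro D Z_in)

lemma integrable_match: "integrable M (\<lambda>\<omega>. match_samples n (\<lambda>j. Z j \<omega>))"
proof (rule integrable_bounded)
  fix \<omega> assume "\<omega> \<in> space M"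
  then show "\<bar>match_samples n (\<lambda>j. Z j \<omega>)\<bar> \<le> D * real n"
    using matching_cost_nonneg[of "\<lambda>i. Z (Inr i) \<omega>" "\<lambda>i. Z (Inl i) \<omega>" n]
      matching_cost_le_diameter[of "\<lambda>i. Z (Inr i) \<omega>" "\<lambda>i. Z (Inl i) \<omega>" D n] D_Z by simp
qed measurable

lemma integrable_crane: "integrable M (\<lambda>\<omega>. crane_samples n (\<lambda>j. Z j \<omega>))"
proof (rule integrable_bounded)
  fix \<omega> assume "\<omega> \<in> space M"
  then show "\<bar>crane_samples n (\<lambda>j. Z j \<omega>)\<bar> \<le> 2 * D * real n"
    using stacker_crane_opt_nonneg[of "\<lambda>i. Z (Inl i) \<omega>" "\<lambda>i. Z (Inr i) \<omega>" n]
      stacker_crane_opt_le_diameter[of "\<lambda>i. Z (Inl i) \<omega>" "\<lambda>i. Z (Inr i) \<omega>" D n] D_Z by simp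
qed measurable

lemma integrable_dist: "integrable M (\<lambda>\<omega>. dist (Z j \<omega>) (Z k \<omega>))"
  by (rule integrable_bounded[of _ D]) (auto simp: D_Z)

lemma exchangeable:
  assumes "inj h" "\<And>j. distr M borel (Z (h j)) = distr M borel (Z j)"
    and "f \<in> borel_measurable (PiM UNIV (\<lambda>_. borel))"
  shows "expectation (\<lambda>\<omega>. f (\<lambda>j. Z (h j) \<omega>)) = (expectation (\<lambda>\<omega>. f (\<lambda>j. Z j \<omega>)) :: real)"
  using indep_vars_reindex[OF indep, of h UNIV] assms
  by (intro indep_vars_expectation_eq[OF prob_space_axioms prob_space_axioms _ indep]) auto

lemma expectation_dist_eq:
  "expectation (\<lambda>\<omega>. dist (Z (Inl i) \<omega>) (Z (Inr i) \<omega>)) = expectation (\<lambda>\<omega>. dist (Z (Inl 0) \<omega>) (Z (Inr 0) \<omega>))"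
proof -
  define h where "h = map_sum (Transposition.transpose 0 i) (Transposition.transpose 0 i)"
  have "inj h" unfolding h_def by (intro sum.inj_map) auto
  moreover have "distr M borel (Z (h j)) = distr M borel (Z j)" for j
    by (cases j) (simp_all add: h_def law_Inl law_Inr)
  moreover have "(\<lambda>z. dist (z (Inl 0)) (z (Inr 0))) \<in> borel_measurable (PiM UNIV (\<lambda>_::nat + nat. borel :: 'a measure))"
    by (intro borel_measurable_dist measurable_component_singleton) auto
  ultimately have "expectation (\<lambda>\<omega>. dist (Z (h (Inl 0)) \<omega>) (Z (h (Inr 0)) \<omega>)) =
      expectation (\<lambda>\<omega>. dist (Z (Inl 0) \<omega>) (Z (Inr 0) \<omega>))"
    by (rule exchangeable)
  then show ?thesis by (simp add: h_def)
qed

text \<open>\<open>F\<close> collects the empty legs of an optimal tour. Relabelling the deliveries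
  leaves its expectation unchanged, so it equals the average over all relabellings, which the
  deterministic bound controls outcome by outcome.\<close>

lemma expectation_crane_le:
  assumes n: "n \<ge> 1"
  shows "expectation (\<lambda>\<omega>. crane_samples n (\<lambda>j. Z j \<omega>)) \<le>
    real n * expectation (\<lambda>\<omega>. dist (Z (Inl 0) \<omega>) (Z (Inr 0) \<omega>))
    + expectation (\<lambda>\<omega>. match_samples n (\<lambda>j. Z j \<omega>)) + 2 * D * harm n"
proof -
  define F :: "(nat + nat \<Rightarrow> 'a) \<Rightarrow> real"
    where "F z = crane_samples n z - (\<Sum>i<n. dist (z (Inl i)) (z (Inr i)))" for z
  define h :: "(nat \<Rightarrow> nat) \<Rightarrow> nat + nat \<Rightarrow> nat + nat" where "h \<tau> = map_sum (\<lambda>i. i) \<tau>" for \<tau>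
  have Fm: "F \<in> borel_measurable (PiM UNIV (\<lambda>_. borel))"
    unfolding F_def
    by (intro borel_measurable_diff measurable_crane_samples borel_measurable_sum borel_measurable_dist
        measurable_component_singleton) auto
  have inj: "inj (h \<tau>)" if "\<tau> permutes {..<n}" for \<tau>
    unfolding h_def using permutes_inj[OF that] by (intro sum.inj_map) auto
  have hm: "(\<lambda>\<omega>. F (\<lambda>j. Z (h \<tau> j) \<omega>)) \<in> borel_measurable M" for \<tau>
    unfolding F_def by measurable
  have EF: "expectation (\<lambda>\<omega>. F (\<lambda>j. Z (h \<tau> j) \<omega>)) = expectation (\<lambda>\<omega>. F (\<lambda>j. Z j \<omega>))"
    if "\<tau> permutes {..<n}" for \<tau>
  proof (rule exchangeable[OF inj[OF that] _ Fm])
    fix j show "distr M borel (Z (h \<tau> j)) = distr M borel (Z j)"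
      by (cases j) (simp_all add: h_def law_Inl law_Inr)
  qed
  have Fint: "integrable M (\<lambda>\<omega>. F (\<lambda>j. Z (h \<tau> j) \<omega>))" for \<tau>
  proof (rule integrable_bounded[OF hm])
    fix \<omega> assume \<omega>: "\<omega> \<in> space M"
    have "0 \<le> crane_samples n (\<lambda>j. Z (h \<tau> j) \<omega>)" "crane_samples n (\<lambda>j. Z (h \<tau> j) \<omega>) \<le> 2 * D * real n"
      using stacker_crane_opt_nonneg stacker_crane_opt_le_diameter[OF D_Z[OF \<omega>]] by auto
    moreover have "0 \<le> (\<Sum>i<n. dist (Z (h \<tau> (Inl i)) \<omega>) (Z (h \<tau> (Inr i)) \<omega>))"
      by (intro sum_nonneg) simp
    moreover have "(\<Sum>i<n. dist (Z (h \<tau> (Inl i)) \<omega>) (Z (h \<tau> (Inr i)) \<omega>)) \<le> (\<Sum>i<n. D)"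
      using \<omega> by (intro sum_mono D_Z)
    ultimately show "\<bar>F (\<lambda>j. Z (h \<tau> j) \<omega>)\<bar> \<le> 2 * D * real n + D * real n"
      using mult_nonneg_nonneg[of D "real n"] D_pos unfolding F_def sum_constant card_lessThan abs_le_iff
      by (simp only: mult.commute[of "real n"] minus_diff_eq) linarith
  qed
  have "fact n * expectation (\<lambda>\<omega>. F (\<lambda>j. Z j \<omega>)) = (\<Sum>\<tau> | \<tau> permutes {..<n}. expectation (\<lambda>\<omega>. F (\<lambda>j. Z (h \<tau> j) \<omega>)))"
    using EF by (simp add: card_permutations)
  also have "\<dots> = expectation (\<lambda>\<omega>. \<Sum>\<tau> | \<tau> permutes {..<n}. F (\<lambda>j. Z (h \<tau> j) \<omega>))"
    using Fint by (intro Bochner_Integration.integral_sum[symmetric])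
  also have "\<dots> \<le> expectation (\<lambda>\<omega>. fact n * (match_samples n (\<lambda>j. Z j \<omega>) + 2 * D * harm n))"
  proof (rule integral_mono)
    show "integrable M (\<lambda>\<omega>. \<Sum>\<tau> | \<tau> permutes {..<n}. F (\<lambda>j. Z (h \<tau> j) \<omega>))" using Fint by simp
    show "integrable M (\<lambda>\<omega>. fact n * (match_samples n (\<lambda>j. Z j \<omega>) + 2 * D * harm n))"
      using integrable_match by simp
    fix \<omega> assume \<omega>: "\<omega> \<in> space M"
    show "(\<Sum>\<tau> | \<tau> permutes {..<n}. F (\<lambda>j. Z (h \<tau> j) \<omega>)) \<le> fact n * (match_samples n (\<lambda>j. Z j \<omega>) + 2 * D * harm n)"
      using stacker_crane_opt_average_le[of "\<lambda>i. Z (Inr i) \<omega>" "\<lambda>i. Z (Inl i) \<omega>" D n] D_Z[OF \<omega>] n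
      by (simp add: F_def h_def comp_def)
  qed
  also have "\<dots> = fact n * (expectation (\<lambda>\<omega>. match_samples n (\<lambda>j. Z j \<omega>)) + 2 * D * harm n)"
    using integrable_match by (simp add: prob_space)
  finally have "expectation (\<lambda>\<omega>. F (\<lambda>j. Z j \<omega>)) \<le> expectation (\<lambda>\<omega>. match_samples n (\<lambda>j. Z j \<omega>)) + 2 * D * harm n"
    by simp
  moreover have "expectation (\<lambda>\<omega>. F (\<lambda>j. Z j \<omega>)) = expectation (\<lambda>\<omega>. crane_samples n (\<lambda>j. Z j \<omega>))
      - real n * expectation (\<lambda>\<omega>. dist (Z (Inl 0) \<omega>) (Z (Inr 0) \<omega>))"
  proof -
    have "expectation (\<lambda>\<omega>. F (\<lambda>j. Z j \<omega>)) = expectation (\<lambda>\<omega>. crane_samples n (\<lambda>j. Z j \<omega>))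
        - (\<Sum>i<n. expectation (\<lambda>\<omega>. dist (Z (Inl i) \<omega>) (Z (Inr i) \<omega>)))"
      unfolding F_def using integrable_crane integrable_dist by simp
    also have "(\<Sum>i<n. expectation (\<lambda>\<omega>. dist (Z (Inl i) \<omega>) (Z (Inr i) \<omega>))) =
        (\<Sum>i<n. expectation (\<lambda>\<omega>. dist (Z (Inl 0) \<omega>) (Z (Inr 0) \<omega>)))"
      by (rule sum.cong[OF refl expectation_dist_eq])
    finally show ?thesis by simp
  qed
  ultimately show ?thesis by linarith
qed

text \<open>Both tails are wanted, as the expectation is to be recovered from an almost sure limit.
  The cost depends on \<open>2 * n\<close> points, each of influence \<open>D\<close>, hence the
  denominator 2 * D^2 * 2n.\<close>

lemma match_tail:
  assumes "n \<ge> 1" "t > 0"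
  shows "prob {\<omega> \<in> space M. match_samples n (\<lambda>j. Z j \<omega>) - expectation (\<lambda>\<omega>. match_samples n (\<lambda>j. Z j \<omega>)) \<ge> t}
      \<le> exp (- t\<^sup>2 / (4 * D\<^sup>2 * real n))"
    and "prob {\<omega> \<in> space M. expectation (\<lambda>\<omega>. match_samples n (\<lambda>j. Z j \<omega>)) - match_samples n (\<lambda>j. Z j \<omega>) \<ge> t}
      \<le> exp (- t\<^sup>2 / (4 * D\<^sup>2 * real n))"
proof -
  let ?J = "{..<n} <+> {..<n}"
  have J: "finite ?J" "?J \<noteq> {}" "card ?J = 2 * n" using assms(1) by (auto simp: card_Plus lessThan_empty_iff)
  have iJ: "indep_vars (\<lambda>_. borel) Z ?J" by (rule indep_vars_subset[OF indep]) simp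
  have dep: "match_samples n z = match_samples n z'" if "\<And>j. j \<in> ?J \<Longrightarrow> z j = z' j" for z z' :: "nat + nat \<Rightarrow> 'a"
    using that by (intro matching_cost_cong) auto
  have bnd: "\<bar>match_samples n z\<bar> \<le> D * real n" if "\<And>j. z j \<in> \<Omega>" for z
    using matching_cost_nonneg[of "\<lambda>i. z (Inr i)" "\<lambda>i. z (Inl i)" n]
      matching_cost_le_diameter[of "\<lambda>i. z (Inr i)" "\<lambda>i. z (Inl i)" D n] D that by simp
  have upd: "(\<forall>i. i \<noteq> k \<longrightarrow> (z(j := a)) (Inr i) = z (Inr i)) \<and> (\<lambda>i. (z(j := a)) (Inl i)) = (\<lambda>i. z (Inl i)) \<or>
       (\<forall>i. i \<noteq> k \<longrightarrow> (z(j := a)) (Inl i) = z (Inl i)) \<and> (\<lambda>i. (z(j := a)) (Inr i)) = (\<lambda>i. z (Inr i))"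
    if "j = Inl k \<or> j = Inr k" for z :: "nat + nat \<Rightarrow> 'a" and j a k
    using that by auto
  have bdiff: "\<bar>match_samples n (z(j := a)) - match_samples n z\<bar> \<le> D" if z: "\<And>j. z j \<in> \<Omega>" "a \<in> \<Omega>" for z j a
  proof -
    obtain k where k: "j = Inl k \<or> j = Inr k" by (cases j) auto
    have "match_samples n (z(j := a)) \<le> match_samples n z + D"
      using upd[OF k, of z a] z by (intro matching_cost_update_le[where i = k] D) auto
    moreover have "match_samples n z \<le> match_samples n (z(j := a)) + D"
      using upd[OF k, of z a] z by (intro matching_cost_update_le[where i = k] D) auto
    ultimately show ?thesis by linarith
  qed
  have c: "2 * D\<^sup>2 * real (card ?J) = 4 * D\<^sup>2 * real n" unfolding J(3) by simp
  show "prob {\<omega> \<in> space M. match_samples n (\<lambda>j. Z j \<omega>) - expectation (\<lambda>\<omega>. match_samples n (\<lambda>j. Z j \<omega>)) \<ge> t}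
      \<le> exp (- t\<^sup>2 / (4 * D\<^sup>2 * real n))"
    unfolding c[symmetric]
  proof (rule mcdiarmid_tail[where f = "match_samples n" and B = "D * real n",
        OF prob_space_axioms iJ J(1,2) \<Omega>_borel Z_in])
    show "(match_samples n :: (_ \<Rightarrow> 'a) \<Rightarrow> _) \<in> borel_measurable (PiM ?J (\<lambda>_. borel))"
      by (rule measurable_match_samples) simp
    show "match_samples n z = match_samples n z'" if "\<And>j. j \<in> ?J \<Longrightarrow> z j = z' j" for z z' :: "nat + nat \<Rightarrow> 'a"
      using that by (rule dep)
    show "\<bar>match_samples n z\<bar> \<le> D * real n" if "\<And>j. z j \<in> \<Omega>" for z
      using that by (rule bnd)
    show "\<bar>match_samples n (z(j := a)) - match_samples n z\<bar> \<le> D" if "\<And>j. z j \<in> \<Omega>" "a \<in> \<Omega>" for z j a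
      using that by (rule bdiff)
  qed (assumption | rule D_pos assms(2))+
  have "prob {\<omega> \<in> space M. - match_samples n (\<lambda>j. Z j \<omega>) - expectation (\<lambda>\<omega>. - match_samples n (\<lambda>j. Z j \<omega>)) \<ge> t}
      \<le> exp (- t\<^sup>2 / (4 * D\<^sup>2 * real n))"
    unfolding c[symmetric]
  proof (rule mcdiarmid_tail[where f = "\<lambda>z. - match_samples n z" and B = "D * real n",
        OF prob_space_axioms iJ J(1,2) \<Omega>_borel Z_in])
    show "(\<lambda>z. - match_samples n (z :: _ \<Rightarrow> 'a)) \<in> borel_measurable (PiM ?J (\<lambda>_. borel))"
      by (intro borel_measurable_uminus measurable_match_samples) simp
    show "- match_samples n z = - match_samples n z'" if "\<And>j. j \<in> ?J \<Longrightarrow> z j = z' j" for z z' :: "nat + nat \<Rightarrow> 'a"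
      using dep[OF that] by simp
    show "\<bar>- match_samples n z\<bar> \<le> D * real n" if "\<And>j. z j \<in> \<Omega>" for z
      using bnd[OF that] by simp
    show "\<bar>- match_samples n (z(j := a)) - - match_samples n z\<bar> \<le> D" if "\<And>j. z j \<in> \<Omega>" "a \<in> \<Omega>" for z j a
    proof -
      have "\<bar>match_samples n (z(j := a)) - match_samples n z\<bar> \<le> D" by (rule bdiff) (rule that)+
      then show ?thesis by (simp add: abs_minus_commute)
    qed
  qed (assumption | rule D_pos assms(2))+
  then show "prob {\<omega> \<in> space M. expectation (\<lambda>\<omega>. match_samples n (\<lambda>j. Z j \<omega>)) - match_samples n (\<lambda>j. Z j \<omega>) \<ge> t}
      \<le> exp (- t\<^sup>2 / (4 * D\<^sup>2 * real n))" by simp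
qed

lemma crane_tail:
  assumes "n \<ge> 1" "t > 0"
  shows "prob {\<omega> \<in> space M. crane_samples n (\<lambda>j. Z j \<omega>) - expectation (\<lambda>\<omega>. crane_samples n (\<lambda>j. Z j \<omega>)) \<ge> t}
      \<le> exp (- t\<^sup>2 / (16 * D\<^sup>2 * real n))"
proof -
  let ?J = "{..<n} <+> {..<n}"
  have J: "finite ?J" "?J \<noteq> {}" "card ?J = 2 * n" using assms(1) by (auto simp: card_Plus lessThan_empty_iff)
  have iJ: "indep_vars (\<lambda>_. borel) Z ?J" by (rule indep_vars_subset[OF indep]) simp
  have dep: "crane_samples n z = crane_samples n z'" if "\<And>j. j \<in> ?J \<Longrightarrow> z j = z' j" for z z' :: "nat + nat \<Rightarrow> 'a"
    using that by (intro stacker_crane_opt_cong) auto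
  have bnd: "\<bar>crane_samples n z\<bar> \<le> 2 * D * real n" if "\<And>j. z j \<in> \<Omega>" for z
    using stacker_crane_opt_nonneg[of "\<lambda>i. z (Inl i)" "\<lambda>i. z (Inr i)" n]
      stacker_crane_opt_le_diameter[of "\<lambda>i. z (Inl i)" "\<lambda>i. z (Inr i)" D n] D that by simp
  have upd: "(\<forall>i. i \<noteq> k \<longrightarrow> (z(j := a)) (Inr i) = z (Inr i)) \<and> (\<lambda>i. (z(j := a)) (Inl i)) = (\<lambda>i. z (Inl i)) \<or>
       (\<forall>i. i \<noteq> k \<longrightarrow> (z(j := a)) (Inl i) = z (Inl i)) \<and> (\<lambda>i. (z(j := a)) (Inr i)) = (\<lambda>i. z (Inr i))"
    if "j = Inl k \<or> j = Inr k" for z :: "nat + nat \<Rightarrow> 'a" and j a k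
    using that by auto
  have bdiff: "\<bar>crane_samples n (z(j := a)) - crane_samples n z\<bar> \<le> 2 * D" if z: "\<And>j. z j \<in> \<Omega>" "a \<in> \<Omega>" for z j a
  proof -
    obtain k where k: "j = Inl k \<or> j = Inr k" by (cases j) auto
    have "crane_samples n (z(j := a)) \<le> crane_samples n z + 2 * D"
      using upd[OF k, of z a] z by (intro stacker_crane_opt_update_le[where i = k] D) auto
    moreover have "crane_samples n z \<le> crane_samples n (z(j := a)) + 2 * D"
      using upd[OF k, of z a] z by (intro stacker_crane_opt_update_le[where i = k] D) auto
    ultimately show ?thesis by linarith
  qed
  \<comment> \<open>A point of a tour has influence \<open>2 * D\<close>, and there are
    \<open>2 * n\<close> points.\<close>
  have c: "2 * (2 * D)\<^sup>2 * real (card ?J) = 16 * D\<^sup>2 * real n" unfolding J(3) by simp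
  show ?thesis
    unfolding c[symmetric]
  proof (rule mcdiarmid_tail[where f = "crane_samples n" and B = "2 * D * real n",
        OF prob_space_axioms iJ J(1,2) \<Omega>_borel Z_in])
    show "(crane_samples n :: (_ \<Rightarrow> 'a) \<Rightarrow> _) \<in> borel_measurable (PiM ?J (\<lambda>_. borel))"
      by (rule measurable_crane_samples) simp
    show "2 * D > 0" using D_pos by simp
    show "crane_samples n z = crane_samples n z'" if "\<And>j. j \<in> ?J \<Longrightarrow> z j = z' j" for z z' :: "nat + nat \<Rightarrow> 'a"
      using that by (rule dep)
    show "\<bar>crane_samples n z\<bar> \<le> 2 * D * real n" if "\<And>j. z j \<in> \<Omega>" for z
      using that by (rule bnd)
    show "\<bar>crane_samples n (z(j := a)) - crane_samples n z\<bar> \<le> 2 * D" if "\<And>j. z j \<in> \<Omega>" "a \<in> \<Omega>" for z j a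
      using that by (rule bdiff)
  qed (assumption | rule D_pos assms(2))+
qed

end

section \<open>Almost sure deviations and couplings\<close>

lemma summable_exp_neg_cube_root:
  fixes a :: real
  assumes "a > 0"
  shows "summable (\<lambda>n. exp (- a * real n powr (1 / 3)))"
proof (rule summable_comparison_test_bigo)
  show "summable (\<lambda>n. norm (inverse (real n ^ 2)))"
    using inverse_power_summable[of 2, where 'a = real] by simp
  show "(\<lambda>n. exp (- a * real n powr (1 / 3))) \<in> O(\<lambda>n. inverse (real n ^ 2))"
    using assms by real_asymp
qed

text \<open>As \<open>q \<ge> 2 / 3\<close>, a deviation \<epsilon> n^q has probability at most exp
  (- (\<epsilon>^2 / \<kappa>) n^(1/3)); this is summable, and Borel-Cantelli applies.\<close>

lemma (in prob_space) AE_deviation_small: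
  fixes F :: "nat \<Rightarrow> 'a \<Rightarrow> real"
  assumes F: "\<And>n. F n \<in> borel_measurable M" and \<kappa>: "\<kappa> > 0" and q: "q \<ge> 2 / 3"
    and tail: "\<And>n t. n \<ge> 1 \<Longrightarrow> t > 0 \<Longrightarrow> prob {\<omega> \<in> space M. F n \<omega> - e n \<ge> t} \<le> exp (- t\<^sup>2 / (\<kappa> * real n))"
  shows "AE \<omega> in M. \<forall>\<epsilon>>0. \<forall>\<^sub>F n in sequentially. F n \<omega> - e n \<le> \<epsilon> * real n powr q"
proof -
  have "AE \<omega> in M. \<forall>\<^sub>F n in sequentially. F n \<omega> - e n \<le> \<epsilon> * real n powr q" if \<epsilon>: "\<epsilon> > 0" for \<epsilon>
  proof -
    define A where "A n = {\<omega> \<in> space M. F n \<omega> - e n \<ge> \<epsilon> * real n powr q}" for n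
    have A: "A n \<in> sets M" for n unfolding A_def using F[of n] by measurable
    have "prob (A n) \<le> exp (- (\<epsilon>\<^sup>2 / \<kappa>) * real n powr (1 / 3))" if n: "n \<ge> 1" for n
    proof -
      have "prob (A n) \<le> exp (- (\<epsilon> * real n powr q)\<^sup>2 / (\<kappa> * real n))"
        unfolding A_def using n \<epsilon> by (intro tail) auto
      also have "- (\<epsilon> * real n powr q)\<^sup>2 / (\<kappa> * real n) = - ((\<epsilon>\<^sup>2 / \<kappa>) * (real n powr (2 * q) / real n powr 1))"
        using n by (simp add: power_mult_distrib powr_power mult.commute)
      also have "real n powr (2 * q) / real n powr 1 = real n powr (2 * q - 1)"
        by (rule powr_diff[symmetric])
      finally have "prob (A n) \<le> exp (- ((\<epsilon>\<^sup>2 / \<kappa>) * real n powr (2 * q - 1)))" .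
      also have "\<dots> \<le> exp (- (\<epsilon>\<^sup>2 / \<kappa>) * real n powr (1 / 3))"
      proof -
        have "real n powr (1 / 3) \<le> real n powr (2 * q - 1)" using n q by (intro powr_mono) auto
        then have "(\<epsilon>\<^sup>2 / \<kappa>) * real n powr (1 / 3) \<le> (\<epsilon>\<^sup>2 / \<kappa>) * real n powr (2 * q - 1)"
          using \<kappa> by (intro mult_left_mono) auto
        then show ?thesis by (simp only: exp_le_cancel_iff mult_minus_left neg_le_iff_le)
      qed
      finally show ?thesis .
    qed
    then have "summable (\<lambda>n. prob (A n))"
      using \<epsilon> \<kappa> by (intro summable_comparison_test_ev[OF _ summable_exp_neg_cube_root[of "\<epsilon>\<^sup>2 / \<kappa>"]])
        (auto intro!: eventually_sequentiallyI[of 1])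
    then have "AE \<omega> in M. \<forall>\<^sub>F n in sequentially. \<omega> \<in> space M - A n"
      using A by (intro borel_cantelli_AE1) (auto simp: emeasure_eq_measure)
    then show ?thesis
      by (rule AE_mp) (auto intro!: AE_I2 elim!: eventually_mono simp: A_def)
  qed
  \<comment> \<open>Restricting to countably many values of \<epsilon> keeps the exceptional set
    null.\<close>
  then have "AE \<omega> in M. \<forall>k. \<forall>\<^sub>F n in sequentially. F n \<omega> - e n \<le> inverse (real (Suc k)) * real n powr q"
    unfolding AE_all_countable by simp
  then show ?thesis
  proof (rule AE_mp, intro AE_I2 impI allI)
    fix \<omega> and \<epsilon> :: real
    assume *: "\<forall>k. \<forall>\<^sub>F n in sequentially. F n \<omega> - e n \<le> inverse (real (Suc k)) * real n powr q" and "\<epsilon> > 0"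
    then obtain k where k: "inverse (real (Suc k)) < \<epsilon>" using reals_Archimedean by blast
    show "\<forall>\<^sub>F n in sequentially. F n \<omega> - e n \<le> \<epsilon> * real n powr q"
      using *[rule_format, of k]
    proof (rule eventually_mono)
      fix n assume "F n \<omega> - e n \<le> inverse (real (Suc k)) * real n powr q"
      also have "\<dots> \<le> \<epsilon> * real n powr q" using k by (intro mult_right_mono) auto
      finally show "F n \<omega> - e n \<le> \<epsilon> * real n powr q" .
    qed
  qed
qed

lemma indep_vars_PiM_compose:
  fixes g :: "'i \<Rightarrow> 'b \<Rightarrow> 'a::topological_space"
  assumes \<gamma>: "prob_space \<gamma>" and g: "\<And>j. g j \<in> borel_measurable \<gamma>"
  shows "prob_space.indep_vars (PiM UNIV (\<lambda>_::'i. \<gamma>)) (\<lambda>_. borel) (\<lambda>j z. g j (z j)) UNIV"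
    and "distr (PiM UNIV (\<lambda>_::'i. \<gamma>)) borel (\<lambda>z. g j (z j)) = distr \<gamma> borel (g j)"
proof -
  let ?P = "PiM UNIV (\<lambda>_::'i. \<gamma>)"
  interpret P: prob_space ?P by (rule prob_space_PiM[OF \<gamma>])
  have comp: "distr ?P \<gamma> (\<lambda>z. z i) = \<gamma>" for i by (rule distr_PiM_component[OF \<gamma>]) simp
  have m: "(\<lambda>z. z i) \<in> measurable ?P \<gamma>" for i by (rule measurable_component_singleton) simp
  have "P.indep_vars (\<lambda>_. \<gamma>) (\<lambda>j z. z j) UNIV"
    by (subst P.indep_vars_iff_distr_eq_PiM) (auto simp: comp m restrict_UNIV distr_id2)
  then show "P.indep_vars (\<lambda>_. borel) (\<lambda>j z. g j (z j)) UNIV"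
    by (rule P.indep_vars_compose2) (rule g)
  have "distr \<gamma> borel (g j) = distr (distr ?P \<gamma> (\<lambda>z. z j)) borel (g j)" by (simp add: comp)
  also have "\<dots> = distr ?P borel (\<lambda>z. g j (z j))" by (subst distr_distr[OF g m]) (simp add: comp_def)
  finally show "distr ?P borel (\<lambda>z. g j (z j)) = distr \<gamma> borel (g j)" by simp
qed

context crane_sample
begin

text \<open>Draw i.i.d. pairs from the coupling \<open>\<gamma>\<close> over the whole index set \<open>nat + nat\<close>: taking the second
  component at \<open>Inl i\<close> and the first at \<open>Inr i\<close> reproduces the law of \<open>Z\<close>, while taking the same
  component everywhere gives two samples of one law, at distance the coupling cost.\<close>
lemma expectation_match_le_coupling:
  fixes V :: "nat + nat \<Rightarrow> 'm \<Rightarrow> 'a"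
  assumes \<gamma>: "prob_space \<gamma>" and sets_\<gamma>: "sets \<gamma> = sets borel"
    and fst_\<gamma>: "distr \<gamma> borel fst = \<nu>" and snd_\<gamma>: "distr \<gamma> borel snd = \<mu>"
    and AE_\<gamma>: "AE z in \<gamma>. fst z \<in> \<Omega> \<and> snd z \<in> \<Omega>"
    and V: "crane_sample M V \<Omega> \<nu> \<nu> D \<or> crane_sample M V \<Omega> \<mu> \<mu> D"
  shows "expectation (\<lambda>\<omega>. match_samples n (\<lambda>j. Z j \<omega>)) \<le>
    real n * (\<integral>z. dist (fst z) (snd z) \<partial>\<gamma>) + expectation (\<lambda>\<omega>. match_samples n (\<lambda>j. V j \<omega>))"
proof -
  obtain \<omega>0 where \<omega>0: "\<omega>0 \<in> space M" using not_empty by blast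
  \<comment> \<open>The coupling is concentrated on \<open>\<Omega> \<times> \<Omega>\<close> only
    almost surely; this retraction secures membership everywhere and preserves the laws.\<close>
  define p where "p x = (if x \<in> \<Omega> then x else Z (Inl 0) \<omega>0)" for x
  have p_in: "p x \<in> \<Omega>" for x using Z_in[OF \<omega>0] by (simp add: p_def)
  have pm [measurable]: "p \<in> borel_measurable borel" unfolding p_def using \<Omega>_borel by measurable
  have fm [measurable]: "fst \<in> measurable \<gamma> borel" "snd \<in> measurable \<gamma> borel"
    by (simp_all add: measurable_cong_sets[OF sets_\<gamma> refl] borel_prod[symmetric])
  have law_p: "distr (distr M borel (Z j)) borel p = distr M borel (Z j)" for j
    by (subst distr_distr) (auto intro!: distr_cong simp: p_def Z_in)
  have law_A: "distr \<gamma> borel (\<lambda>z. p (fst z)) = \<nu>"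
  proof -
    have "distr \<gamma> borel (\<lambda>z. p (fst z)) = distr (distr \<gamma> borel fst) borel p"
      by (subst distr_distr) (auto simp: comp_def)
    then show ?thesis using law_p[of "Inr 0"] by (simp add: fst_\<gamma> law_Inr)
  qed
  have law_B: "distr \<gamma> borel (\<lambda>z. p (snd z)) = \<mu>"
  proof -
    have "distr \<gamma> borel (\<lambda>z. p (snd z)) = distr (distr \<gamma> borel snd) borel p"
      by (subst distr_distr) (auto simp: comp_def)
    then show ?thesis using law_p[of "Inl 0"] by (simp add: snd_\<gamma> law_Inl)
  qed
  define P where "P = PiM UNIV (\<lambda>_::nat + nat. \<gamma>)"
  interpret P: prob_space P unfolding P_def by (rule prob_space_PiM[OF \<gamma>])
  define A B where "A j z = p (fst (z j))" and "B j z = p (snd (z j))" for j :: "nat + nat" and z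
  have cm: "(\<lambda>z. z j) \<in> measurable P \<gamma>" for j unfolding P_def by (rule measurable_component_singleton) simp
  have AB [measurable]: "A j \<in> borel_measurable P" "B j \<in> borel_measurable P" for j
    unfolding A_def B_def using measurable_compose[OF cm] by (auto intro!: measurable_compose[OF cm, of "\<lambda>z. p (fst z)"] measurable_compose[OF cm, of "\<lambda>z. p (snd z)"])
  have AB_D: "dist (A j z) (A k z) \<le> D" "dist (A j z) (B k z) \<le> D" "dist (B j z) (B k z) \<le> D" for j k z
    unfolding A_def B_def by (intro D p_in)+
  define C where "C = case_sum (\<lambda>i. B (Inl i)) (\<lambda>i. A (Inr i))"
  \<comment> \<open>Any choice of \<open>A\<close> or \<open>B\<close>, index by index, gives an
    independent family, since distinct indices use distinct copies of \<open>\<gamma>\<close>. It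
    remains to compare marginals with those of \<open>W\<close>.\<close>
  have transfer: "P.expectation (\<lambda>z. match_samples n (\<lambda>j. G j z)) = expectation (\<lambda>\<omega>. match_samples n (\<lambda>j. W j \<omega>))"
    if G: "\<And>j. G j = A j \<and> distr M borel (W j) = \<nu> \<or> G j = B j \<and> distr M borel (W j) = \<mu>"
      and W: "indep_vars (\<lambda>_. borel) W UNIV" for G and W :: "nat + nat \<Rightarrow> 'm \<Rightarrow> 'a"
  proof -
    define g where "g j = (if G j = A j \<and> distr M borel (W j) = \<nu> then (\<lambda>z. p (fst z)) else (\<lambda>z. p (snd z)))" for j
    have gm: "g j \<in> borel_measurable \<gamma>" for j unfolding g_def by simp
    have Gg: "G = (\<lambda>j z. g j (z j))"
    proof
      fix j show "G j = (\<lambda>z. g j (z j))" using G[of j] by (auto simp: g_def A_def B_def fun_eq_iff)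
    qed
    have "distr P borel (G j) = distr \<gamma> borel (g j)" for j
      unfolding Gg P_def by (rule indep_vars_PiM_compose(2)[OF \<gamma> gm])
    moreover have "distr \<gamma> borel (g j) = distr M borel (W j)" for j
      using G[of j] by (auto simp: g_def law_A law_B)
    moreover have "P.indep_vars (\<lambda>_. borel) G UNIV"
      unfolding Gg P_def by (rule indep_vars_PiM_compose(1)[OF \<gamma> gm])
    ultimately show ?thesis
      by (intro indep_vars_expectation_eq[OF P.prob_space_axioms prob_space_axioms _ W] measurable_match_samples) auto
  qed
  have EZ: "P.expectation (\<lambda>z. match_samples n (\<lambda>j. C j z)) = expectation (\<lambda>\<omega>. match_samples n (\<lambda>j. Z j \<omega>))"
  proof (rule transfer[OF _ indep])
    fix j show "C j = A j \<and> distr M borel (Z j) = \<nu> \<or> C j = B j \<and> distr M borel (Z j) = \<mu>"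
      by (cases j) (simp_all add: C_def law_Inl law_Inr)
  qed
  have Ed: "P.expectation (\<lambda>z. dist (A j z) (B j z)) = (\<integral>z. dist (fst z) (snd z) \<partial>\<gamma>)" for j
  proof -
    have "(\<integral>z. dist (fst z) (snd z) \<partial>\<gamma>) = (\<integral>z. dist (p (fst z)) (p (snd z)) \<partial>\<gamma>)"
    proof (rule integral_cong_AE)
      show "AE z in \<gamma>. dist (fst z) (snd z) = dist (p (fst z)) (p (snd z))"
        using AE_\<gamma> by eventually_elim (simp add: p_def)
    qed simp_all
    also have "\<dots> = (\<integral>z. dist (p (fst z)) (p (snd z)) \<partial>distr P \<gamma> (\<lambda>z. z j))"
      unfolding P_def by (subst distr_PiM_component[OF \<gamma>]) auto
    also have "\<dots> = P.expectation (\<lambda>z. dist (A j z) (B j z))"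
      unfolding A_def B_def by (rule integral_distr[OF cm]) simp
    finally show ?thesis by simp
  qed
  have int_d: "integrable P (\<lambda>z. dist (A j z) (B j z))" for j
    by (rule P.integrable_bounded[of _ D]) (auto simp: AB_D)
  have int_m: "integrable P (\<lambda>z. match_samples n (\<lambda>j. G j z))" if "\<And>j. G j = A j \<or> G j = B j" for G
  proof (rule P.integrable_bounded[of _ "D * real n"])
    have "G j \<in> borel_measurable P" for j using that[of j] AB by metis
    then show "(\<lambda>z. match_samples n (\<lambda>j. G j z)) \<in> borel_measurable P" by measurable
    fix z
    have "dist (G j z) (G k z) \<le> D" for j k
      using that[of j] that[of k] AB_D by (metis dist_commute)
    then show "\<bar>match_samples n (\<lambda>j. G j z)\<bar> \<le> D * real n"
      using matching_cost_nonneg[of "\<lambda>i. G (Inr i) z" "\<lambda>i. G (Inl i) z" n]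
        matching_cost_le_diameter[of "\<lambda>i. G (Inr i) z" "\<lambda>i. G (Inl i) z" D n] by simp
  qed
  have int_C: "integrable P (\<lambda>z. match_samples n (\<lambda>j. C j z))"
  proof (rule int_m)
    fix j show "C j = A j \<or> C j = B j" by (cases j) (simp_all add: C_def)
  qed
  show ?thesis using V
  proof
    assume "crane_sample M V \<Omega> \<nu> \<nu> D"
    then interpret V: crane_sample M V \<Omega> \<nu> \<nu> D .
    have lawV: "distr M borel (V j) = \<nu>" for j by (cases j) (simp_all add: V.law_Inl V.law_Inr)
    \<comment> \<open>The deliveries of \<open>C\<close> are already those of \<open>A\<close>. Only
      the pickups are exchanged, at the cost of \<open>n\<close> coupled distances.\<close>
    have "P.expectation (\<lambda>z. match_samples n (\<lambda>j. C j z)) \<le>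
        P.expectation (\<lambda>z. match_samples n (\<lambda>j. A j z) + (\<Sum>i<n. dist (A (Inl i) z) (B (Inl i) z)))"
    proof (rule integral_mono[OF int_C])
      show "integrable P (\<lambda>z. match_samples n (\<lambda>j. A j z) + (\<Sum>i<n. dist (A (Inl i) z) (B (Inl i) z)))"
        using int_d int_m by simp
      fix z show "match_samples n (\<lambda>j. C j z) \<le> match_samples n (\<lambda>j. A j z) + (\<Sum>i<n. dist (A (Inl i) z) (B (Inl i) z))"
        using matching_cost_triangle[of "\<lambda>i. A (Inr i) z" "\<lambda>i. B (Inl i) z" n "\<lambda>i. A (Inl i) z"]
          matching_cost_le_sum[of "\<lambda>i. A (Inl i) z" "\<lambda>i. B (Inl i) z" n] by (simp add: C_def)
    qed
    also have "\<dots> = P.expectation (\<lambda>z. match_samples n (\<lambda>j. A j z)) + real n * (\<integral>z. dist (fst z) (snd z) \<partial>\<gamma>)"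
      using int_d int_m by (simp add: Ed)
    also have "P.expectation (\<lambda>z. match_samples n (\<lambda>j. A j z)) = expectation (\<lambda>\<omega>. match_samples n (\<lambda>j. V j \<omega>))"
      using lawV by (intro transfer V.indep) simp
    finally show ?thesis by (simp add: EZ)
  next
    assume "crane_sample M V \<Omega> \<mu> \<mu> D"
    then interpret V: crane_sample M V \<Omega> \<mu> \<mu> D .
    have lawV: "distr M borel (V j) = \<mu>" for j by (cases j) (simp_all add: V.law_Inl V.law_Inr)
    \<comment> \<open>Now the pickups agree with those of \<open>B\<close>, and the deliveries are
      exchanged.\<close>
    have "P.expectation (\<lambda>z. match_samples n (\<lambda>j. C j z)) \<le>
        P.expectation (\<lambda>z. match_samples n (\<lambda>j. B j z) + (\<Sum>i<n. dist (A (Inr i) z) (B (Inr i) z)))"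
    proof (rule integral_mono[OF int_C])
      show "integrable P (\<lambda>z. match_samples n (\<lambda>j. B j z) + (\<Sum>i<n. dist (A (Inr i) z) (B (Inr i) z)))"
        using int_d int_m by simp
      fix z show "match_samples n (\<lambda>j. C j z) \<le> match_samples n (\<lambda>j. B j z) + (\<Sum>i<n. dist (A (Inr i) z) (B (Inr i) z))"
        using matching_cost_triangle[of "\<lambda>i. A (Inr i) z" "\<lambda>i. B (Inl i) z" n "\<lambda>i. B (Inr i) z"]
          matching_cost_le_sum[of "\<lambda>i. A (Inr i) z" "\<lambda>i. B (Inr i) z" n] by (simp add: C_def)
    qed
    also have "\<dots> = P.expectation (\<lambda>z. match_samples n (\<lambda>j. B j z)) + real n * (\<integral>z. dist (fst z) (snd z) \<partial>\<gamma>)"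
      using int_d int_m by (simp add: Ed)
    also have "P.expectation (\<lambda>z. match_samples n (\<lambda>j. B j z)) = expectation (\<lambda>\<omega>. match_samples n (\<lambda>j. V j \<omega>))"
      using lawV by (intro transfer V.indep) simp
    finally show ?thesis by (simp add: EZ)
  qed
qed

lemma crane_sample_reindex:
  assumes h: "inj h" and law: "\<And>j. distr M borel (Z (h j)) = \<rho>"
  shows "crane_sample M (\<lambda>j. Z (h j)) \<Omega> \<rho> \<rho> D"
proof
  show "indep_vars (\<lambda>_. borel) (\<lambda>j. Z (h j)) UNIV"
    using indep_vars_reindex[OF indep, of h UNIV] h by simp
qed (use law Z_in compact D D_pos in auto)

end

text \<open>Concentration read backwards: almost surely the matching cost is within o(n^q) of its
  mean, so its limit is also that of the means. The means are deterministic, so one outcome common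
  to the three almost sure events suffices.\<close>

lemma (in crane_sample) expectation_match_limit:
  fixes \<phi> :: "'a \<Rightarrow> real"
  assumes same: "\<mu> = density lborel (\<lambda>x. ennreal (\<phi> x))" "\<nu> = density lborel (\<lambda>x. ennreal (\<phi> x))"
    and \<phi>: "\<And>x. 0 \<le> \<phi> x" "(\<lambda>x. ennreal (\<phi> x)) \<in> borel_measurable lborel"
    and dim: "DIM('a) \<ge> 3" and \<beta>: "beta_M_property TYPE('m) TYPE('a) \<beta>"
  shows "(\<lambda>n. expectation (\<lambda>\<omega>. match_samples n (\<lambda>j. Z j \<omega>)) / real n powr (1 - 1 / real DIM('a)))
    \<longlonglongrightarrow> \<beta> * (\<integral>x\<in>\<Omega>. \<phi> x powr (1 - 1 / real DIM('a)) \<partial>lborel)"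
proof -
  define q where "q = 1 - 1 / real DIM('a)"
  have q: "q \<ge> 2 / 3" unfolding q_def using dim by (simp add: field_simps)
  define e where "e n = expectation (\<lambda>\<omega>. match_samples n (\<lambda>j. Z j \<omega>))" for n
  define I where "I = \<beta> * (\<integral>x\<in>\<Omega>. \<phi> x powr q \<partial>lborel)"
  have dist: "distributed M lborel (Z j) (\<lambda>x. ennreal (\<phi> x))" for j
  proof -
    have "distr M lborel (Z j) = distr M borel (Z j)" by (rule distr_cong) auto
    also have "\<dots> = density lborel (\<lambda>x. ennreal (\<phi> x))"
      by (cases j) (simp_all add: law_Inl law_Inr same)
    finally show ?thesis using \<phi>(2) by (simp add: distributed_def)
  qed
  \<comment> \<open>\<open>match_samples\<close> puts the deliveries first, so they play the part of
    \<open>U\<close> in \<open>beta_M_property\<close> and the two summands have to be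
    swapped.\<close>
  have "indep_vars (\<lambda>_. borel) (\<lambda>j. Z (case_sum Inr Inl j)) UNIV"
    using indep_vars_reindex[OF indep, of "case_sum Inr Inl" UNIV]
    by (auto simp: inj_on_def split: sum.splits)
  also have "(\<lambda>j. Z (case_sum Inr Inl j)) = case_sum (\<lambda>i. Z (Inr i)) (\<lambda>i. Z (Inl i))"
    by (auto split: sum.splits)
  finally have ind: "indep_vars (\<lambda>_. borel) (case_sum (\<lambda>i. Z (Inr i)) (\<lambda>i. Z (Inl i))) UNIV" .
  have "AE \<omega> in M. (\<lambda>n. match_samples n (\<lambda>j. Z j \<omega>) / real n powr q) \<longlonglongrightarrow> I"
    using \<beta>[unfolded beta_M_property_def, rule_format, of M \<Omega> \<phi> "\<lambda>i. Z (Inr i)" "\<lambda>i. Z (Inl i)"]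
      prob_space_axioms compact \<phi>(1) dist ind Z_in
    unfolding I_def q_def by auto
  moreover have "AE \<omega> in M. \<forall>\<epsilon>>0. \<forall>\<^sub>F n in sequentially. match_samples n (\<lambda>j. Z j \<omega>) - e n \<le> \<epsilon> * real n powr q"
    unfolding e_def using D_pos match_tail(1)
    by (intro AE_deviation_small[where \<kappa> = "4 * D\<^sup>2", OF _ _ q]) auto
  moreover have "AE \<omega> in M. \<forall>\<epsilon>>0. \<forall>\<^sub>F n in sequentially. - match_samples n (\<lambda>j. Z j \<omega>) - (- e n) \<le> \<epsilon> * real n powr q"
    unfolding e_def using D_pos match_tail(2)
    by (intro AE_deviation_small[where \<kappa> = "4 * D\<^sup>2", OF _ _ q]) auto
  ultimately have "AE \<omega> in M. (\<lambda>n. match_samples n (\<lambda>j. Z j \<omega>) / real n powr q) \<longlonglongrightarrow> I \<and>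
      (\<forall>\<epsilon>>0. \<forall>\<^sub>F n in sequentially. match_samples n (\<lambda>j. Z j \<omega>) - e n \<le> \<epsilon> * real n powr q) \<and>
      (\<forall>\<epsilon>>0. \<forall>\<^sub>F n in sequentially. - match_samples n (\<lambda>j. Z j \<omega>) - (- e n) \<le> \<epsilon> * real n powr q)"
    by auto
  then obtain \<omega> where lim: "(\<lambda>n. match_samples n (\<lambda>j. Z j \<omega>) / real n powr q) \<longlonglongrightarrow> I"
    and up: "\<And>\<epsilon>. \<epsilon> > 0 \<Longrightarrow> \<forall>\<^sub>F n in sequentially. match_samples n (\<lambda>j. Z j \<omega>) - e n \<le> \<epsilon> * real n powr q"
    and lo: "\<And>\<epsilon>. \<epsilon> > 0 \<Longrightarrow> \<forall>\<^sub>F n in sequentially. - match_samples n (\<lambda>j. Z j \<omega>) - (- e n) \<le> \<epsilon> * real n powr q"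
    using AE_happens by blast
  have "(\<lambda>n. (match_samples n (\<lambda>j. Z j \<omega>) - e n) / real n powr q) \<longlonglongrightarrow> 0"
  proof (rule tendstoI)
    fix \<epsilon> :: real assume \<epsilon>: "\<epsilon> > 0"
    have "\<forall>\<^sub>F n in sequentially. n \<ge> (1::nat)" by (rule eventually_ge_at_top)
    then show "\<forall>\<^sub>F n in sequentially. dist ((match_samples n (\<lambda>j. Z j \<omega>) - e n) / real n powr q) 0 < \<epsilon>"
      using up[OF half_gt_zero[OF \<epsilon>]] lo[OF half_gt_zero[OF \<epsilon>]]
    proof eventually_elim
      case (elim n)
      then have pos: "real n powr q > 0" by simp
      have "\<bar>match_samples n (\<lambda>j. Z j \<omega>) - e n\<bar> \<le> \<epsilon> / 2 * real n powr q" using elim by linarith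
      then have "\<bar>match_samples n (\<lambda>j. Z j \<omega>) - e n\<bar> / real n powr q \<le> \<epsilon> / 2"
        using pos by (simp add: pos_divide_le_eq)
      then have "\<bar>match_samples n (\<lambda>j. Z j \<omega>) - e n\<bar> / real n powr q < \<epsilon>" using \<epsilon> by linarith
      then show ?case by simp
    qed
  qed
  from tendsto_diff[OF lim this] have "(\<lambda>n. e n / real n powr q) \<longlonglongrightarrow> I"
    by (simp add: diff_divide_distrib)
  then show ?thesis unfolding e_def I_def q_def .
qed

lemma coupling_near_optimal:
  fixes \<phi>1 \<phi>2 :: "'a::euclidean_space \<Rightarrow> real"
  assumes \<Omega>: "compact \<Omega>" and ne: "couplings \<Omega> \<phi>1 \<phi>2 \<noteq> {}"
    and prob1: "prob_space (density lborel (\<lambda>x. ennreal (\<phi>1 x)))" and \<epsilon>: "\<epsilon> > 0"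
  obtains \<gamma> where "prob_space \<gamma>" "sets \<gamma> = sets borel"
    "distr \<gamma> borel fst = density lborel (\<lambda>x. ennreal (\<phi>1 x))"
    "distr \<gamma> borel snd = density lborel (\<lambda>x. ennreal (\<phi>2 x))"
    "AE z in \<gamma>. fst z \<in> \<Omega> \<and> snd z \<in> \<Omega>"
    "(\<integral>z. dist (fst z) (snd z) \<partial>\<gamma>) \<le> wasserstein \<Omega> \<phi>1 \<phi>2 + \<epsilon>"
proof -
  have space: "space \<gamma> = UNIV" "fst \<in> measurable \<gamma> borel" "snd \<in> measurable \<gamma> borel"
    if "sets \<gamma> = sets borel" for \<gamma> :: "('a \<times> 'a) measure"
  proof -
    show "space \<gamma> = UNIV" using sets_eq_imp_space_eq[OF that] by simp
  qed (simp_all add: measurable_cong_sets[OF that refl] borel_prod[symmetric])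
  have prob: "prob_space \<gamma>" if "\<gamma> \<in> couplings \<Omega> \<phi>1 \<phi>2" for \<gamma>
  proof -
    have \<gamma>: "sets \<gamma> = sets borel" "distr \<gamma> borel fst = density lborel (\<lambda>x. ennreal (\<phi>1 x))"
      using that by (auto simp: couplings_def)
    have "prob_space (distr \<gamma> borel fst)" using prob1 by (simp add: \<gamma>(2))
    then show ?thesis by (rule prob_space_distrD[OF space(2)[OF \<gamma>(1)]])
  qed
  have AE: "AE z in \<gamma>. fst z \<in> \<Omega> \<and> snd z \<in> \<Omega>" if "\<gamma> \<in> couplings \<Omega> \<phi>1 \<phi>2" for \<gamma>
  proof (rule AE_I)
    have \<gamma>: "sets \<gamma> = sets borel" "emeasure \<gamma> (space \<gamma> - \<Omega> \<times> \<Omega>) = 0"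
      using that by (auto simp: couplings_def)
    show "{z \<in> space \<gamma>. \<not> (fst z \<in> \<Omega> \<and> snd z \<in> \<Omega>)} \<subseteq> space \<gamma> - \<Omega> \<times> \<Omega>" by auto
    show "emeasure \<gamma> (space \<gamma> - \<Omega> \<times> \<Omega>) = 0" by fact
    have "\<Omega> \<times> \<Omega> \<in> sets borel" using \<Omega> by (intro borel_compact compact_Times)
    then show "space \<gamma> - \<Omega> \<times> \<Omega> \<in> sets \<gamma>" unfolding \<gamma>(1) space(1)[OF \<gamma>(1)] by auto
  qed
  define cost where "cost \<gamma> = (\<integral>\<^sup>+ z. ennreal (norm (snd z - fst z)) \<partial>\<gamma>)" for \<gamma> :: "('a \<times> 'a) measure"
  define I where "I = (INF \<gamma>\<in>couplings \<Omega> \<phi>1 \<phi>2. cost \<gamma>)"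
  have W: "wasserstein \<Omega> \<phi>1 \<phi>2 = enn2real I" by (simp add: wasserstein_def I_def cost_def)
  obtain \<gamma>0 where \<gamma>0: "\<gamma>0 \<in> couplings \<Omega> \<phi>1 \<phi>2" using ne by blast
  \<comment> \<open>\<open>enn2real\<close> sends infinity to 0, so the infimum must be seen to be
    finite before its real value says anything about costs. One coupling is enough, its cost being
    at most the diameter.\<close>
  have "cost \<gamma>0 < \<infinity>"
  proof -
    interpret prob_space \<gamma>0 by (rule prob[OF \<gamma>0])
    have bd: "bounded \<Omega>" using \<Omega> by (rule compact_imp_bounded)
    have "cost \<gamma>0 \<le> (\<integral>\<^sup>+ z. ennreal (diameter \<Omega>) \<partial>\<gamma>0)"
      unfolding cost_def
    proof (rule nn_integral_mono_AE)
      show "AE z in \<gamma>0. ennreal (norm (snd z - fst z)) \<le> ennreal (diameter \<Omega>)"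
        using AE[OF \<gamma>0]
      proof eventually_elim
        case (elim z)
        then show ?case using diameter_bounded_bound[OF bd, of "snd z" "fst z"] by (simp add: dist_norm ennreal_leI)
      qed
    qed
    also have "\<dots> < \<infinity>" by (simp add: emeasure_space_1)
    finally show ?thesis .
  qed
  then have "I < \<infinity>" unfolding I_def using \<gamma>0 by (meson INF_lower le_less_trans)
  then have "I = ennreal (enn2real I)" by simp
  also have "\<dots> < ennreal (enn2real I + \<epsilon>)" using \<epsilon> by (intro ennreal_lessI) (auto simp: add_nonneg_pos)
  finally have "\<exists>\<gamma>\<in>couplings \<Omega> \<phi>1 \<phi>2. cost \<gamma> < ennreal (enn2real I + \<epsilon>)"
    unfolding I_def INF_less_iff .
  then obtain \<gamma> where \<gamma>: "\<gamma> \<in> couplings \<Omega> \<phi>1 \<phi>2" "cost \<gamma> < ennreal (enn2real I + \<epsilon>)" by blast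
  have "(\<integral>z. dist (fst z) (snd z) \<partial>\<gamma>) \<le> wasserstein \<Omega> \<phi>1 \<phi>2 + \<epsilon>"
    unfolding W using \<gamma>(2) \<epsilon> by (intro integral_real_bounded) (auto simp: cost_def dist_norm norm_minus_commute less_imp_le)
  then show ?thesis using that[of \<gamma>] prob[OF \<gamma>(1)] AE[OF \<gamma>(1)] \<gamma>(1) by (auto simp: couplings_def)
qed

section \<open>The asymptotic bounds\<close>

lemma (in crane_sample) AE_limsup_crane_le:
  assumes q: "q \<ge> 2 / 3" and lim: "(\<lambda>n. m n / real n powr q) \<longlonglongrightarrow> I"
    and e: "\<And>n. n \<ge> 1 \<Longrightarrow>
      expectation (\<lambda>\<omega>. crane_samples n (\<lambda>j. Z j \<omega>)) \<le> real n * c + m n + 2 * D * harm n"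
  shows "AE \<omega> in M. limsup (\<lambda>n. ereal ((crane_samples n (\<lambda>j. Z j \<omega>) - real n * c) / real n powr q)) \<le> ereal I"
proof -
  define E where "E n = expectation (\<lambda>\<omega>. crane_samples n (\<lambda>j. Z j \<omega>))" for n
  have "AE \<omega> in M. \<forall>\<epsilon>>0. \<forall>\<^sub>F n in sequentially. crane_samples n (\<lambda>j. Z j \<omega>) - E n \<le> \<epsilon> * real n powr q"
    unfolding E_def using D_pos crane_tail
    by (intro AE_deviation_small[where \<kappa> = "16 * D\<^sup>2", OF _ _ q]) auto
  then show ?thesis
  proof (rule AE_mp, intro AE_I2 impI)
    fix \<omega>
    assume dev: "\<forall>\<epsilon>>0. \<forall>\<^sub>F n in sequentially. crane_samples n (\<lambda>j. Z j \<omega>) - E n \<le> \<epsilon> * real n powr q"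
    have "limsup (\<lambda>n. ereal ((crane_samples n (\<lambda>j. Z j \<omega>) - real n * c) / real n powr q)) \<le> ereal I + ereal \<epsilon>"
      if \<epsilon>: "\<epsilon> > 0" for \<epsilon>
    proof -
      \<comment> \<open>One third each for the deviation, for the convergence of \<open>m n\<close>,
        and for the harmonic term, which is of order log n against n^(2/3).\<close>
      define \<delta> where "\<delta> = \<epsilon> / 3"
      have \<delta>: "\<delta> > 0" using \<epsilon> by (simp add: \<delta>_def)
      have "(\<lambda>n. 2 * D * ((1 + ln (real n)) / real n powr (2 / 3))) \<longlonglongrightarrow> 2 * D * 0"
        by (intro tendsto_intros) real_asymp
      then have "\<forall>\<^sub>F n in sequentially. 2 * D * ((1 + ln (real n)) / real n powr (2 / 3)) < \<delta>"
        using \<delta> by (intro order_tendstoD(2)) auto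
      moreover have "\<forall>\<^sub>F n in sequentially. m n / real n powr q < I + \<delta>"
        using lim \<delta> by (intro order_tendstoD(2)) auto
      moreover have "\<forall>\<^sub>F n in sequentially. crane_samples n (\<lambda>j. Z j \<omega>) - E n \<le> \<delta> * real n powr q"
        using dev \<delta> by blast
      moreover have "\<forall>\<^sub>F n in sequentially. n \<ge> (1::nat)" by (rule eventually_ge_at_top)
      ultimately have "\<forall>\<^sub>F n in sequentially.
          ereal ((crane_samples n (\<lambda>j. Z j \<omega>) - real n * c) / real n powr q) \<le> ereal (I + \<epsilon>)"
      proof eventually_elim
        case (elim n)
        then have n: "n \<ge> 1" by simp
        then have pos: "real n powr q > 0" by simp
        have "2 * D * harm n / real n powr q \<le> 2 * D * ((1 + ln (real n)) / real n powr (2 / 3))"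
        proof -
          have "harm n / real n powr q \<le> (1 + ln (real n)) / real n powr (2 / 3)"
            using n q by (intro frac_le harm_le_1_plus_ln powr_mono) auto
          then have "2 * D * (harm n / real n powr q) \<le> 2 * D * ((1 + ln (real n)) / real n powr (2 / 3))"
            using D_pos by (intro mult_left_mono) auto
          then show ?thesis by simp
        qed
        moreover have "(crane_samples n (\<lambda>j. Z j \<omega>) - real n * c) / real n powr q \<le>
            (\<delta> * real n powr q + m n + 2 * D * harm n) / real n powr q"
          using e[OF n] elim(3) by (intro divide_right_mono) (auto simp: E_def)
        moreover have "(\<delta> * real n powr q + m n + 2 * D * harm n) / real n powr q =
            \<delta> + m n / real n powr q + 2 * D * harm n / real n powr q"
          using pos by (simp add: add_divide_distrib)
        ultimately have "(crane_samples n (\<lambda>j. Z j \<omega>) - real n * c) / real n powr q \<le> I + \<epsilon>"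
          using elim(1,2) by (simp add: \<delta>_def)
        then show ?case by simp
      qed
      then show ?thesis by (simp add: Limsup_bounded)
    qed
    then show "limsup (\<lambda>n. ereal ((crane_samples n (\<lambda>j. Z j \<omega>) - real n * c) / real n powr q)) \<le> ereal I"
      by (rule ereal_le_epsilon2)
  qed
qed

text \<open>The slack 1 above \<open>C\<close> allows a deviation sqrt (n ln n), whose probability
  is at most n^(-a) with a = 1 / (16 D^2). This tends to 0 whatever the size of
  \<open>D\<close>.\<close>

lemma (in crane_sample) crane_probability_tendsto_1:
  assumes e: "\<And>n. n \<ge> 2 \<Longrightarrow>
      expectation (\<lambda>\<omega>. crane_samples n (\<lambda>j. Z j \<omega>)) \<le> real n * c + C * sqrt (real n * ln (real n))"
  shows "(\<lambda>n. prob {\<omega> \<in> space M. (crane_samples n (\<lambda>j. Z j \<omega>) - real n * c) / sqrt (real n * ln (real n)) \<le> C + 1})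
    \<longlonglongrightarrow> 1"
proof (rule tendsto_sandwich)
  define E where "E n = expectation (\<lambda>\<omega>. crane_samples n (\<lambda>j. Z j \<omega>))" for n
  define a where "a = 1 / (16 * D\<^sup>2)"
  have "a > 0" using D_pos by (simp add: a_def)
  then show "(\<lambda>n. 1 - exp (- a * ln (real n))) \<longlonglongrightarrow> 1" by real_asymp
  show "\<forall>\<^sub>F n in sequentially. prob {\<omega> \<in> space M. (crane_samples n (\<lambda>j. Z j \<omega>) - real n * c) / sqrt (real n * ln (real n)) \<le> C + 1} \<le> 1"
    by simp
  show "\<forall>\<^sub>F n in sequentially. 1 - exp (- a * ln (real n)) \<le>
      prob {\<omega> \<in> space M. (crane_samples n (\<lambda>j. Z j \<omega>) - real n * c) / sqrt (real n * ln (real n)) \<le> C + 1}"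
  proof (rule eventually_sequentiallyI[of 2])
    fix n :: nat assume n: "n \<ge> 2"
    define s where "s = sqrt (real n * ln (real n))"
    have nl: "real n * ln (real n) > 0" using n by simp
    then have s: "s > 0" by (simp add: s_def)
    define B where "B = {\<omega> \<in> space M. crane_samples n (\<lambda>j. Z j \<omega>) - E n \<ge> s}"
    have B: "B \<in> events" unfolding B_def by measurable
    have "prob B \<le> exp (- s\<^sup>2 / (16 * D\<^sup>2 * real n))"
      unfolding B_def E_def using n s by (intro crane_tail) auto
    also have "- s\<^sup>2 / (16 * D\<^sup>2 * real n) = - a * ln (real n)"
      using nl n by (simp add: s_def a_def)
    finally have "1 - exp (- a * ln (real n)) \<le> prob (space M - B)" using prob_compl[OF B] by simp
    also have "\<dots> \<le> prob {\<omega> \<in> space M. (crane_samples n (\<lambda>j. Z j \<omega>) - real n * c) / s \<le> C + 1}"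
    proof (rule finite_measure_mono)
      show "space M - B \<subseteq> {\<omega> \<in> space M. (crane_samples n (\<lambda>j. Z j \<omega>) - real n * c) / s \<le> C + 1}"
      proof
        fix \<omega> assume "\<omega> \<in> space M - B"
        then have \<omega>: "\<omega> \<in> space M" "crane_samples n (\<lambda>j. Z j \<omega>) - E n < s" by (auto simp: B_def)
        have "crane_samples n (\<lambda>j. Z j \<omega>) - real n * c \<le> (C + 1) * s"
          using \<omega>(2) e[OF n] by (simp add: E_def s_def distrib_right)
        then show "\<omega> \<in> {\<omega> \<in> space M. (crane_samples n (\<lambda>j. Z j \<omega>) - real n * c) / s \<le> C + 1}"
          using \<omega>(1) s by (simp add: pos_divide_le_eq)
      qed
    qed measurable
    finally show "1 - exp (- a * ln (real n)) \<le>
      prob {\<omega> \<in> space M. (crane_samples n (\<lambda>j. Z j \<omega>) - real n * c) / sqrt (real n * ln (real n)) \<le> C + 1}"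
      by (simp add: s_def)
  qed
qed simp

theorem theorem3:
  fixes M :: "'m measure" and \<Omega> :: "'a::euclidean_space set"
    and \<phi>P \<phi>D :: "'a \<Rightarrow> real" and X Y :: "nat \<Rightarrow> 'm \<Rightarrow> 'a"
  assumes "prob_space M"
    and "compact \<Omega>"
    and "DIM('a) \<ge> 2"
    and "\<forall>x. 0 \<le> \<phi>P x" and "\<forall>x. 0 \<le> \<phi>D x"
    and "\<forall>i. distributed M lborel (X i) (\<lambda>x. ennreal (\<phi>P x))"
    and "\<forall>i. distributed M lborel (Y i) (\<lambda>x. ennreal (\<phi>D x))"
    and "\<forall>i. AE \<omega> in M. X i \<omega> \<in> \<Omega> \<and> Y i \<omega> \<in> \<Omega>"
    and "prob_space.indep_vars M (\<lambda>_. borel) (case_sum X Y) UNIV"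
  defines "L \<equiv> \<lambda>n \<omega>. stacker_crane_opt (\<lambda>i. X i \<omega>) (\<lambda>i. Y i \<omega>) n"
    and "c \<equiv> (\<integral>\<omega>. dist (X 0 \<omega>) (Y 0 \<omega>) \<partial>M) + wasserstein \<Omega> \<phi>D \<phi>P"
    and "d \<equiv> real DIM('a)"
  shows "(DIM('a) \<ge> 3 \<longrightarrow> (\<forall>\<beta>. beta_M_property TYPE('m) TYPE('a) \<beta> \<longrightarrow>
            (AE \<omega> in M.
               limsup (\<lambda>n. ereal ((L n \<omega> - real n * c) / real n powr (1 - 1 / d)))
               \<le> ereal (min (\<beta> * (\<integral>x\<in>\<Omega>. \<phi>P x powr (1 - 1 / d) \<partial>lborel))
                             (\<beta> * (\<integral>x\<in>\<Omega>. \<phi>D x powr (1 - 1 / d) \<partial>lborel))))))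
       \<and> (DIM('a) = 2 \<longrightarrow> (\<exists>\<gamma>>0.
            (\<lambda>n. measure M {\<omega> \<in> space M.
                    (L n \<omega> - real n * c) / sqrt (real n * ln (real n)) \<le> \<gamma>})
            \<longlonglongrightarrow> 1))"
proof -
  interpret prob_space M by fact
  note \<Omega> = \<open>compact \<Omega>\<close>
  define \<mu> \<nu> where "\<mu> = density lborel (\<lambda>x. ennreal (\<phi>P x))" and "\<nu> = density lborel (\<lambda>x. ennreal (\<phi>D x))"
  define XY where "XY = case_sum X Y"
  have dX: "distributed M lborel (X i) (\<lambda>x. ennreal (\<phi>P x))" and dY: "distributed M lborel (Y i) (\<lambda>x. ennreal (\<phi>D x))" for i
    using assms by auto
  have XYm [measurable]: "X i \<in> borel_measurable M" "Y i \<in> borel_measurable M" for i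
    using distributed_measurable[OF dX[of i]] distributed_measurable[OF dY[of i]] by simp_all
  have XYm' [measurable]: "XY j \<in> borel_measurable M" for j
    unfolding XY_def by (cases j) simp_all
  have lawX: "distr M borel (X i) = \<mu>" for i
  proof -
    have "distr M borel (X i) = distr M lborel (X i)" by (rule distr_cong) auto
    then show ?thesis using distributed_distr_eq_density[OF dX[of i]] by (simp add: \<mu>_def)
  qed
  have lawY: "distr M borel (Y i) = \<nu>" for i
  proof -
    have "distr M borel (Y i) = distr M lborel (Y i)" by (rule distr_cong) auto
    then show ?thesis using distributed_distr_eq_density[OF dY[of i]] by (simp add: \<nu>_def)
  qed
  have AE_XY: "AE \<omega> in M. XY j \<omega> \<in> \<Omega>" for j
    using assms(8) unfolding XY_def by (cases j) auto
  obtain x0 where x0: "x0 \<in> \<Omega>" using AE_happens[OF AE_XY[of "Inl 0"]] by blast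
  \<comment> \<open>The points lie in \<open>\<Omega>\<close> only almost surely. Redirecting the
    exceptional ones to \<open>x0\<close> alters the samples on a null set and preserves laws and
    independence.\<close>
  define p where "p x = (if x \<in> \<Omega> then x else x0)" for x
  have pm [measurable]: "p \<in> borel_measurable borel"
    unfolding p_def using borel_compact[OF \<Omega>] by measurable
  define Z where "Z j \<omega> = p (XY j \<omega>)" for j \<omega>
  have AE_Z: "AE \<omega> in M. \<forall>j. Z j \<omega> = XY j \<omega>"
    unfolding AE_all_countable
  proof
    fix j show "AE \<omega> in M. Z j \<omega> = XY j \<omega>"
      using AE_XY[of j] by (rule AE_mp) (auto simp: Z_def p_def)
  qed
  have Zm [measurable]: "Z j \<in> borel_measurable M" for j unfolding Z_def by measurable
  have lawZ: "distr M borel (Z j) = distr M borel (XY j)" for j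
  proof (rule distr_cong_AE)
    show "AE \<omega> in M. Z j \<omega> = XY j \<omega>" using AE_Z by (rule AE_mp) auto
  qed auto
  have lawZ_Inl: "distr M borel (Z (Inl i)) = \<mu>" and lawZ_Inr: "distr M borel (Z (Inr i)) = \<nu>" for i
    by (simp_all add: lawZ XY_def lawX lawY)
  define D where "D = diameter \<Omega> + 1"
  have bd: "bounded \<Omega>" using \<Omega> by (rule compact_imp_bounded)
  interpret S: crane_sample M Z \<Omega> \<mu> \<nu> D
  proof
    show "indep_vars (\<lambda>_. borel) Z UNIV"
      using indep_vars_compose2[OF assms(9), of "\<lambda>_. p" "\<lambda>_. borel"] pm unfolding Z_def XY_def by simp
    show "dist a b \<le> D" if "a \<in> \<Omega>" "b \<in> \<Omega>" for a b
      using diameter_bounded_bound[OF bd that] by (simp add: D_def)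
    show "D > 0" using diameter_ge_0[OF bd] by (simp add: D_def)
  qed (use lawZ_Inl lawZ_Inr \<Omega> x0 in \<open>auto simp: Z_def p_def\<close>)
  \<comment> \<open>Even indices for one sample and odd ones for the other: one infinite sample is
    split into two independent samples of the same law, on the original space.\<close>
  define eo :: "nat + nat \<Rightarrow> nat" where "eo = case_sum (\<lambda>i. 2 * i) (\<lambda>i. 2 * i + 1)"
  have "j = (if even (eo j) then Inl (eo j div 2) else Inr (eo j div 2))" for j
    by (cases j) (simp_all add: eo_def)
  then have "inj eo" by (metis injI)
  define V where "V h j = Z (h (eo j))" for h :: "nat \<Rightarrow> nat + nat" and j
  have VP: "crane_sample M (V Inl) \<Omega> \<mu> \<mu> D" and VD: "crane_sample M (V Inr) \<Omega> \<nu> \<nu> D"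
    unfolding V_def using \<open>inj eo\<close>
    by (auto intro!: S.crane_sample_reindex simp: lawZ_Inl lawZ_Inr inj_def)
  have "prob_space \<nu>" unfolding lawY[of 0, symmetric] by (rule prob_space_distr) simp
  have ne: "couplings \<Omega> \<phi>D \<phi>P \<noteq> {}"
  proof -
    \<comment> \<open>The joint law of an actual delivery and pickup is a coupling, so the infimum
      is not over an empty set.\<close>
    let ?\<gamma> = "distr M borel (\<lambda>\<omega>. (Y 0 \<omega>, X 0 \<omega>))"
    have m: "(\<lambda>\<omega>. (Y 0 \<omega>, X 0 \<omega>)) \<in> borel_measurable M" by measurable
    have \<Omega>\<Omega>: "\<Omega> \<times> \<Omega> \<in> sets borel" using \<Omega> by (intro borel_compact compact_Times)
    have AE0: "AE \<omega> in M. \<not> (Y 0 \<omega>, X 0 \<omega>) \<in> - (\<Omega> \<times> \<Omega>)" using assms(8) by auto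
    have "emeasure ?\<gamma> (space ?\<gamma> - \<Omega> \<times> \<Omega>) = emeasure M ((\<lambda>\<omega>. (Y 0 \<omega>, X 0 \<omega>)) -` (space ?\<gamma> - \<Omega> \<times> \<Omega>) \<inter> space M)"
      using \<Omega>\<Omega> by (intro emeasure_distr m) auto
    also have "(\<lambda>\<omega>. (Y 0 \<omega>, X 0 \<omega>)) -` (space ?\<gamma> - \<Omega> \<times> \<Omega>) \<inter> space M =
        {\<omega> \<in> space M. (Y 0 \<omega>, X 0 \<omega>) \<in> - (\<Omega> \<times> \<Omega>)}" by auto
    also have "emeasure M \<dots> = 0" by (rule emeasure_eq_0_AE[OF AE0])
    finally have "emeasure ?\<gamma> (space ?\<gamma> - \<Omega> \<times> \<Omega>) = 0" .
    moreover have "distr ?\<gamma> borel fst = density lborel (\<lambda>x. ennreal (\<phi>D x))"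
      using lawY[of 0] m by (subst distr_distr) (auto simp: comp_def \<nu>_def borel_prod[symmetric])
    moreover have "distr ?\<gamma> borel snd = density lborel (\<lambda>x. ennreal (\<phi>P x))"
      using lawX[of 0] m by (subst distr_distr) (auto simp: comp_def \<mu>_def borel_prod[symmetric])
    ultimately have "?\<gamma> \<in> couplings \<Omega> \<phi>D \<phi>P" by (simp add: couplings_def)
    then show ?thesis by blast
  qed
  define W where "W = wasserstein \<Omega> \<phi>D \<phi>P"
  define m where "m h n = expectation (\<lambda>\<omega>. match_samples n (\<lambda>j. V h j \<omega>))" for h n
  have match_le: "expectation (\<lambda>\<omega>. match_samples n (\<lambda>j. Z j \<omega>)) \<le> real n * W + m h n"
    if h: "h = Inl \<or> h = Inr" and n: "n \<ge> 1" for h n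
  proof (rule field_le_epsilon)
    fix \<epsilon> :: real assume "\<epsilon> > 0"
    then have \<epsilon>n: "\<epsilon> / real n > 0" using n by simp
    \<comment> \<open>Over \<open>n\<close> pairs, a coupling within \<epsilon> / n of the infimum
      costs at most \<epsilon> more.\<close>
    obtain \<gamma> where \<gamma>: "prob_space \<gamma>" "sets \<gamma> = sets borel" "distr \<gamma> borel fst = \<nu>" "distr \<gamma> borel snd = \<mu>"
      "AE z in \<gamma>. fst z \<in> \<Omega> \<and> snd z \<in> \<Omega>" "(\<integral>z. dist (fst z) (snd z) \<partial>\<gamma>) \<le> W + \<epsilon> / real n"
      unfolding W_def \<mu>_def \<nu>_def
      by (rule coupling_near_optimal[OF \<Omega> ne \<open>prob_space \<nu>\<close>[unfolded \<nu>_def] \<epsilon>n])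
    have "expectation (\<lambda>\<omega>. match_samples n (\<lambda>j. Z j \<omega>)) \<le> real n * (\<integral>z. dist (fst z) (snd z) \<partial>\<gamma>) + m h n"
      unfolding m_def using h VP VD by (intro S.expectation_match_le_coupling[OF \<gamma>(1-5)]) auto
    also have "\<dots> \<le> real n * (W + \<epsilon> / real n) + m h n"
      using \<gamma>(6) by (intro add_right_mono mult_left_mono) auto
    also have "\<dots> = real n * W + m h n + \<epsilon>" using n by (simp add: distrib_left)
    finally show "expectation (\<lambda>\<omega>. match_samples n (\<lambda>j. Z j \<omega>)) \<le> real n * W + m h n + \<epsilon>" .
  qed
  have "(\<integral>\<omega>. dist (X 0 \<omega>) (Y 0 \<omega>) \<partial>M) = expectation (\<lambda>\<omega>. dist (Z (Inl 0) \<omega>) (Z (Inr 0) \<omega>))"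
    using AE_Z by (intro integral_cong_AE) (auto elim!: AE_mp simp: XY_def)
  then have crane_le: "expectation (\<lambda>\<omega>. crane_samples n (\<lambda>j. Z j \<omega>)) \<le> real n * c + m h n + 2 * D * harm n"
    if h: "h = Inl \<or> h = Inr" and n: "n \<ge> 1" for h n
    using S.expectation_crane_le[OF n] match_le[OF h n] by (simp add: c_def W_def distrib_left)
  have L_eq: "AE \<omega> in M. \<forall>n. L n \<omega> = crane_samples n (\<lambda>j. Z j \<omega>)"
    using AE_Z by (rule AE_mp) (auto simp: L_def XY_def)
  have Lm: "L n \<in> borel_measurable M" for n unfolding L_def by measurable
  show ?thesis
  proof (intro conjI impI allI)
    fix \<beta> assume dim: "DIM('a) \<ge> 3" and \<beta>: "beta_M_property TYPE('m) TYPE('a) \<beta>"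
    have q: "1 - 1 / d \<ge> 2 / 3" unfolding d_def using dim by (simp add: field_simps)
    have \<phi>m: "(\<lambda>x. ennreal (\<phi>P x)) \<in> borel_measurable lborel" "(\<lambda>x. ennreal (\<phi>D x)) \<in> borel_measurable lborel"
      using dX[of 0] dY[of 0] by (auto simp: distributed_def)
    have "(\<lambda>n. m Inl n / real n powr (1 - 1 / d)) \<longlonglongrightarrow> \<beta> * (\<integral>x\<in>\<Omega>. \<phi>P x powr (1 - 1 / d) \<partial>lborel)"
      unfolding m_def d_def
      by (rule crane_sample.expectation_match_limit[OF VP \<mu>_def \<mu>_def _ \<phi>m(1) dim \<beta>]) (use assms(4) in auto)
    from S.AE_limsup_crane_le[OF q this crane_le]
    have P: "AE \<omega> in M. limsup (\<lambda>n. ereal ((crane_samples n (\<lambda>j. Z j \<omega>) - real n * c) / real n powr (1 - 1 / d)))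
        \<le> ereal (\<beta> * (\<integral>x\<in>\<Omega>. \<phi>P x powr (1 - 1 / d) \<partial>lborel))" by simp
    have "(\<lambda>n. m Inr n / real n powr (1 - 1 / d)) \<longlonglongrightarrow> \<beta> * (\<integral>x\<in>\<Omega>. \<phi>D x powr (1 - 1 / d) \<partial>lborel)"
      unfolding m_def d_def
      by (rule crane_sample.expectation_match_limit[OF VD \<nu>_def \<nu>_def _ \<phi>m(2) dim \<beta>]) (use assms(5) in auto)
    from S.AE_limsup_crane_le[OF q this crane_le]
    have "AE \<omega> in M. limsup (\<lambda>n. ereal ((crane_samples n (\<lambda>j. Z j \<omega>) - real n * c) / real n powr (1 - 1 / d)))
        \<le> ereal (\<beta> * (\<integral>x\<in>\<Omega>. \<phi>D x powr (1 - 1 / d) \<partial>lborel))" by simp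
    \<comment> \<open>Both bounds hold on a common almost sure event, whence the minimum.\<close>
    with P L_eq show "AE \<omega> in M. limsup (\<lambda>n. ereal ((L n \<omega> - real n * c) / real n powr (1 - 1 / d)))
       \<le> ereal (min (\<beta> * (\<integral>x\<in>\<Omega>. \<phi>P x powr (1 - 1 / d) \<partial>lborel))
                     (\<beta> * (\<integral>x\<in>\<Omega>. \<phi>D x powr (1 - 1 / d) \<partial>lborel)))"
      by eventually_elim (simp add: min_def)
  next
    assume dim: "DIM('a) = 2"
    obtain R where R: "R > 0" "\<And>x. x \<in> \<Omega> \<Longrightarrow> norm x \<le> R" using bd bounded_pos by blast
    interpret V: crane_sample M "V Inr" \<Omega> \<nu> \<nu> D by (rule VD)
    \<comment> \<open>\<open>96 * R\<close> comes from the planar matching; \<open>6 * D\<close> is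
      2 * D * 3, the merging cost \<open>2 * D * harm n\<close> with \<open>harm n\<close> at most 3
      sqrt (n ln n).\<close>
    define C where "C = 96 * R + 6 * D"
    have C: "C > 0" using R S.D_pos by (simp add: C_def add_pos_pos)
    have "expectation (\<lambda>\<omega>. crane_samples n (\<lambda>j. Z j \<omega>)) \<le> real n * c + C * sqrt (real n * ln (real n))"
      if n: "n \<ge> 2" for n
    proof -
      have "m Inr n \<le> 96 * R * sqrt (real n * ln (real n))"
        unfolding m_def
      proof (rule expectation_matching_cost_plane_le[OF dim V.indep _ _ R(1) n])
        show "distr M borel (V Inr j) = \<nu>" for j by (cases j) (simp_all add: V.law_Inl V.law_Inr)
        show "norm (V Inr j \<omega>) \<le> R" if "\<omega> \<in> space M" for j \<omega> by (rule R(2)[OF V.Z_in[OF that]])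
      qed
      moreover have "harm n \<le> 3 * sqrt (real n * ln (real n))"
      proof -
        have "ln (1 / 2 :: real) \<le> 1 / 2 - 1" by (rule ln_le_minus_one) simp
        then have "1 / 2 \<le> ln (2::real)" by (simp add: ln_div)
        also have "\<dots> \<le> ln (real n)" using n by simp
        finally have l: "1 / 2 \<le> ln (real n)" .
        have "harm n \<le> 1 + ln (real n)" using n by (intro harm_le_1_plus_ln) simp
        also have "\<dots> \<le> 3 * ln (real n)" using l by simp
        also have "ln (real n) \<le> sqrt (real n * ln (real n))"
        proof (rule real_le_rsqrt)
          have "ln (real n) \<le> real n" using n ln_le_minus_one[of "real n"] by simp
          then show "(ln (real n))\<^sup>2 \<le> real n * ln (real n)"
            unfolding power2_eq_square using l by (intro mult_right_mono) auto
        qed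
        finally show ?thesis by simp
      qed
      then have "2 * D * harm n \<le> 2 * D * (3 * sqrt (real n * ln (real n)))"
        using S.D_pos by (intro mult_left_mono) auto
      ultimately show ?thesis using crane_le[of Inr n] n by (simp add: C_def distrib_right)
    qed
    then have lim: "(\<lambda>n. prob {\<omega> \<in> space M. (crane_samples n (\<lambda>j. Z j \<omega>) - real n * c) / sqrt (real n * ln (real n)) \<le> C + 1})
        \<longlonglongrightarrow> 1"
      by (rule S.crane_probability_tendsto_1)
    have "prob {\<omega> \<in> space M. (crane_samples n (\<lambda>j. Z j \<omega>) - real n * c) / sqrt (real n * ln (real n)) \<le> C + 1} =
        prob {\<omega> \<in> space M. (L n \<omega> - real n * c) / sqrt (real n * ln (real n)) \<le> C + 1}" for n
    proof (rule measure_eq_AE)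
      show "AE \<omega> in M. (\<omega> \<in> {\<omega> \<in> space M. (crane_samples n (\<lambda>j. Z j \<omega>) - real n * c) / sqrt (real n * ln (real n)) \<le> C + 1}) =
          (\<omega> \<in> {\<omega> \<in> space M. (L n \<omega> - real n * c) / sqrt (real n * ln (real n)) \<le> C + 1})"
        using L_eq by eventually_elim simp
      show "{\<omega> \<in> space M. (L n \<omega> - real n * c) / sqrt (real n * ln (real n)) \<le> C + 1} \<in> events"
        using Lm[of n] by measurable
    qed measurable
    then show "\<exists>\<gamma>>0. (\<lambda>n. measure M {\<omega> \<in> space M. (L n \<omega> - real n * c) / sqrt (real n * ln (real n)) \<le> \<gamma>}) \<longlonglongrightarrow> 1"
      using lim C by (intro exI[of _ "C + 1"]) simp
  qed
qed

end
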